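(* Let $d\ge 2$. For a full measure set of full-rank lattices $\Gamma\subset\mathbb{R}^d$, the flat torus $\mathbb{T}_\Gamma=\mathbb{R}^d/\Gamma$ does not have the inverse localization property. However, $\mathbb{T}_\Gamma$ does have the inverse localization property whenever $\Gamma\subset\mathbb{R}^d$ is a full-rank lattice such that $r\,\Gamma\subset\mathbb{Z}^d$ for some $r>0$.
   Context: Functions are real-valued. The set of full-rank lattices of $\mathbb{R}^d$ is $\mathrm{GL}_d(\mathbb{R})/\mathrm{GL}_d(\mathbb{Z})$ (the lattice $\Gamma=A\mathbb{Z}^d$ corresponds to the class of $A$); a property holds for a full measure set of lattices if the set of matrices $A\in\mathrm{GL}_d(\mathbb{R})\subset\mathbb{R}^{d^2}$ for which it fails for $\Gamma=A\mathbb{Z}^d$ has Lebesgue measure zero. A Laplace eigenfunction $u$ on $\mathbb{T}_\Gamma$ with eigenvalue $\lambda\ge0$ is viewed as a $\Gamma$-periodic function on $\mathbb{R}^d$ with $\Delta u+\lambda u=0$. Inverse localization property: $\mathbb{T}_\Gamma$ has it if for any solution $h$ of the Helmholtz equation $\Delta h+h=0$ on $\mathbb{R}^d$, any ball $B\subset\mathbb{R}^d$ and any positive integer $l$, there exists a sequence of Laplace eigenfunctions $u_n$ on $\mathbb{T}_\Gamma$ with eigenvalues $\lambda_n\to\infty$ such that $\lim_{n\to\infty}\|u_n(\cdot/\sqrt{\lambda_n})-h\|_{C^l(B)}=0$. *)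

theory Defs
  imports "HOL-Analysis.Analysis"
begin

definition int_lattice :: "(real ^ 'n) set" where
  "int_lattice = {z. \<forall>i. z $ i \<in> \<int>}"

definition lattice_of :: "real ^ 'n ^ 'n \<Rightarrow> (real ^ 'n) set" where
  "lattice_of A = (\<lambda>z. A *v z) ` int_lattice"

definition full_rank_lattice :: "(real ^ 'n) set \<Rightarrow> bool" where
  "full_rank_lattice \<Gamma> \<longleftrightarrow> (\<exists>A :: real ^ 'n ^ 'n. invertible A \<and> \<Gamma> = lattice_of A)"

definition partial :: "'n \<Rightarrow> (real ^ 'n \<Rightarrow> real) \<Rightarrow> real ^ 'n \<Rightarrow> real" where
  "partial i f x = frechet_derivative f (at x) (axis i 1)"

text \<open>Derivatives of order k are indexed by lists of k coordinate directions rather than by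
  multi-indices; the last direction of the list is differentiated first.\<close>

fun partials :: "'n list \<Rightarrow> (real ^ 'n \<Rightarrow> real) \<Rightarrow> real ^ 'n \<Rightarrow> real" where
  "partials [] f = f"
| "partials (i # is) f = partial i (partials is f)"

definition smooth :: "(real ^ 'n \<Rightarrow> real) \<Rightarrow> bool" where
  "smooth f \<longleftrightarrow> (\<forall>is x. partials is f differentiable (at x))"

definition laplacian :: "(real ^ 'n \<Rightarrow> real) \<Rightarrow> real ^ 'n \<Rightarrow> real" where
  "laplacian f x = (\<Sum>i\<in>UNIV. partials [i, i] f x)"

text \<open>The supremum is meant for a bounded nonempty set and a smooth function: it is then
  the supremum of a bounded nonempty set of reals.\<close>

definition Cl_norm :: "nat \<Rightarrow> (real ^ 'n) set \<Rightarrow> (real ^ 'n \<Rightarrow> real) \<Rightarrow> real" where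
  "Cl_norm l B f = (SUP (is, x) \<in> {is. length is \<le> l} \<times> B. \<bar>partials is f x\<bar>)"

text \<open>Solutions are taken in the classical smooth sense. By elliptic regularity every
  distributional solution is of this kind.\<close>

definition helmholtz_solution :: "(real ^ 'n \<Rightarrow> real) \<Rightarrow> bool" where
  "helmholtz_solution h \<longleftrightarrow> smooth h \<and> (\<forall>x. laplacian h x + h x = 0)"

definition torus_eigenfunction ::
    "(real ^ 'n) set \<Rightarrow> real \<Rightarrow> (real ^ 'n \<Rightarrow> real) \<Rightarrow> bool" where
  "torus_eigenfunction \<Gamma> \<mu> u \<longleftrightarrow>
     \<mu> \<ge> 0 \<and> smooth u \<and> (\<exists>x. u x \<noteq> 0) \<and>
     (\<forall>x. \<forall>\<gamma>\<in>\<Gamma>. u (x + \<gamma>) = u x) \<and>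
     (\<forall>x. laplacian u x + \<mu> * u x = 0)"

definition inverse_localization :: "(real ^ 'n) set \<Rightarrow> bool" where
  "inverse_localization \<Gamma> \<longleftrightarrow>
     (\<forall>h c R. \<forall>l::nat. helmholtz_solution h \<and> R > 0 \<and> l \<ge> 1 \<longrightarrow>
        (\<exists>(u :: nat \<Rightarrow> real ^ 'n \<Rightarrow> real) (\<mu> :: nat \<Rightarrow> real).
           (\<forall>n. torus_eigenfunction \<Gamma> (\<mu> n) (u n)) \<and>
           filterlim \<mu> at_top sequentially \<and>
           (\<lambda>n. Cl_norm l (ball c R) (\<lambda>x. u n (x /\<^sub>R sqrt (\<mu> n)) - h x)) \<longlonglongrightarrow> 0))"

end

theory Submission
  imports Defs "HOL-Combinatorics.Stirling"
begin

text \<open>For almost every lattice the Laplace spectrum of the torus is as simple as possible: dual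
  vectors of equal length agree up to sign. Every eigenfunction is then a single plane wave, and
  rescaled plane waves cannot approximate \<open>cos x\<^sub>i + cos x\<^sub>j\<close> in \<open>C\<^sup>1\<close>.

  For a lattice inside a multiple of \<open>\<int>\<^sup>d\<close>, finite sums of plane waves with rational unit
  frequencies become eigenfunctions of arbitrarily high energy after dilation, so it suffices to show
  that such sums are dense among the solutions of the Helmholtz equation. By Bernstein estimates global
  solutions are entire, hence determined with good bounds by their Cauchy data on a hyperplane. The
  Taylor polynomials of the Cauchy data are approximated by finite differences of exponentials of
  small frequency \<open>\<xi>'\<close>, and such an exponential extends to the plane waves of the unit frequencies
  \<open>(\<xi>', \<plusminus> sqrt (1 - |\<xi>'|\<^sup>2))\<close>. Finally rational unit vectors are dense in the sphere.\<close>

section \<open>Iterated partial derivatives\<close>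

text \<open>The Cauchy problem for an elliptic equation is ill-posed: data that are small on a
  hyperplane do not control the solution. But on a given ball the derivatives of order
  \<open>k\<close> of a global solution are at most \<open>C * \<epsilon> ^ k * fact k\<close> for
  every \<open>\<epsilon> > 0\<close>. So Cauchy data are compared through all their Taylor
  coefficients at one point, against a majorant with convergent Taylor series, and not in a sup
  norm. Frequencies clustered at the two poles of one axis then suffice. Only uniform approximation
  has to be arranged: the difference of two solutions is a solution, and the gradient bound turns
  sup bounds on a larger ball into \<open>C^l\<close> bounds on a smaller one. For generic lattices,
  Green's identity and Stone-Weierstrass replace Fourier series: the former makes eigenfunctions of
  different eigenvalues orthogonal, the latter makes a function orthogonal to all waves vanish.
  Exceptional matrices are covered by countably many sets, one for each pair of integer vectors,
  each the image under the inverse transpose of the solutions of a nontrivial quadratic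
  equation.\<close>

lemma partials_append: "partials (xs @ ys) f = partials xs (partials ys f)"
  by (induction xs) auto

lemma smooth_partials: "smooth f \<Longrightarrow> smooth (partials is f)"
  unfolding smooth_def by (simp flip: partials_append)

lemma smooth_partial: "smooth f \<Longrightarrow> smooth (partial i f)"
  using smooth_partials[of f "[i]"] by simp

lemma smooth_differentiable: "smooth f \<Longrightarrow> partials is f differentiable (at x)"
  by (simp add: smooth_def)

lemma smooth_differentiable0: "smooth f \<Longrightarrow> f differentiable (at x)"
  using smooth_differentiable[of f "[]"] by simp

lemma smooth_continuous_on: "smooth f \<Longrightarrow> continuous_on S f"
  by (meson continuous_at_imp_continuous_on differentiable_imp_continuous_within smooth_differentiable0)

lemma has_derivative_partials:
  fixes f :: "real ^ 'n \<Rightarrow> real"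
  assumes "f differentiable (at x)"
  shows "(f has_derivative (\<lambda>v. \<Sum>i\<in>UNIV. v $ i * partial i f x)) (at x)"
proof -
  let ?D = "frechet_derivative f (at x)"
  have D: "(f has_derivative ?D) (at x)"
    using frechet_derivative_works assms by blast
  have "?D v = (\<Sum>i\<in>UNIV. v $ i * partial i f x)" for v
  proof -
    have lin: "linear ?D" using D has_derivative_linear by blast
    have "?D v = ?D (\<Sum>i\<in>UNIV. v $ i *\<^sub>R axis i 1)"
      using basis_expansion[of v] by (simp add: scalar_mult_eq_scaleR)
    also have "\<dots> = (\<Sum>i\<in>UNIV. v $ i * ?D (axis i 1))"
      by (simp add: linear_sum[OF lin] linear_cmul[OF lin])
    finally show ?thesis by (simp add: partial_def)
  qed
  then have eq: "?D = (\<lambda>v. \<Sum>i\<in>UNIV. v $ i * partial i f x)" by blast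
  show ?thesis using D unfolding eq .
qed

text \<open>Written through \<open>partial\<close> rather than through the Frechet derivative, so
  that iterates expand into \<open>partials\<close> and inherit smoothness from finite sums.\<close>

definition dird :: "real ^ 'n \<Rightarrow> (real ^ 'n \<Rightarrow> real) \<Rightarrow> real ^ 'n \<Rightarrow> real" where
  "dird v f x = (\<Sum>i\<in>UNIV. v $ i * partial i f x)"

lemma has_real_derivative_along_line:
  fixes f :: "real ^ 'n \<Rightarrow> real"
  assumes "f differentiable (at (x + t *\<^sub>R v))"
  shows "((\<lambda>t. f (x + t *\<^sub>R v)) has_real_derivative dird v f (x + t *\<^sub>R v)) (at t)"
proof -
  have "((\<lambda>t. f (x + t *\<^sub>R v)) has_derivative
      (\<lambda>h. \<Sum>i\<in>UNIV. (h *\<^sub>R v) $ i * partial i f (x + t *\<^sub>R v))) (at t)"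
    by (rule has_derivative_compose[where f="\<lambda>t. x + t *\<^sub>R v", OF _ has_derivative_partials[OF assms]])
       (auto intro!: derivative_eq_intros)
  then show ?thesis
    unfolding has_field_derivative_def dird_def
    by (rule has_derivative_eq_rhs) (simp add: sum_distrib_left fun_eq_iff mult_ac)
qed

lemmas smooth_line_deriv = has_real_derivative_along_line[OF smooth_differentiable0]

lemma dird_axis [simp]: "dird (axis i 1) f = partial i f"
  by (auto simp: dird_def axis_def fun_eq_iff if_distrib[of "\<lambda>a. a * _"] cong: if_cong)

lemma smooth_axis_deriv:
  assumes "smooth f"
  shows "((\<lambda>t. f (x + t *\<^sub>R axis i 1)) has_real_derivative partial i f (x + t *\<^sub>R axis i 1)) (at t)"
  using smooth_line_deriv[OF assms, of x "axis i 1" t] by simp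

lemma has_derivative_partial:
  "(f has_derivative f') (at x) \<Longrightarrow> partial i f x = f' (axis i 1)"
  by (metis frechet_derivative_at partial_def)

lemma partial_lincomb:
  assumes "f differentiable (at x)" "g differentiable (at x)"
  shows "partial i (\<lambda>x. a * f x + b * g x) x = a * partial i f x + b * partial i g x"
proof -
  have "((\<lambda>x. a * f x + b * g x) has_derivative
     (\<lambda>v. a * frechet_derivative f (at x) v + b * frechet_derivative g (at x) v)) (at x)"
    using assms[THEN frechet_derivative_works[THEN iffD1]]
    by (intro has_derivative_add has_derivative_mult_right)
  from has_derivative_partial[OF this] show ?thesis by (simp add: partial_def)
qed

lemma partials_lincomb:
  assumes "smooth f" "smooth g"
  shows "partials is (\<lambda>x. a * f x + b * g x) = (\<lambda>x. a * partials is f x + b * partials is g x)"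
  using assms by (induction "is") (auto simp: partial_lincomb smooth_differentiable)

lemma smooth_lincomb:
  assumes "smooth f" "smooth g"
  shows "smooth (\<lambda>x. a * f x + b * g x)"
  unfolding smooth_def using assms by (auto simp: partials_lincomb smooth_differentiable)

lemma smooth_const [simp]: "smooth (\<lambda>x. c)" and partials_const: "is \<noteq> [] \<Longrightarrow> partials is (\<lambda>x. c) = (\<lambda>x. 0)"
proof -
  have p: "partial i (\<lambda>x. c) = (\<lambda>x. 0)" for i and c :: real
    by (rule ext) (simp add: partial_def)
  have q: "partials is (\<lambda>x. c) = (if is = [] then (\<lambda>x. c) else (\<lambda>x. 0))" for "is" and c :: real
    by (induction "is") (auto simp: p)
  show "smooth (\<lambda>x. c)" unfolding smooth_def by (auto simp: q)
  show "is \<noteq> [] \<Longrightarrow> partials is (\<lambda>x. c) = (\<lambda>x. 0)" by (simp add: q)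
qed

lemma smooth_diff: "smooth f \<Longrightarrow> smooth g \<Longrightarrow> smooth (\<lambda>x. f x - g x)"
  and smooth_add: "smooth f \<Longrightarrow> smooth g \<Longrightarrow> smooth (\<lambda>x. f x + g x)"
  and smooth_cmult: "smooth f \<Longrightarrow> smooth (\<lambda>x. a * f x)"
  using smooth_lincomb[of f g 1 "-1"] smooth_lincomb[of f g 1 1] smooth_lincomb[of f "\<lambda>x. 0" a 0]
  by simp_all

lemma partials_diff: "smooth f \<Longrightarrow> smooth g \<Longrightarrow>
    partials is (\<lambda>x. f x - g x) = (\<lambda>x. partials is f x - partials is g x)"
  and partials_add: "smooth f \<Longrightarrow> smooth g \<Longrightarrow>
    partials is (\<lambda>x. f x + g x) = (\<lambda>x. partials is f x + partials is g x)"
  and partials_cmult: "smooth f \<Longrightarrow>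
    partials is (\<lambda>x. a * f x) = (\<lambda>x. a * partials is f x)"
  using partials_lincomb[of f g "is" 1 "-1"] partials_lincomb[of f g "is" 1 1]
    partials_lincomb[of f "\<lambda>x. 0" "is" a 0]
  by simp_all

lemma smooth_sum: "(\<And>j. j \<in> J \<Longrightarrow> smooth (f j)) \<Longrightarrow> smooth (\<lambda>x. \<Sum>j\<in>J. f j x)"
  by (induction J rule: infinite_finite_induct) (auto intro: smooth_add)

lemma partials_sum:
  "(\<And>j. j \<in> J \<Longrightarrow> smooth (f j)) \<Longrightarrow>
    partials is (\<lambda>x. \<Sum>j\<in>J. f j x) x = (\<Sum>j\<in>J. partials is (f j) x)"
proof (induction J rule: infinite_finite_induct)
  case (insert j J)
  then show ?case by (simp add: partials_add smooth_sum)
qed (cases "is"; auto simp: partials_const simp del: partials.simps(2))+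

lemma partials_dilate:
  assumes "smooth f"
  shows "partials is (\<lambda>x. f (c *\<^sub>R x)) = (\<lambda>x. c ^ length is * partials is f (c *\<^sub>R x))"
proof (induction "is")
  case (Cons i "is")
  show ?case
  proof
    fix x
    let ?g = "partials is f"
    have "((\<lambda>x. c ^ length is * ?g (c *\<^sub>R x)) has_derivative
        (\<lambda>v. c ^ length is * frechet_derivative ?g (at (c *\<^sub>R x)) (c *\<^sub>R v))) (at x)"
      by (rule has_derivative_mult_right, rule has_derivative_compose[OF has_derivative_scaleR_right[OF has_derivative_ident]],
          rule frechet_derivative_works[THEN iffD1], rule smooth_differentiable[OF assms])
    from has_derivative_partial[OF this, of i]
    show "partials (i # is) (\<lambda>x. f (c *\<^sub>R x)) x = c ^ length (i # is) * partials (i # is) f (c *\<^sub>R x)"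
      using linear_cmul[OF linear_frechet_derivative[OF smooth_differentiable[OF assms, of "is" "c *\<^sub>R x"]], of c]
      by (simp add: Cons partial_def)
  qed
qed auto

lemma smooth_dilate:
  assumes "smooth f"
  shows "smooth (\<lambda>x. f (c *\<^sub>R x))"
  unfolding smooth_def partials_dilate[OF assms]
proof (intro allI differentiable_mult differentiable_const)
  fix "is" x
  show "(\<lambda>x. partials is f (c *\<^sub>R x)) differentiable at x"
    by (rule differentiable_compose[where f="partials is f" and g="\<lambda>x. c *\<^sub>R x"])
       (auto intro: smooth_differentiable assms)
qed

text \<open>Two mean value steps, in either order, express the second difference over a square of
  side \<open>t\<close> as \<open>t * t\<close> times a mixed derivative at a nearby point. Both
  mixed derivatives are continuous because \<open>smooth\<close> makes them differentiable.\<close>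

lemma partial_commute:
  fixes f :: "real ^ 'n \<Rightarrow> real"
  assumes f: "smooth f"
  shows "partial i (partial j f) x = partial j (partial i f) x"
proof -
  have key: "\<exists>s r. 0 \<le> s \<and> s \<le> t \<and> 0 \<le> r \<and> r \<le> t \<and>
      f (x + t *\<^sub>R axis i 1 + t *\<^sub>R axis j 1) - f (x + t *\<^sub>R axis i 1) - f (x + t *\<^sub>R axis j 1) + f x
        = t * t * partial j (partial i f) (x + s *\<^sub>R axis i 1 + r *\<^sub>R axis j 1)"
    if "t > 0" for t :: real and i j
  proof -
    define g where "g = (\<lambda>s. f ((x + t *\<^sub>R axis j 1) + s *\<^sub>R axis i 1) - f (x + s *\<^sub>R axis i 1))"
    have "\<exists>z>0. z < t \<and> g t - g 0 = (t - 0) * (partial i f ((x + t *\<^sub>R axis j 1) + z *\<^sub>R axis i 1) - partial i f (x + z *\<^sub>R axis i 1))"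
      unfolding g_def by (rule MVT2[OF that]) (intro DERIV_diff smooth_axis_deriv f)
    then obtain s where s: "0 < s" "s < t" and gs: "g t - g 0 = t * (partial i f ((x + t *\<^sub>R axis j 1) + s *\<^sub>R axis i 1) - partial i f (x + s *\<^sub>R axis i 1))"
      by auto
    define y where "y = x + s *\<^sub>R axis i 1"
    have "\<exists>z>0. z < t \<and> partial i f (y + t *\<^sub>R axis j 1) - partial i f (y + 0 *\<^sub>R axis j 1)
           = (t - 0) * partial j (partial i f) (y + z *\<^sub>R axis j 1)"
      by (rule MVT2[OF that]) (intro smooth_axis_deriv smooth_partial f)
    then obtain r where r: "0 < r" "r < t" and
      e: "partial i f (y + t *\<^sub>R axis j 1) - partial i f y = t * partial j (partial i f) (y + r *\<^sub>R axis j 1)"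
      by auto
    have "g t - g 0 = t * t * partial j (partial i f) (x + s *\<^sub>R axis i 1 + r *\<^sub>R axis j 1)"
      using gs e by (simp add: y_def algebra_simps)
    then show ?thesis using s r
      by (intro exI[of _ s] exI[of _ r]) (simp add: g_def algebra_simps)
  qed
  define q where "q = (\<lambda>t. (f (x + t *\<^sub>R axis i 1 + t *\<^sub>R axis j 1) - f (x + t *\<^sub>R axis i 1)
        - f (x + t *\<^sub>R axis j 1) + f x) / (t * t))"
  have lim: "(h \<longlongrightarrow> G x) (at_right 0)"
    if G: "continuous (at x) G" and h: "\<And>t. t > 0 \<Longrightarrow>
      \<exists>s r. 0 \<le> s \<and> s \<le> t \<and> 0 \<le> r \<and> r \<le> t \<and> h t = G (x + s *\<^sub>R axis k 1 + r *\<^sub>R axis l 1)"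
    for h :: "real \<Rightarrow> real" and G and k l :: 'n
  proof (rule tendstoI)
    fix e :: real assume "e > 0"
    with G obtain d where d: "d > 0" "\<And>y. dist y x < d \<Longrightarrow> dist (G y) (G x) < e"
      unfolding continuous_at_eps_delta by metis
    show "\<forall>\<^sub>F t in at_right 0. dist (h t) (G x) < e"
      unfolding eventually_at_right_field
    proof (intro exI[of _ "d / 2"] conjI allI impI)
      fix t assume t: "0 < t" "t < d / 2"
      obtain s r where sr: "0 \<le> s" "s \<le> t" "0 \<le> r" "r \<le> t" "h t = G (x + s *\<^sub>R axis k 1 + r *\<^sub>R axis l 1)"
        using h[OF t(1)] by blast
      have "dist (x + s *\<^sub>R axis k 1 + r *\<^sub>R axis l 1) x = norm (s *\<^sub>R (axis k 1 :: real ^ 'n) + r *\<^sub>R axis l 1)"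
        by (simp add: dist_norm algebra_simps)
      also have "\<dots> \<le> s + r"
        using norm_triangle_ineq[of "s *\<^sub>R (axis k 1 :: real ^ 'n)" "r *\<^sub>R axis l 1"] sr by simp
      also have "\<dots> < d" using sr t by linarith
      finally show "dist (h t) (G x) < e" using d(2) sr(5) by simp
    qed (use d in auto)
  qed
  have c: "continuous (at x) (partial k (partial l f))" for k l
    using differentiable_imp_continuous_within[OF smooth_differentiable[OF f, of "[k,l]" x]] by simp
  have 1: "(q \<longlongrightarrow> partial j (partial i f) x) (at_right 0)"
  proof (rule lim[OF c, where k=i and l=j])
    fix t :: real assume t: "t > 0"
    from key[OF t, of i j] show "\<exists>s r. 0 \<le> s \<and> s \<le> t \<and> 0 \<le> r \<and> r \<le> t \<and> q t = partial j (partial i f) (x + s *\<^sub>R axis i 1 + r *\<^sub>R axis j 1)"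
      using t by (fastforce simp: q_def field_simps)
  qed
  have 2: "(q \<longlongrightarrow> partial i (partial j f) x) (at_right 0)"
  proof (rule lim[OF c, where k=j and l=i])
    fix t :: real assume t: "t > 0"
    obtain s r where "0 \<le> s \<and> s \<le> t \<and> 0 \<le> r \<and> r \<le> t" and e:
      "f (x + t *\<^sub>R axis j 1 + t *\<^sub>R axis i 1) - f (x + t *\<^sub>R axis j 1) - f (x + t *\<^sub>R axis i 1) + f x
        = t * t * partial i (partial j f) (x + s *\<^sub>R axis j 1 + r *\<^sub>R axis i 1)"
      using key[OF t, of j i] by blast
    moreover have "q t = partial i (partial j f) (x + s *\<^sub>R axis j 1 + r *\<^sub>R axis i 1)"
      using t e by (simp add: q_def field_simps)
    ultimately show "\<exists>s r. 0 \<le> s \<and> s \<le> t \<and> 0 \<le> r \<and> r \<le> t \<and> q t = partial i (partial j f) (x + s *\<^sub>R axis j 1 + r *\<^sub>R axis i 1)"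
      by blast
  qed
  show ?thesis using tendsto_unique[OF _ 2 1] by simp
qed

lemma partials_swap: "smooth f \<Longrightarrow> partials (i # j # is) f = partials (j # i # is) f"
  by (auto simp: partial_commute smooth_partials)

lemma partials_snoc: "smooth f \<Longrightarrow> partials (is @ [i]) f = partials (i # is) f"
proof (induction "is")
  case (Cons j "is")
  have "partials ((j # is) @ [i]) f = partials (j # i # is) f"
    using Cons by simp
  then show ?case using partials_swap[OF Cons.prems] by metis
qed auto

text \<open>Lists stand for multi-indices; this lemma justifies counting and moving occurrences of a
  direction.\<close>

lemma partials_mset_cong:
  assumes "smooth f" "mset xs = mset ys"
  shows "partials xs f = partials ys f"
  using assms(2)
proof (induction xs arbitrary: ys)
  case (Cons x xs)
  then have "x \<in> set ys" by (metis list.set_intros(1) set_mset_mset)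
  then obtain us vs where ys: "ys = us @ x # vs" by (meson split_list)
  have "partials ys f = partials (us @ [x]) (partials vs f)"
    using partials_append[of "us @ [x]" vs f] by (simp add: ys)
  also have "\<dots> = partials (x # (us @ vs)) f"
    using partials_snoc[OF smooth_partials[OF assms(1)], of us x vs] by (simp add: partials_append)
  also have "\<dots> = partials (x # xs) f"
    using Cons.IH[of "us @ vs"] Cons.prems by (simp add: ys)
  finally show ?case by simp
qed auto

section \<open>A gradient bound for the Helmholtz equation\<close>

lemma helmholtz_smooth: "helmholtz_solution h \<Longrightarrow> smooth h"
  by (simp add: helmholtz_solution_def)

lemma helmholtz_sum: 
  assumes "helmholtz_solution h"
  shows "(\<Sum>j\<in>UNIV. partial j (partial j h) x) = - h x"
  using assms by (simp add: helmholtz_solution_def laplacian_def eq_neg_iff_add_eq_0)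

lemma laplacian_partials:
  assumes "smooth h"
  shows "laplacian (partials is h) x = partials is (laplacian h) x"
proof -
  have "laplacian (partials is h) x = (\<Sum>j\<in>UNIV. partials ([j, j] @ is) h x)"
    by (simp add: laplacian_def)
  also have "\<dots> = (\<Sum>j\<in>UNIV. partials is (partials [j, j] h) x)"
    by (intro sum.cong refl, subst partials_append[symmetric], subst partials_mset_cong[OF assms, where ys="is @ [_, _]"]) auto
  also have "\<dots> = partials is (\<lambda>x. \<Sum>j\<in>UNIV. partials [j, j] h x) x"
    by (rule partials_sum[symmetric]) (rule smooth_partials[OF assms])
  finally show ?thesis by (simp add: laplacian_def[abs_def])
qed

lemma helmholtz_partials:
  assumes "helmholtz_solution h"
  shows "helmholtz_solution (partials is h)"
proof -
  have s: "smooth h" using assms by (rule helmholtz_smooth)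
  have "laplacian h = (\<lambda>x. (-1) * h x)"
    using assms by (auto simp: helmholtz_solution_def eq_neg_iff_add_eq_0)
  then have "laplacian (partials is h) x + partials is h x = 0" for x
    by (simp add: laplacian_partials[OF s] partials_cmult[OF s, of _ "-1", simplified])
  with s show ?thesis by (simp add: helmholtz_solution_def smooth_partials)
qed

lemma helmholtz_diff:
  assumes "helmholtz_solution f" "helmholtz_solution g"
  shows "helmholtz_solution (\<lambda>x. f x - g x)"
proof -
  have "laplacian (\<lambda>x. f x - g x) x = laplacian f x - laplacian g x" for x
    using assms by (simp add: laplacian_def partials_diff helmholtz_smooth sum_subtractf del: partials.simps)
  moreover have "smooth f" "smooth g" "\<And>x. laplacian f x + f x = 0" "\<And>x. laplacian g x + g x = 0"
    using assms by (auto simp: helmholtz_solution_def)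
  ultimately show ?thesis
    by (simp add: helmholtz_solution_def smooth_diff) (metis add_diff_add diff_self)
qed

text \<open>At the maximum \<open>\<psi> 0 = 0\<close>, so a positive \<open>L\<close> would make
  \<open>\<psi>\<close> positive just to the right of 0, and the mean value theorem would push
  \<open>\<phi>\<close> above its maximum.\<close>

lemma second_derivative_nonpos_at_max:
  fixes \<phi> \<psi> :: "real \<Rightarrow> real"
  assumes \<phi>: "\<And>t. (\<phi> has_real_derivative \<psi> t) (at t)" and \<psi>: "(\<psi> has_real_derivative L) (at 0)"
    and d: "d > 0" "\<And>t. \<bar>t\<bar> < d \<Longrightarrow> \<phi> t \<le> \<phi> 0"
  shows "L \<le> 0"
proof (rule ccontr)
  assume "\<not> L \<le> 0"
  then have "L > 0" by simp
  have 0: "\<psi> 0 = 0" using DERIV_local_max[OF \<phi> d(1)] d(2) by simp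
  obtain d' where d': "d' > 0" "\<And>h. 0 < h \<Longrightarrow> h < d' \<Longrightarrow> \<psi> 0 < \<psi> (0 + h)"
    using DERIV_pos_inc_right[OF \<psi> \<open>L > 0\<close>] by blast
  define t where "t = min d d' / 2"
  have t: "t > 0" "t < d" "t < d'" using d d' by (auto simp: t_def)
  obtain z where z: "0 < z" "z < t" "\<phi> t - \<phi> 0 = (t - 0) * \<psi> z"
    using MVT2[OF t(1), of \<phi> \<psi>] \<phi> by blast
  have "\<psi> z > 0" using d'(2)[of z] z t 0 by simp
  then have "\<phi> t > \<phi> 0" using z t by (smt (verit) mult_pos_pos)
  with d(2)[of t] t show False by simp
qed

text \<open>Bernstein's method: \<open>w\<close> below is strictly subharmonic in the ball, so it attains its
  maximum on the sphere, where the cut-off \<open>\<eta>\<close> kills the derivative term.\<close>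

lemma helmholtz_gradient_bound:
  fixes u :: "real ^ 'n \<Rightarrow> real"
  assumes u: "helmholtz_solution u" and \<rho>: "0 < \<rho>" "\<rho> \<le> 1"
    and M: "\<And>y. y \<in> cball x0 \<rho> \<Longrightarrow> \<bar>u y\<bar> \<le> M"
  shows "\<bar>partial i u x0\<bar> \<le> (39 + 6 * real CARD('n)) / \<rho> * M"
proof -
  define d where "d = real CARD('n)"
  have d1: "d \<ge> 1" by (simp add: d_def Suc_leI)
  define v where "v = partial i u"
  have su: "smooth u" using u by (rule helmholtz_smooth)
  have sv: "smooth v" unfolding v_def by (rule smooth_partial[OF su])
  have hv: "helmholtz_solution v" using helmholtz_partials[OF u, of "[i]"] by (simp add: v_def)
  have M0: "M \<ge> 0" using M[of x0] \<rho> by auto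
  \<comment> \<open>With this \<open>A\<close> the good term \<open>2 * A * (v y)\<^sup>2\<close>
    balances exactly the bounds with coefficients 24, 2 and \<open>4 * d\<close>, each times
    \<open>\<rho>\<^sup>2 * (v y)\<^sup>2\<close>, for the negative terms met below.\<close>
  define A where "A = (13 + 2 * d) * \<rho>\<^sup>2"
  have A: "A > 0" using \<rho> d1 by (simp add: A_def)
  \<comment> \<open>The surplus \<open>\<delta>\<close> makes the subharmonicity strict; it tends to
    0 afterwards.\<close>
  have bound: "\<rho>\<^sup>2 * (v x0)\<^sup>2 \<le> (13 + 2 * d) * (2 * M\<^sup>2 + \<delta>)" if \<delta>: "\<delta> > 0" for \<delta>
  proof -
    define B where "B = A * (M\<^sup>2 + \<delta>) / d"
    have B: "B > 0" using A \<delta> d1 by (auto simp: B_def intro!: divide_pos_pos mult_pos_pos add_nonneg_pos)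
    define \<eta> where "\<eta> = (\<lambda>y. \<rho>\<^sup>2 - (y - x0) \<bullet> (y - x0))"
    define w where "w = (\<lambda>y. (\<eta> y * v y)\<^sup>2 + A * (u y)\<^sup>2 + B * ((y - x0) \<bullet> (y - x0)))"
    have "continuous_on (cball x0 \<rho>) w"
      unfolding w_def \<eta>_def by (intro continuous_intros smooth_continuous_on su sv)
    then obtain y where y: "y \<in> cball x0 \<rho>" and ymax: "\<And>z. z \<in> cball x0 \<rho> \<Longrightarrow> w z \<le> w y"
      using continuous_attains_sup[of "cball x0 \<rho>" w] \<rho> by auto
    have "dist x0 y = \<rho>"
    proof (rule ccontr)
      assume "dist x0 y \<noteq> \<rho>"
      with y have yi: "dist x0 y < \<rho>" by simp
      define z where "z = y - x0"
      have zz: "z \<bullet> z \<le> \<rho>\<^sup>2"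
        using yi by (simp add: z_def dist_norm norm_minus_commute power2_norm_eq_inner[symmetric] power_mono)
      \<comment> \<open>\<open>L j\<close> is the second derivative of \<open>w\<close> at
        \<open>y\<close> along axis \<open>j\<close>, so the sum over \<open>j\<close> is the
        Laplacian of \<open>w\<close>. An interior maximum makes every \<open>L j\<close>
        nonpositive, while the sum turns out to be positive.\<close>
      define L where "L = (\<lambda>j. 2 * (- 2 * z $ j * v y + \<eta> y * partial j v y)\<^sup>2
         + 2 * \<eta> y * v y * (- 2 * v y - 4 * z $ j * partial j v y + \<eta> y * partial j (partial j v) y)
         + 2 * A * ((partial j u y)\<^sup>2 + u y * partial j (partial j u) y) + 2 * B)"
      have "L j \<le> 0" for j
      proof -
        define e where "e = (axis j 1 :: real ^ 'n)"
        define E where "E = (\<lambda>t::real. \<rho>\<^sup>2 - (z \<bullet> z + 2 * t * z $ j + t * t))"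
        define U U' V V' where "U = (\<lambda>t. u (y + t *\<^sub>R e))" and "U' = (\<lambda>t. partial j u (y + t *\<^sub>R e))"
          and "V = (\<lambda>t. v (y + t *\<^sub>R e))" and "V' = (\<lambda>t. partial j v (y + t *\<^sub>R e))"
        have U: "(U has_real_derivative U' t) (at t)" and V: "(V has_real_derivative V' t) (at t)" for t
          unfolding U_def U'_def V_def V'_def e_def by (intro smooth_axis_deriv su sv)+
        have U': "(U' has_real_derivative partial j (partial j u) y) (at 0)"
          and V': "(V' has_real_derivative partial j (partial j v) y) (at 0)"
          using smooth_axis_deriv[OF smooth_partial[OF su, of j], of y j 0]
            smooth_axis_deriv[OF smooth_partial[OF sv, of j], of y j 0]
          unfolding U'_def V'_def e_def by simp_all
        have nn: "(y + t *\<^sub>R e - x0) \<bullet> (y + t *\<^sub>R e - x0) = z \<bullet> z + 2 * t * z $ j + t * t" for t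
        proof -
          have "y + t *\<^sub>R e - x0 = z + t *\<^sub>R e" by (simp add: z_def)
          moreover have "z \<bullet> e = z $ j" "e \<bullet> e = 1" by (simp_all add: e_def inner_axis inner_axis_axis)
          ultimately show ?thesis by (simp add: inner_add inner_commute algebra_simps)
        qed
        have wline: "w (y + t *\<^sub>R e) = (E t * V t)\<^sup>2 + A * (U t)\<^sup>2 + B * (z \<bullet> z + 2 * t * z $ j + t * t)" for t
          by (simp add: w_def \<eta>_def nn E_def U_def V_def)
        define \<psi> where "\<psi> = (\<lambda>t. 2 * (E t * V t) * (- (2 * z $ j + 2 * t) * V t + E t * V' t)
            + A * (2 * U t * U' t) + B * (2 * z $ j + 2 * t))"
        have E: "(E has_real_derivative - (2 * z $ j + 2 * t)) (at t)" for t
          unfolding E_def by (auto intro!: derivative_eq_intros)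
        have 1: "((\<lambda>t. w (y + t *\<^sub>R e)) has_real_derivative \<psi> t) (at t)" for t
          unfolding wline \<psi>_def
          by (rule derivative_eq_intros E U V refl)+ (simp add: algebra_simps)
        have vals: "E 0 = \<eta> y" "V 0 = v y" "U 0 = u y" "U' 0 = partial j u y" "V' 0 = partial j v y"
          by (simp_all add: E_def \<eta>_def V_def U_def U'_def V'_def z_def)
        have 2: "(\<psi> has_real_derivative L j) (at 0)"
          unfolding \<psi>_def
          by (rule derivative_eq_intros E U V U' V' refl)+
             (simp add: vals L_def, simp add: algebra_simps power2_eq_square)
        show ?thesis
        proof (rule second_derivative_nonpos_at_max[OF 1 2])
          show "\<rho> - dist x0 y > 0" using yi by simp
          fix t assume "\<bar>t\<bar> < \<rho> - dist x0 y"
          moreover have "dist x0 (y + t *\<^sub>R e) \<le> dist x0 y + \<bar>t\<bar>"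
            using dist_triangle[of x0 "y + t *\<^sub>R e" y] by (simp add: e_def dist_norm)
          ultimately show "w (y + t *\<^sub>R e) \<le> w (y + 0 *\<^sub>R e)"
            by (simp, intro ymax) simp
        qed
      qed
      then have "(\<Sum>j\<in>UNIV. L j) \<le> 0" by (simp add: sum_nonpos)
      moreover have "(\<Sum>j\<in>UNIV. L j) > 0"
      proof -
        \<comment> \<open>Completing the square absorbs the cross term between \<open>v\<close> and
          its derivative, at the price of turning the coefficient 8 of
          \<open>(z $ j * v y)\<^sup>2\<close> into -24.\<close>
        have Lj: "L j \<ge> - 24 * (v y)\<^sup>2 * (z $ j * z $ j) - 4 * \<eta> y * (v y)\<^sup>2 + 2 * (\<eta> y)\<^sup>2 * v y * partial j (partial j v) y
           + 2 * A * (partial j u y)\<^sup>2 + 2 * A * u y * partial j (partial j u) y + 2 * B" for j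
        proof -
          have "L j - (- 24 * (v y)\<^sup>2 * (z $ j * z $ j) - 4 * \<eta> y * (v y)\<^sup>2 + 2 * (\<eta> y)\<^sup>2 * v y * partial j (partial j v) y
           + 2 * A * (partial j u y)\<^sup>2 + 2 * A * u y * partial j (partial j u) y + 2 * B)
            = 2 * (\<eta> y * partial j v y - 4 * z $ j * v y)\<^sup>2"
            by (simp add: L_def power2_eq_square algebra_simps)
          then show ?thesis by (smt (verit) zero_le_power2)
        qed
        have "(\<Sum>j\<in>UNIV. L j) \<ge> (\<Sum>j\<in>UNIV. - 24 * (v y)\<^sup>2 * (z $ j * z $ j) - 4 * \<eta> y * (v y)\<^sup>2 + 2 * (\<eta> y)\<^sup>2 * v y * partial j (partial j v) y
           + 2 * A * (partial j u y)\<^sup>2 + 2 * A * u y * partial j (partial j u) y + 2 * B)"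
          by (rule sum_mono) (rule Lj)
        also have "(\<Sum>j\<in>UNIV. - 24 * (v y)\<^sup>2 * (z $ j * z $ j) - 4 * \<eta> y * (v y)\<^sup>2 + 2 * (\<eta> y)\<^sup>2 * v y * partial j (partial j v) y
           + 2 * A * (partial j u y)\<^sup>2 + 2 * A * u y * partial j (partial j u) y + 2 * B)
          = - 24 * (v y)\<^sup>2 * (z \<bullet> z) - 4 * d * \<eta> y * (v y)\<^sup>2 - 2 * (\<eta> y)\<^sup>2 * (v y)\<^sup>2
            + 2 * A * (\<Sum>j\<in>UNIV. (partial j u y)\<^sup>2) - 2 * A * (u y)\<^sup>2 + 2 * d * B"
          by (simp add: sum.distrib sum_subtractf sum_distrib_left[symmetric] helmholtz_sum[OF u] helmholtz_sum[OF hv]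
              inner_vec_def d_def sum_negf mult.assoc, simp add: power2_eq_square)
        finally have 1: "(\<Sum>j\<in>UNIV. L j) \<ge> \<dots>" .
        have "(partial i u y)\<^sup>2 \<le> (\<Sum>j\<in>UNIV. (partial j u y)\<^sup>2)"
          by (rule member_le_sum) auto
        then have 2: "A * (v y)\<^sup>2 \<le> A * (\<Sum>j\<in>UNIV. (partial j u y)\<^sup>2)"
          using A by (simp add: v_def)
        have \<eta>: "0 \<le> \<eta> y" "\<eta> y \<le> \<rho>\<^sup>2" using zz by (simp_all add: \<eta>_def z_def)
        have \<rho>2: "\<rho>\<^sup>2 \<le> 1" "\<rho>\<^sup>2 > 0" using \<rho> by (simp_all add: power_le_one)
        have "(\<eta> y)\<^sup>2 \<le> \<rho>\<^sup>2 * 1"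
          unfolding power2_eq_square[of "\<eta> y"] using \<eta> \<rho>2 by (intro mult_mono) auto
        then have 3: "(\<eta> y)\<^sup>2 * (v y)\<^sup>2 \<le> \<rho>\<^sup>2 * (v y)\<^sup>2" by (intro mult_right_mono) auto
        have 4: "d * \<eta> y * (v y)\<^sup>2 \<le> d * \<rho>\<^sup>2 * (v y)\<^sup>2"
          using \<eta> d1 by (intro mult_right_mono mult_left_mono) auto
        have 5: "(v y)\<^sup>2 * (z \<bullet> z) \<le> (v y)\<^sup>2 * \<rho>\<^sup>2" using zz by (intro mult_left_mono) auto
        have 6: "A * (u y)\<^sup>2 \<le> A * M\<^sup>2"
          using M[OF y] A by (intro mult_left_mono) (auto simp: abs_le_square_iff[symmetric] M0)
        have 7: "d * B = A * M\<^sup>2 + A * \<delta>" "A * \<delta> > 0" using d1 A \<delta> by (auto simp: B_def field_simps)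
        have 8: "A * (v y)\<^sup>2 = 13 * (\<rho>\<^sup>2 * (v y)\<^sup>2) + 2 * (d * \<rho>\<^sup>2 * (v y)\<^sup>2)"
          by (simp add: A_def algebra_simps)
        show ?thesis using 1 2 3 4 5 6 7 8 by (simp add: algebra_simps)
      qed
      ultimately show False by simp
    qed
    then have yy: "(y - x0) \<bullet> (y - x0) = \<rho>\<^sup>2"
      by (simp add: dist_norm norm_minus_commute power2_norm_eq_inner[symmetric])
    \<comment> \<open>At the centre \<open>\<eta>\<close> equals \<open>\<rho>\<^sup>2\<close>, on
      the sphere it is 0; comparing the two values of \<open>w\<close> bounds \<open>v x0\<close> by
      \<open>u\<close> alone.\<close>
    have "w x0 \<le> w y" using ymax \<rho> by simp
    also have "w y = A * (u y)\<^sup>2 + B * \<rho>\<^sup>2" by (simp add: w_def \<eta>_def yy)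
    also have "\<dots> \<le> A * M\<^sup>2 + B * 1"
      using M[OF y] A B \<rho> by (intro add_mono mult_left_mono) (auto simp: abs_le_square_iff[symmetric] M0 power_le_one)
    also have "B \<le> A * (M\<^sup>2 + \<delta>) / 1" unfolding B_def
      using d1 A \<delta> by (intro divide_left_mono) auto
    finally have "w x0 \<le> A * (2 * M\<^sup>2 + \<delta>)" by (simp add: algebra_simps)
    moreover have "w x0 = \<rho>\<^sup>2 * (\<rho>\<^sup>2 * (v x0)\<^sup>2) + A * (u x0)\<^sup>2"
      by (simp add: w_def \<eta>_def power2_eq_square mult_ac)
    moreover have "A * (u x0)\<^sup>2 \<ge> 0" using A by simp
    ultimately have "\<rho>\<^sup>2 * (\<rho>\<^sup>2 * (v x0)\<^sup>2) \<le> \<rho>\<^sup>2 * ((13 + 2 * d) * (2 * M\<^sup>2 + \<delta>))"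
      by (simp add: A_def algebra_simps)
    then show ?thesis by (rule mult_left_le_imp_le) (use \<rho> in simp)
  qed
  have "\<rho>\<^sup>2 * (v x0)\<^sup>2 \<le> (13 + 2 * d) * (2 * M\<^sup>2)"
  proof (rule field_le_epsilon)
    fix e :: real assume "e > 0"
    then show "\<rho>\<^sup>2 * (v x0)\<^sup>2 \<le> (13 + 2 * d) * (2 * M\<^sup>2) + e"
      using bound[of "e / (13 + 2 * d)"] d1 by (simp add: distrib_left)
  qed
  \<comment> \<open>A factor that is at least 1 is dominated by its square, so the final constant
    contains no square root.\<close>
  also have "\<dots> \<le> (39 + 6 * d) * M\<^sup>2" using d1 by (simp add: algebra_simps)
  also have "\<dots> \<le> (39 + 6 * d)\<^sup>2 * M\<^sup>2"
    using d1 by (intro mult_right_mono self_le_power) auto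
  finally have "(\<rho> * \<bar>v x0\<bar>)\<^sup>2 \<le> ((39 + 6 * d) * M)\<^sup>2" by (simp add: power_mult_distrib)
  then have "\<rho> * \<bar>v x0\<bar> \<le> (39 + 6 * d) * M"
    by (rule power2_le_imp_le) (use d1 M0 in auto)
  then show ?thesis using \<rho> by (simp add: v_def d_def field_simps)
qed

section \<open>Taylor expansion of global solutions\<close>

text \<open>One term of the exponential series; for \<open>x = k\<close> it is the Stirling-type
  bound \<open>k ^ k \<le> exp k * fact k\<close>.\<close>

lemma power_le_exp_fact:
  fixes x :: real assumes "x \<ge> 0" shows "x ^ k \<le> exp x * fact k"
proof -
  have "(\<Sum>n\<in>{k}. x ^ n /\<^sub>R fact n) \<le> (\<Sum>n. x ^ n /\<^sub>R fact n)"
    by (rule sum_le_suminf[OF summable_exp_generic]) (use assms in auto)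
  then show ?thesis by (simp add: exp_def field_simps)
qed

text \<open>Each derivative costs a shell of width \<open>\<rho>\<close>. Many thin shells give
  analyticity, unit shells turn sup bounds into \<open>C^l\<close> bounds.\<close>

lemma helmholtz_partials_bound:
  fixes u :: "real ^ 'n \<Rightarrow> real"
  assumes u: "helmholtz_solution u" and \<rho>: "0 < \<rho>" "\<rho> \<le> 1"
    and M: "\<And>y. y \<in> cball x0 (real (length is) * \<rho>) \<Longrightarrow> \<bar>u y\<bar> \<le> M"
  shows "\<bar>partials is u x0\<bar> \<le> ((39 + 6 * real CARD('n)) / \<rho>) ^ length is * M"
  using M
proof (induction "is" arbitrary: x0)
  case (Cons i "is")
  have "\<bar>partials is u y\<bar> \<le> ((39 + 6 * real CARD('n)) / \<rho>) ^ length is * M" if "y \<in> cball x0 \<rho>" for y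
  proof (rule Cons.IH)
    fix z assume "z \<in> cball y (real (length is) * \<rho>)"
    then have "z \<in> cball x0 (real (length (i # is)) * \<rho>)"
      using that dist_triangle[of x0 z y] by (auto simp: algebra_simps)
    then show "\<bar>u z\<bar> \<le> M" by (rule Cons.prems)
  qed
  then have "\<bar>partial i (partials is u) x0\<bar>
      \<le> (39 + 6 * real CARD('n)) / \<rho> * (((39 + 6 * real CARD('n)) / \<rho>) ^ length is * M)"
    by (rule helmholtz_gradient_bound[OF helmholtz_partials[OF u] \<rho>])
  then show ?case by simp
qed auto

text \<open>Iterating the gradient bound over \<open>k\<close> balls of radius \<open>\<rho> / k\<close>, with \<open>\<rho>\<close> arbitrarily large,
  shows that global solutions are entire.\<close>

lemma helmholtz_entire:
  fixes h :: "real ^ 'n \<Rightarrow> real"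
  assumes h: "helmholtz_solution h" and \<epsilon>: "\<epsilon> > 0"
  obtains C where "C \<ge> 0" "\<And>is x. norm x \<le> R \<Longrightarrow> \<bar>partials is h x\<bar> \<le> C * \<epsilon> ^ length is * fact (length is)"
proof -
  define K where "K = 39 + 6 * real CARD('n)"
  \<comment> \<open>Chosen so that \<open>K / \<rho> * exp 1 = \<epsilon>\<close>, the factor left
    over after \<open>k ^ k \<le> exp k * fact k\<close>.\<close>
  define \<rho> where "\<rho> = K * exp 1 / \<epsilon>"
  have K: "K \<ge> 1" by (simp add: K_def)
  have \<rho>: "\<rho> > 0" using K \<epsilon> by (simp add: \<rho>_def)
  have "compact (h ` cball 0 (R + \<rho>))"
    by (intro compact_continuous_image smooth_continuous_on helmholtz_smooth h) auto
  then obtain M where M: "M > 0" "\<And>y. y \<in> cball 0 (R + \<rho>) \<Longrightarrow> \<bar>h y\<bar> \<le> M"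
    using compact_imp_bounded[of "h ` cball 0 (R + \<rho>)"] by (auto simp: bounded_pos)
  have "\<bar>partials is h x\<bar> \<le> ((1 + exp \<rho>) * M) * \<epsilon> ^ length is * fact (length is)" if x: "norm x \<le> R" for "is" x
  proof -
    define k where "k = length is"
    \<comment> \<open>Shells of width \<open>\<rho> / k\<close>, capped at 1 as the gradient bound
      demands. In the capped case \<open>K ^ k\<close> is absorbed by
      \<open>exp \<rho> * \<epsilon> ^ k * fact k\<close>.\<close>
    define \<delta> where "\<delta> = (if k = 0 then 1 else min 1 (\<rho> / k))"
    have \<delta>: "0 < \<delta>" "\<delta> \<le> 1" "real k * \<delta> \<le> \<rho>"
      using \<rho> by (auto simp: \<delta>_def min_def field_simps)
    have "\<bar>h y\<bar> \<le> M" if "y \<in> cball x (real (length is) * \<delta>)" for y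
    proof (rule M(2))
      have "norm y \<le> norm x + norm (y - x)" by (metis add.commute diff_add_cancel norm_triangle_ineq)
      then show "y \<in> cball 0 (R + \<rho>)" using that \<delta> x
        by (simp add: k_def dist_norm norm_minus_commute)
    qed
    from helmholtz_partials_bound[OF h \<delta>(1,2) this]
    have 1: "\<bar>partials is h x\<bar> \<le> (K / \<delta>) ^ k * M" by (simp add: K_def k_def)
    have "(K / \<delta>) ^ k \<le> K ^ k + (K * k / \<rho>) ^ k"
    proof (cases "\<delta> = 1")
      case False
      then have "k > 0" "\<delta> = \<rho> / k" by (auto simp: \<delta>_def min_def split: if_splits)
      then show ?thesis using K by simp
    qed (use K \<rho> in simp)
    also have "\<dots> \<le> (1 + exp \<rho>) * \<epsilon> ^ k * fact k"
    proof -
      have \<epsilon>': "\<epsilon> = K / \<rho> * exp 1" using K \<epsilon> by (simp add: \<rho>_def)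
      have a: "K / \<rho> \<le> \<epsilon>" unfolding \<epsilon>' using K \<rho> mult_left_mono[of 1 "exp 1" "K/\<rho>"] by simp
      have "K ^ k = (K / \<rho>) ^ k * \<rho> ^ k" using \<rho> by (simp add: power_mult_distrib[symmetric])
      also have "\<dots> \<le> \<epsilon> ^ k * (exp \<rho> * fact k)"
        using a K \<rho> \<epsilon> by (intro mult_mono power_mono power_le_exp_fact) auto
      finally have 1: "K ^ k \<le> exp \<rho> * \<epsilon> ^ k * fact k" by (simp add: mult_ac)
      have "(K * k / \<rho>) ^ k = (K / \<rho>) ^ k * real k ^ k" by (simp add: power_mult_distrib[symmetric])
      also have "\<dots> \<le> (K / \<rho>) ^ k * (exp (real k) * fact k)"
        using K \<rho> by (intro mult_left_mono power_le_exp_fact) auto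
      also have "\<dots> = \<epsilon> ^ k * fact k"
        by (simp add: \<epsilon>' power_mult_distrib power_divide exp_of_nat_mult[of k 1, simplified])
      finally show ?thesis using 1 by (simp add: algebra_simps)
    qed
    finally have "(K / \<delta>) ^ k \<le> (1 + exp \<rho>) * \<epsilon> ^ k * fact k" .
    from order_trans[OF 1 mult_right_mono[OF this, of M]] M(1) show ?thesis by (simp add: k_def mult_ac)
  qed
  with M(1) show thesis by (intro that[of "(1 + exp \<rho>) * M"]) (auto simp: add_nonneg_nonneg)
qed

lemma smooth_dird: "smooth f \<Longrightarrow> smooth (dird v f)"
  unfolding dird_def[abs_def] by (intro smooth_sum smooth_cmult smooth_partial)

lemma partials_dird: 
  assumes "smooth f"
  shows "partials is (dird v f) x = (\<Sum>i\<in>UNIV. v $ i * partials (is @ [i]) f x)"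
proof -
  have "partials is (dird v f) x = (\<Sum>i\<in>UNIV. partials is (\<lambda>x. v $ i * partial i f x) x)"
    unfolding dird_def[abs_def] by (intro partials_sum smooth_cmult smooth_partial assms)
  then show ?thesis
    by (simp add: partials_cmult smooth_partial assms partials_append)
qed

text \<open>Each application of \<open>dird v\<close> adds one index to the list and costs the l1
  norm of \<open>v\<close>.\<close>

lemma dird_power_bound:
  fixes f :: "real ^ 'n \<Rightarrow> real"
  assumes "smooth f" "\<And>is. length is = k \<Longrightarrow> \<bar>partials is f x\<bar> \<le> B"
  shows "\<bar>(dird v ^^ k) f x\<bar> \<le> (\<Sum>i\<in>UNIV. \<bar>v $ i\<bar>) ^ k * B"
  using assms
proof (induction k arbitrary: f B)
  case (Suc k)
  let ?s = "\<Sum>i\<in>UNIV. \<bar>v $ i\<bar>"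
  have "\<bar>(dird v ^^ k) (dird v f) x\<bar> \<le> ?s ^ k * (?s * B)"
  proof (rule Suc.IH[OF smooth_dird[OF Suc.prems(1)]])
    fix js :: "'n list" assume js: "length js = k"
    have "\<bar>partials js (dird v f) x\<bar> \<le> (\<Sum>i\<in>UNIV. \<bar>v $ i * partials (js @ [i]) f x\<bar>)"
      unfolding partials_dird[OF Suc.prems(1)] by (rule sum_abs)
    also have "\<dots> \<le> (\<Sum>i\<in>UNIV. \<bar>v $ i\<bar> * B)"
      unfolding abs_mult using js by (intro sum_mono mult_left_mono Suc.prems) auto
    finally show "\<bar>partials js (dird v f) x\<bar> \<le> ?s * B" by (simp add: sum_distrib_right)
  qed
  then show ?case by (simp add: funpow_swap1 mult_ac)
qed auto

text \<open>Taylor expansion on the segment from 0 to \<open>x\<close>: the hypothesis on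
  \<open>T\<close> bounds every partial sum, and the remainder tends to 0 because \<open>E\<close>
  is entire. Thus the derivatives at a single point control the solution on a ball.\<close>

lemma helmholtz_taylor_bound:
  fixes E :: "real ^ 'n \<Rightarrow> real"
  assumes E: "helmholtz_solution E" and T: "\<And>is. \<bar>partials is E 0\<bar> \<le> T (length is)"
    and R: "norm x \<le> R"
    and \<eta>: "\<And>n. (\<Sum>k<n. (real CARD('n) * R) ^ k / fact k * T k) \<le> \<eta>"
  shows "\<bar>E x\<bar> \<le> \<eta>"
proof -
  define D where "D = real CARD('n) * R"
  have sE: "smooth E" using E by (rule helmholtz_smooth)
  have R0: "R \<ge> 0" using R norm_ge_zero order_trans by blast
  have D: "D \<ge> 0" "(\<Sum>i\<in>UNIV. \<bar>x $ i\<bar>) \<le> D"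
  proof -
    have "(\<Sum>i\<in>UNIV. \<bar>x $ i\<bar>) \<le> (\<Sum>i\<in>(UNIV::'n set). R)"
      using R component_le_norm_cart[of x] order_trans by (intro sum_mono) blast
    then show "(\<Sum>i\<in>UNIV. \<bar>x $ i\<bar>) \<le> D" by (simp add: D_def)
  qed (simp add: D_def R0)
  have sm: "smooth ((dird x ^^ m) E)" for m
    by (induction m) (auto intro: smooth_dird sE)
  define \<phi> where "\<phi> = (\<lambda>m t. (dird x ^^ m) E (t *\<^sub>R x))"
  have der: "(\<phi> m has_real_derivative \<phi> (Suc m) t) (at t)" for m t
    using smooth_line_deriv[OF sm, of m 0 x t] by (simp add: \<phi>_def)
  \<comment> \<open>Makes \<open>D * \<epsilon> \<le> 1 / 2\<close>, so that the remainder of order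
    \<open>n\<close> is at most \<open>C * (1/2) ^ n\<close>.\<close>
  define \<epsilon> where "\<epsilon> = 1 / (2 * (D + 1))"
  have \<epsilon>: "\<epsilon> > 0" "D * \<epsilon> \<le> 1 / 2" using D by (auto simp: \<epsilon>_def field_simps)
  obtain C where C: "C \<ge> 0" "\<And>is y. norm y \<le> R \<Longrightarrow> \<bar>partials is E y\<bar> \<le> C * \<epsilon> ^ length is * fact (length is)"
    using helmholtz_entire[OF E \<epsilon>(1), of R] by metis
  have "\<bar>E x\<bar> \<le> \<eta> + C * (1/2) ^ n" for n
  proof -
    obtain t where t: "\<bar>t\<bar> \<le> 1" and e: "\<phi> 0 1 = (\<Sum>m<n. (\<phi> m 0 / fact m) * 1 ^ m) + (\<phi> n t / fact n) * 1 ^ n"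
      using Maclaurin_all_le[of \<phi> "\<phi> 0" 1 n] der by auto
    have bnd: "\<bar>\<phi> m s\<bar> \<le> D ^ m * B" if "\<And>is. length is = m \<Longrightarrow> \<bar>partials is E (s *\<^sub>R x)\<bar> \<le> B" for m s B
    proof -
      have "\<bar>\<phi> m s\<bar> \<le> (\<Sum>i\<in>UNIV. \<bar>x $ i\<bar>) ^ m * B"
        unfolding \<phi>_def by (rule dird_power_bound[OF sE that])
      \<comment> \<open>Some list of length \<open>m\<close> exists, and for it \<open>B\<close>
        bounds an absolute value.\<close>
      moreover have "B \<ge> 0" using that[of "replicate m undefined"] by (smt (verit) length_replicate)
      ultimately show ?thesis using D by (smt (verit) mult_right_mono power_mono sum_nonneg abs_ge_zero)
    qed
    have "\<bar>\<Sum>m<n. (\<phi> m 0 / fact m) * 1 ^ m\<bar> \<le> (\<Sum>m<n. \<bar>\<phi> m 0 / fact m\<bar>)"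
      using sum_abs[of "\<lambda>m. \<phi> m 0 / fact m" "{..<n}"] by simp
    also have "\<dots> \<le> (\<Sum>m<n. D ^ m / fact m * T m)"
    proof (rule sum_mono)
      fix m
      have "\<bar>\<phi> m 0\<bar> \<le> D ^ m * T m" by (rule bnd) (use T in auto)
      then show "\<bar>\<phi> m 0 / fact m\<bar> \<le> D ^ m / fact m * T m" by (simp add: abs_divide divide_right_mono)
    qed
    also have "\<dots> \<le> \<eta>" using \<eta> by (simp add: D_def)
    finally have 1: "\<bar>\<Sum>m<n. (\<phi> m 0 / fact m) * 1 ^ m\<bar> \<le> \<eta>" .
    have "norm (t *\<^sub>R x) \<le> R" using t R mult_mono[of "\<bar>t\<bar>" 1 "norm x" R] by simp
    then have "\<bar>\<phi> n t\<bar> \<le> D ^ n * (C * \<epsilon> ^ n * fact n)" using C(2) by (intro bnd) blast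
    then have "\<bar>\<phi> n t / fact n\<bar> \<le> C * (D * \<epsilon>) ^ n" by (simp add: abs_divide field_simps power_mult_distrib)
    also have "\<dots> \<le> C * (1/2) ^ n" using C D \<epsilon> by (intro mult_left_mono power_mono) auto
    finally have "\<bar>\<phi> n t / fact n\<bar> \<le> C * (1/2) ^ n" .
    moreover have "E x = \<phi> 0 1" by (simp add: \<phi>_def)
    ultimately show ?thesis using 1[unfolded power_one mult_1_right] e[unfolded power_one mult_1_right] by linarith
  qed
  moreover have "(\<lambda>n. \<eta> + C * (1/2) ^ n) \<longlonglongrightarrow> \<eta> + C * 0"
    by (intro tendsto_intros LIMSEQ_power_zero) simp
  ultimately show ?thesis by (metis (no_types, lifting) LIMSEQ_le_const mult_zero_right add_0_right)
qed

text \<open>The equation trades two derivatives in direction \<open>a\<close> for derivatives in the other directions.\<close>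

lemma helmholtz_cauchy_data:
  fixes E :: "real ^ 'n \<Rightarrow> real"
  assumes E: "helmholtz_solution E" and T: "mono T"
    and data: "\<And>js b. a \<notin> set js \<Longrightarrow> b \<le> 1 \<Longrightarrow> \<bar>partials (js @ replicate b a) E x\<bar> \<le> T (length js + b)"
  shows "\<bar>partials is E x\<bar> \<le> real CARD('n) ^ length is * T (length is)"
proof -
  let ?d = "real CARD('n)"
  have d: "?d \<ge> 1" by (simp add: Suc_leI)
  have sE: "smooth E" using E by (rule helmholtz_smooth)
  \<comment> \<open>The induction runs on the number of occurrences of \<open>a\<close>: trading a
    pair \<open>a, a\<close> lowers it by 2, while the list keeps its length or loses the pair. The
    shorter list is where monotonicity of \<open>T\<close> enters.\<close>
  have "\<bar>partials is E x\<bar> \<le> ?d ^ count_list is a * T (length is)"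
  proof (induction "count_list is a" arbitrary: "is" rule: less_induct)
    case less
    define q where "q = count_list is a"
    define js where "js = filter (\<lambda>i. i \<noteq> a) is"
    have js: "a \<notin> set js" by (simp add: js_def)
    have "mset is = mset js + mset (filter (\<lambda>i. i = a) is)"
      using multiset_partition[of "mset is" "\<lambda>i. i \<noteq> a"] by (simp add: js_def)
    also have "filter (\<lambda>i. i = a) is = replicate q a"
      unfolding q_def by (induction "is") auto
    finally have ms: "mset is = mset (js @ replicate q a)" by simp
    have len: "length is = length js + q" using mset_eq_length[OF ms] by simp
    show ?case
    proof (cases "q \<le> 1")
      case True
      have T0: "T (length is) \<ge> 0" using data[OF js True] len by simp
      have "\<bar>partials is E x\<bar> \<le> 1 * T (length is)"
        using data[OF js True] unfolding partials_mset_cong[OF sE ms] len by simp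
      also have "\<dots> \<le> ?d ^ count_list is a * T (length is)"
        using d T0 by (intro mult_right_mono one_le_power) auto
      finally show ?thesis .
    next
      case False
      then obtain p where q: "q = p + 2" by (metis add.commute le_Suc_ex not_less_eq_eq one_add_one plus_1_eq_Suc)
      define ks where "ks = js @ replicate p a"
      have ca: "count_list js a = 0" using js by (simp add: count_list_0_iff)
      have cr: "count_list (replicate p a) a = p" by (induction p) auto
      have ks: "count_list ks a = p" "length ks + 2 = length is"
        by (auto simp: ks_def ca cr len q)
      have T0: "0 \<le> T (length is)"
      proof -
        have "0 \<le> T 0" using data[of "[]" 0] by simp
        also have "\<dots> \<le> T (length is)" by (rule monoD[OF T]) simp
        finally show ?thesis .
      qed
      have IH1: "\<bar>partials ks E x\<bar> \<le> ?d ^ p * T (length is)"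
      proof -
        have "\<bar>partials ks E x\<bar> \<le> ?d ^ p * T (length ks)" using less[of ks] ks q q_def by simp
        also have "\<dots> \<le> ?d ^ p * T (length is)" using ks by (intro mult_left_mono monoD[OF T]) auto
        finally show ?thesis .
      qed
      have IH2: "\<bar>partials (i # i # ks) E x\<bar> \<le> ?d ^ p * T (length is)" if "i \<noteq> a" for i
        using less[of "i # i # ks"] ks q q_def that by simp
      have "partials is E x = partials (a # a # ks) E x"
        by (rule partials_mset_cong[THEN fun_cong, OF sE]) (simp add: ms q ks_def)
      also have "\<dots> = - partials ks E x - (\<Sum>i\<in>UNIV - {a}. partials (i # i # ks) E x)"
        using helmholtz_sum[OF helmholtz_partials[OF E, of ks], of x]
        by (simp add: sum.remove[of UNIV a] algebra_simps)
      finally have "\<bar>partials is E x\<bar> \<le> \<bar>partials ks E x\<bar> + (\<Sum>i\<in>UNIV - {a}. \<bar>partials (i # i # ks) E x\<bar>)"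
        using sum_abs[of "\<lambda>i. partials (i # i # ks) E x" "UNIV - {a}"] by linarith
      also have "\<dots> \<le> ?d ^ p * T (length is) + (\<Sum>i\<in>UNIV - {a}. ?d ^ p * T (length is))"
        using IH1 IH2 by (intro add_mono sum_mono) auto
      also have "\<dots> = ?d * (?d ^ p * T (length is))"
        by (simp add: card_Diff_singleton of_nat_diff Suc_leI algebra_simps)
      \<comment> \<open>The equation yields \<open>d\<close> terms, hence one factor; a second one
        brings the exponent to \<open>p + 2\<close>.\<close>
      also have "\<dots> \<le> ?d * (?d * (?d ^ p * T (length is)))"
      proof (rule mult_left_mono)
        have "0 \<le> ?d ^ p * T (length is)" using T0 by simp
        from mult_right_mono[OF d this] show "?d ^ p * T (length is) \<le> ?d * (?d ^ p * T (length is))"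
          by (simp only: mult_1_left)
      qed simp
      finally show ?thesis using q q_def by (simp add: mult_ac)
    qed
  qed
  also have "\<dots> \<le> ?d ^ length is * T (length is)"
  proof (intro mult_right_mono power_increasing count_le_length d)
    have "0 \<le> T 0" using data[of "[]" 0] by simp
    also have "\<dots> \<le> T (length is)" by (rule monoD[OF T]) simp
    finally show "0 \<le> T (length is)" .
  qed
  finally show ?thesis .
qed

section \<open>Plane waves and finite differences\<close>

text \<open>The complex amplitude carries cosine and sine together, so that differentiation only
  multiplies it and never leaves the family.\<close>

definition wave :: "real ^ 'n \<Rightarrow> complex \<Rightarrow> real ^ 'n \<Rightarrow> real" where
  "wave \<xi> c x = Re (c * cis (\<xi> \<bullet> x))"

lemma partial_wave: "partial i (wave \<xi> c) = wave \<xi> (\<i> * of_real (\<xi> $ i) * c)"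
  and wave_differentiable: "wave \<xi> c differentiable (at x)"
proof -
  have d: "(wave \<xi> c has_derivative (\<lambda>v. Re (c * ((\<xi> \<bullet> v) *\<^sub>R (\<i> * cis (\<xi> \<bullet> x)))))) (at x)" for x
  proof -
    have w: "wave \<xi> c = (\<lambda>x. Re c * cos (\<xi> \<bullet> x) - Im c * sin (\<xi> \<bullet> x))"
      by (auto simp: wave_def fun_eq_iff)
    show ?thesis unfolding w
      by (rule derivative_eq_intros refl)+ (auto simp: fun_eq_iff algebra_simps)
  qed
  then show "wave \<xi> c differentiable (at x)" unfolding differentiable_def by blast
  show "partial i (wave \<xi> c) = wave \<xi> (\<i> * of_real (\<xi> $ i) * c)"
    using has_derivative_partial[OF d, of i]
    by (auto simp: fun_eq_iff wave_def inner_axis scaleR_conv_of_real mult_ac)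
qed

lemma partials_wave: "partials is (wave \<xi> c) = wave \<xi> ((\<Prod>i\<leftarrow>is. \<i> * of_real (\<xi> $ i)) * c)"
  by (induction "is") (auto simp: partial_wave mult_ac)

lemma smooth_wave: "smooth (wave \<xi> c)"
  by (auto simp: smooth_def partials_wave wave_differentiable)

lemma laplacian_wave: "laplacian (wave \<xi> c) x = - (\<xi> \<bullet> \<xi>) * wave \<xi> c x"
proof -
  have "partials [i, i] (wave \<xi> c) x = - (\<xi> $ i * \<xi> $ i) * wave \<xi> c x" for i
  proof -
    have "(\<Prod>j\<leftarrow>[i, i]. \<i> * of_real (\<xi> $ j)) * c = of_real (- (\<xi> $ i * \<xi> $ i)) * c"
      by (simp add: complex_eq_iff)
    then show ?thesis unfolding partials_wave wave_def
      by (simp add: mult.assoc del: of_real_mult of_real_minus)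
  qed
  then show ?thesis
    by (simp add: laplacian_def inner_vec_def sum_distrib_right sum_negf del: partials.simps)
qed

text \<open>The real span of the waves with frequencies in \<open>S\<close>. Scalars are absorbed by
  the complex amplitudes, and closure properties become inductions over the number of waves.\<close>

inductive trig_sum :: "(real ^ 'n) set \<Rightarrow> (real ^ 'n \<Rightarrow> real) \<Rightarrow> bool" for S where
  zero: "trig_sum S (\<lambda>x. 0)"
| insert: "\<xi> \<in> S \<Longrightarrow> trig_sum S f \<Longrightarrow> trig_sum S (\<lambda>x. wave \<xi> c x + f x)"

lemma trig_sum_wave: "\<xi> \<in> S \<Longrightarrow> trig_sum S (wave \<xi> c)"
  using trig_sum.insert[OF _ trig_sum.zero, of \<xi> S c] by simp

lemma trig_sum_add:
  assumes "trig_sum S f" "trig_sum S g"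
  shows "trig_sum S (\<lambda>x. f x + g x)"
  using assms by (induction f rule: trig_sum.induct) (auto simp: add.assoc intro: trig_sum.insert)

lemma trig_sum_sum:
  "(\<And>j. j \<in> J \<Longrightarrow> trig_sum S (f j)) \<Longrightarrow> trig_sum S (\<lambda>x. \<Sum>j\<in>J. f j x)"
  by (induction J rule: infinite_finite_induct) (auto intro: trig_sum.zero trig_sum_add)

lemma trig_sum_smooth: "trig_sum S f \<Longrightarrow> smooth f"
  by (induction rule: trig_sum.induct) (auto intro: smooth_add smooth_wave)

lemma trig_sum_laplacian:
  assumes "trig_sum S f" "\<And>\<xi>. \<xi> \<in> S \<Longrightarrow> \<xi> \<bullet> \<xi> = \<mu>"
  shows "laplacian f x + \<mu> * f x = 0"
  using assms(1)
proof (induction rule: trig_sum.induct)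
  case zero
  then show ?case by (simp add: laplacian_def partials_const del: partials.simps)
next
  case (insert \<xi> f c)
  have "laplacian (\<lambda>x. wave \<xi> c x + f x) x = laplacian (wave \<xi> c) x + laplacian f x"
    using insert by (simp add: laplacian_def partials_add smooth_wave trig_sum_smooth[of S] sum.distrib del: partials.simps)
  then show ?case using insert assms(2) by (simp add: laplacian_wave algebra_simps)
qed

lemma trig_sum_helmholtz: "trig_sum (sphere 0 1) f \<Longrightarrow> helmholtz_solution f"
  unfolding helmholtz_solution_def
  using trig_sum_smooth trig_sum_laplacian[of "sphere 0 1" f 1] by (auto simp: norm_eq_1)

text \<open>The \<open>m\<close>-th normalized finite difference of step \<open>\<epsilon>\<close>, as a combination of exponentials of
  frequencies \<open>0, \<epsilon>, \<dots>, m \<epsilon>\<close>; \<open>fd_moment \<epsilon> m k\<close> is the \<open>k\<close>-th derivative at 0 of that combination.\<close>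

definition fd_coeff :: "real \<Rightarrow> nat \<Rightarrow> nat \<Rightarrow> complex" where
  "fd_coeff \<epsilon> m r = (-1) ^ (m + r) * of_nat (m choose r) / (fact m * (\<i> * of_real \<epsilon>) ^ m)"

definition fd_moment :: "real \<Rightarrow> nat \<Rightarrow> nat \<Rightarrow> complex" where
  "fd_moment \<epsilon> m k = (\<Sum>r\<le>m. fd_coeff \<epsilon> m r * (\<i> * of_real (\<epsilon> * real r)) ^ k)"

text \<open>The explicit formula for Stirling numbers of the second kind. Pascal's rule, as
  \<open>r * (m choose r) = m * ((m choose r) - (m - 1 choose r))\<close> for positive
  \<open>m\<close>, turns the left side into the Stirling recurrence in \<open>k\<close>.\<close>

lemma alternating_binomial_power_sum:
  "(\<Sum>r\<le>m. (-1) ^ (m + r) * of_nat (m choose r) * of_nat r ^ k) = (fact m * of_nat (Stirling k m) :: 'a :: {comm_ring_1, semiring_char_0})"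
proof (induction k arbitrary: m)
  case 0
  show ?case
  proof (cases m)
    case (Suc n)
    have "(\<Sum>r\<le>m. (-1) ^ (m + r) * of_nat (m choose r) * of_nat r ^ 0)
        = (-1) ^ m * (\<Sum>r\<le>m. of_nat (m choose r) * (-1) ^ r * 1 ^ (m - r) :: 'a)"
      by (simp add: sum_distrib_left power_add mult_ac)
    also have "\<dots> = (-1) ^ m * ((-1) + 1) ^ m" by (subst binomial_ring) simp
    finally show ?thesis using Suc by simp
  qed simp
next
  case (Suc k)
  show ?case
  proof (cases m)
    case (Suc n)
    define t :: "nat \<Rightarrow> nat \<Rightarrow> 'a" where "t = (\<lambda>m r. (-1) ^ (m + r) * of_nat (m choose r) * of_nat r ^ k)"
    have pascal: "(-1) ^ (m + r) * of_nat (m choose r) * of_nat r ^ Suc k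
        = of_nat m * (t m r + (if r \<le> n then t n r else 0))" for r
    proof -
      have "r * (m choose r) + m * (n choose r) = m * (m choose r)"
      proof (cases r)
        case 0
        then show ?thesis by simp
      next
        case (Suc s)
        then show ?thesis using \<open>m = Suc n\<close> Suc_times_binomial[of s n] by (simp add: algebra_simps)
      qed
      then have "of_nat r * of_nat (m choose r) = (of_nat m * (of_nat (m choose r) - of_nat (n choose r)) :: 'a)"
        by (metis (no_types, lifting) add_diff_cancel_right' of_nat_add of_nat_mult right_diff_distrib)
      moreover have "(-1) ^ (m + r) * of_nat (m choose r) * of_nat r ^ Suc k
        = (-1) ^ (m + r) * of_nat r ^ k * (of_nat r * of_nat (m choose r) :: 'a)"
        by (simp add: mult_ac)
      ultimately have "(-1) ^ (m + r) * of_nat (m choose r) * of_nat r ^ Suc k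
        = (-1) ^ (m + r) * of_nat r ^ k * (of_nat m * (of_nat (m choose r) - of_nat (n choose r)) :: 'a)"
        by simp
      also have "\<dots> = of_nat m * (t m r + (if r \<le> n then t n r else 0))"
        using Suc by (auto simp: t_def algebra_simps binomial_eq_0)
      finally show ?thesis .
    qed
    have "(\<Sum>r\<le>m. (-1) ^ (m + r) * of_nat (m choose r) * of_nat r ^ Suc k)
      = of_nat m * ((\<Sum>r\<le>m. t m r) + (\<Sum>r\<le>n. t n r))"
      unfolding pascal sum_distrib_left[symmetric] sum.distrib using Suc by simp
    also have "\<dots> = of_nat m * (fact m * of_nat (Stirling k m) + fact n * of_nat (Stirling k n))"
      unfolding t_def Suc.IH ..
    finally show ?thesis using Suc by (simp add: algebra_simps)
  qed simp
qed

text \<open>The combination imitates \<open>t ^ m / fact m\<close>: derivatives at 0 of order below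
  \<open>m\<close> vanish, the \<open>m\<close>-th is 1, and the higher ones carry at least one
  factor \<open>\<epsilon>\<close>.\<close>

lemma fd_moment_eq:
  assumes "\<epsilon> > 0"
  shows "fd_moment \<epsilon> m k = (if k < m then 0 else (\<i> * of_real \<epsilon>) ^ (k - m) * of_nat (Stirling k m))"
proof -
  have "fd_moment \<epsilon> m k = (\<i> * of_real \<epsilon>) ^ k / (fact m * (\<i> * of_real \<epsilon>) ^ m)
      * (\<Sum>r\<le>m. (-1) ^ (m + r) * of_nat (m choose r) * of_nat r ^ k)"
    by (simp add: fd_moment_def fd_coeff_def sum_distrib_left power_mult_distrib sum_divide_distrib field_simps)
  also have "\<dots> = (\<i> * of_real \<epsilon>) ^ k / (\<i> * of_real \<epsilon>) ^ m * of_nat (Stirling k m)"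
    by (simp add: alternating_binomial_power_sum)
  finally show ?thesis using assms by (auto simp: power_diff)
qed

text \<open>Crude, but for bounded \<open>m\<close> only exponential in \<open>k\<close>, which the
  factorials in the Taylor series beat.\<close>

lemma Stirling_le_power: "Stirling k m \<le> (Suc m) ^ k"
proof (induction k arbitrary: m)
  case 0
  then show ?case by (cases m) auto
next
  case (Suc k)
  show ?case
  proof (cases m)
    case (Suc n)
    have "Stirling (Suc k) m = Suc n * Stirling k (Suc n) + Stirling k n" by (simp add: Suc)
    also have "\<dots> \<le> Suc n * Suc (Suc n) ^ k + Suc (Suc n) ^ k"
      using Suc.IH[of "Suc n"] Suc.IH[of n] power_mono[of "Suc n" "Suc (Suc n)" k]
      by (intro add_mono mult_left_mono) auto
    finally show ?thesis using Suc by simp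
  qed simp
qed

lemma norm_fd_moment_le:
  assumes "0 < \<epsilon>" "\<epsilon> \<le> 1" "m \<le> N"
  shows "norm (fd_moment \<epsilon> m k) \<le> (if m < k then \<epsilon> else 1) * real (Suc N) ^ k"
proof (cases "m < k")
  case True
  have "norm (fd_moment \<epsilon> m k) = \<epsilon> ^ (k - m) * real (Stirling k m)"
    using True assms by (simp add: fd_moment_eq norm_mult norm_power)
  also have "\<dots> \<le> \<epsilon> ^ 1 * real (Suc N) ^ k"
  proof (intro mult_mono power_decreasing)
    have "Stirling k m \<le> Suc N ^ k"
      using Stirling_le_power[of k m] power_mono[of "Suc m" "Suc N" k] assms by simp
    then show "real (Stirling k m) \<le> real (Suc N) ^ k" by (metis of_nat_le_iff of_nat_power)
  qed (use True assms in auto)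
  finally show ?thesis using True by simp
next
  case False
  then have "norm (fd_moment \<epsilon> m k) \<le> 1" using assms by (cases "k = m") (auto simp: fd_moment_eq)
  also have "\<dots> \<le> real (Suc N) ^ k" by (rule one_le_power) simp
  finally show ?thesis using False by simp
qed

text \<open>A coordinate with \<open>\<beta> i < \<alpha> i\<close> annihilates the product,
  equality gives exactly 1, and otherwise some coordinate with \<open>\<alpha> j < \<beta> j\<close>
  contributes a factor \<open>\<epsilon>\<close>.\<close>

lemma fd_moment_prod_close:
  fixes \<alpha> \<beta> :: "'n::finite \<Rightarrow> nat"
  assumes \<epsilon>: "0 < \<epsilon>" "\<epsilon> \<le> 1" and N: "\<And>i. \<alpha> i \<le> N"
  shows "norm ((\<Prod>i\<in>UNIV. fd_moment \<epsilon> (\<alpha> i) (\<beta> i)) - (if \<alpha> = \<beta> then 1 else 0)) \<le> \<epsilon> * real (Suc N) ^ (\<Sum>i\<in>UNIV. \<beta> i)"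
proof (cases "\<exists>i. \<beta> i < \<alpha> i")
  case True
  then have 0: "(\<Prod>i\<in>UNIV. fd_moment \<epsilon> (\<alpha> i) (\<beta> i)) = 0" using \<epsilon> by (intro prod_zero) (auto simp: fd_moment_eq)
  have "\<alpha> \<noteq> \<beta>" using True by auto
  then show ?thesis unfolding 0 using \<epsilon> by simp
next
  case False
  show ?thesis
  proof (cases "\<alpha> = \<beta>")
    case True
    then show ?thesis using \<epsilon> by (simp add: fd_moment_eq)
  next
    case ne: False
    then obtain j where j: "\<alpha> j < \<beta> j" using False by (metis ext linorder_neqE_nat)
    have "norm (\<Prod>i\<in>UNIV. fd_moment \<epsilon> (\<alpha> i) (\<beta> i)) = (\<Prod>i\<in>UNIV. norm (fd_moment \<epsilon> (\<alpha> i) (\<beta> i)))"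
      by (rule prod_norm[symmetric])
    also have "\<dots> \<le> (\<Prod>i\<in>UNIV. (if i = j then \<epsilon> else 1) * real (Suc N) ^ \<beta> i)"
    proof (intro prod_mono conjI norm_ge_zero)
      fix i
      have "norm (fd_moment \<epsilon> (\<alpha> i) (\<beta> i)) \<le> (if \<alpha> i < \<beta> i then \<epsilon> else 1) * real (Suc N) ^ \<beta> i"
        by (rule norm_fd_moment_le[OF \<epsilon> N])
      also have "\<dots> \<le> (if i = j then \<epsilon> else 1) * real (Suc N) ^ \<beta> i"
        using j \<epsilon> by (intro mult_right_mono) auto
      finally show "norm (fd_moment \<epsilon> (\<alpha> i) (\<beta> i)) \<le> (if i = j then \<epsilon> else 1) * real (Suc N) ^ \<beta> i" .
    qed
    also have "\<dots> = \<epsilon> * real (Suc N) ^ (\<Sum>i\<in>UNIV. \<beta> i)"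
      by (simp add: prod.distrib power_sum)
    finally show ?thesis using ne by simp
  qed
qed

section \<open>Density of plane waves\<close>

lemma prod_list_count:
  fixes f :: "'n::finite \<Rightarrow> 'a::comm_monoid_mult"
  shows "(\<Prod>j\<leftarrow>js. f j) = (\<Prod>i\<in>UNIV. f i ^ count_list js i)"
proof (induction js)
  case (Cons j js)
  have "(\<Prod>i\<in>UNIV. f i ^ count_list (j # js) i) = (\<Prod>i\<in>UNIV. (if j = i then f i else 1) * f i ^ count_list js i)"
    by (rule prod.cong) auto
  then show ?case by (simp add: prod.distrib Cons)
qed simp

text \<open>Plane waves with almost vertical frequencies \<open>(\<xi>', \<plusminus> sqrt (1 - |\<xi>'|\<^sup>2))\<close>, \<open>\<xi>' = \<epsilon> r\<close>, combine to a
  solution whose Cauchy data on the hyperplane orthogonal to \<open>a\<close> are finite difference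
  approximations of polynomials with prescribed coefficients \<open>A\<close> and \<open>B\<close>.\<close>

lemma exists_trig_sum_cauchy_data:
  fixes A B :: "('n::finite \<Rightarrow> nat) \<Rightarrow> real" and a :: 'n
  defines "grid N \<equiv> {\<alpha>. (\<forall>i. \<alpha> i \<le> N) \<and> \<alpha> a = 0}"
  assumes \<epsilon>: "0 < \<epsilon>" "\<epsilon> * real N * real CARD('n) < 1"
  shows "\<exists>P. trig_sum (sphere 0 1) P \<and>
    (\<forall>js b. a \<notin> set js \<longrightarrow> b \<le> 1 \<longrightarrow> partials (js @ replicate b a) P 0
      = (\<Sum>\<alpha>\<in>grid N. (if b = 0 then A \<alpha> else B \<alpha>) * Re (\<Prod>i\<in>UNIV. fd_moment \<epsilon> (\<alpha> i) (count_list js i))))"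
proof -
  define e :: "real ^ 'n" where "e = axis a 1"
  define \<xi> :: "('n \<Rightarrow> nat) \<Rightarrow> real ^ 'n" where "\<xi> = (\<lambda>r. \<chi> i. \<epsilon> * real (r i))"
  define s where "s = (\<lambda>r. sqrt (1 - \<xi> r \<bullet> \<xi> r))"
  define c where "c = (\<lambda>(\<alpha>::'n \<Rightarrow> nat) r. \<Prod>i\<in>UNIV. fd_coeff \<epsilon> (\<alpha> i) (r i))"
  define rs where "rs = (\<lambda>\<alpha>::'n \<Rightarrow> nat. PiE UNIV (\<lambda>i. {..\<alpha> i}))"
  \<comment> \<open>For the pair of mirrored frequencies, \<open>c0\<close> produces the trace and
    \<open>c1\<close> the normal derivative: the amplitudes add up to \<open>2 * c0\<close>, and in
    the normal derivative to \<open>2 * \<i> * s * c1\<close>. Hence the two denominators.\<close>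
  define c0 c1 where "c0 = (\<lambda>\<alpha> r. of_real (A \<alpha>) * c \<alpha> r / 2)"
    and "c1 = (\<lambda>\<alpha> r. of_real (B \<alpha>) * c \<alpha> r / (2 * \<i> * of_real (s r)))"
  define W where "W = (\<lambda>\<alpha> r x. wave (\<xi> r + s r *\<^sub>R e) (c0 \<alpha> r + c1 \<alpha> r) x + wave (\<xi> r - s r *\<^sub>R e) (c0 \<alpha> r - c1 \<alpha> r) x)"
  define P where "P = (\<lambda>x. \<Sum>\<alpha>\<in>grid N. \<Sum>r\<in>rs \<alpha>. W \<alpha> r x)"
  have r: "r a = 0" "s r > 0" "(s r)\<^sup>2 = 1 - \<xi> r \<bullet> \<xi> r" "\<xi> r $ a = 0"
    if "\<alpha> \<in> grid N" "r \<in> rs \<alpha>" for \<alpha> r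
  proof -
    have ri: "r i \<le> \<alpha> i" for i using that by (auto simp: rs_def PiE_iff)
    then show "r a = 0" using that(1) by (auto simp: grid_def) (metis le_zero_eq)
    then show "\<xi> r $ a = 0" by (simp add: \<xi>_def)
    \<comment> \<open>The horizontal part stays inside the unit ball, so \<open>s r\<close> is real
      and positive and completes it to a unit vector.\<close>
    have "norm (\<xi> r) \<le> (\<Sum>i\<in>UNIV. \<bar>\<xi> r $ i\<bar>)" by (rule norm_le_l1_cart)
    also have "\<dots> \<le> (\<Sum>i\<in>(UNIV::'n set). \<epsilon> * real N)"
    proof (rule sum_mono)
      fix i
      have "r i \<le> N" using ri[of i] that(1) by (force simp: grid_def intro: order_trans)
      then show "\<bar>\<xi> r $ i\<bar> \<le> \<epsilon> * real N" using \<epsilon> by (simp add: \<xi>_def abs_mult)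
    qed
    also have "\<dots> < 1" using \<epsilon> by (simp add: mult_ac)
    finally have "\<xi> r \<bullet> \<xi> r < 1" by (simp add: power2_norm_eq_inner[symmetric] power_less_one_iff)
    then show "s r > 0" "(s r)\<^sup>2 = 1 - \<xi> r \<bullet> \<xi> r" by (simp_all add: s_def)
  qed
  have "trig_sum (sphere 0 1) (W \<alpha> r)" if "\<alpha> \<in> grid N" "r \<in> rs \<alpha>" for \<alpha> r
  proof -
    have "\<xi> r \<bullet> e = 0" "e \<bullet> e = 1" using r(4)[OF that] by (simp_all add: e_def inner_axis inner_axis_axis)
    then have "(\<xi> r + s r *\<^sub>R e) \<bullet> (\<xi> r + s r *\<^sub>R e) = 1" "(\<xi> r - s r *\<^sub>R e) \<bullet> (\<xi> r - s r *\<^sub>R e) = 1"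
      using r(3)[OF that] by (simp_all add: inner_add inner_diff inner_commute power2_eq_square)
    then show ?thesis
      unfolding W_def by (intro trig_sum_add trig_sum_wave) (simp_all add: norm_eq_1)
  qed
  then have P1: "trig_sum (sphere 0 1) P"
    unfolding P_def by (intro trig_sum_sum) auto
  have "partials (js @ replicate b a) P 0
      = (\<Sum>\<alpha>\<in>grid N. (if b = 0 then A \<alpha> else B \<alpha>) * Re (\<Prod>i\<in>UNIV. fd_moment \<epsilon> (\<alpha> i) (count_list js i)))"
    if js: "a \<notin> set js" and b: "b \<le> 1" for js b
  proof -
    define X where "X = (if b = 0 then A else B)"
    have sW: "smooth (W \<alpha> r)" for \<alpha> r unfolding W_def by (intro smooth_add smooth_wave)
    \<comment> \<open>The list \<open>js\<close> avoids \<open>a\<close>, so these derivatives do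
      not see the vertical component.\<close>
    have pm: "(\<Prod>j\<leftarrow>js. \<i> * complex_of_real ((\<xi> r + t *\<^sub>R e) $ j)) = (\<Prod>i\<in>UNIV. (\<i> * of_real (\<epsilon> * real (r i))) ^ count_list js i)" for r t
    proof -
      have "(\<Prod>j\<leftarrow>js. \<i> * complex_of_real ((\<xi> r + t *\<^sub>R e) $ j)) = (\<Prod>j\<leftarrow>js. \<i> * of_real (\<epsilon> * real (r j)))"
        using js by (intro arg_cong[where f=prod_list] map_cong refl) (auto simp: \<xi>_def e_def axis_def)
      then show ?thesis by (simp only: prod_list_count)
    qed
    have pW: "partials (js @ replicate b a) (W \<alpha> r) 0
        = X \<alpha> * Re (\<Prod>i\<in>UNIV. fd_coeff \<epsilon> (\<alpha> i) (r i) * (\<i> * of_real (\<epsilon> * real (r i))) ^ count_list js i)"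
      if "\<alpha> \<in> grid N" "r \<in> rs \<alpha>" for \<alpha> r
    proof -
      define p where "p = (\<Prod>i\<in>UNIV. (\<i> * complex_of_real (\<epsilon> * real (r i))) ^ count_list js i)"
      have sr: "s r \<noteq> 0" and \<xi>a: "\<xi> r $ a = 0" using r[OF that] by auto
      have w: "partials (js @ replicate b a) (wave (\<xi> r + t *\<^sub>R e) k) 0 = Re (p * (\<i> * of_real t) ^ b * k)" for t k
      proof -
        have "(\<xi> r + t *\<^sub>R e) $ a = t" using \<xi>a by (simp add: e_def axis_def)
        then have "(\<Prod>j\<leftarrow>js @ replicate b a. \<i> * complex_of_real ((\<xi> r + t *\<^sub>R e) $ j)) = p * (\<i> * of_real t) ^ b"
          by (simp only: map_append prod_list.append pm map_replicate prod_list_replicate p_def)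
        then show ?thesis by (simp only: partials_wave wave_def inner_zero_right cis_zero mult_1_right)
      qed
      have w': "partials (js @ replicate b a) (wave (\<xi> r - s r *\<^sub>R e) k) 0 = Re (p * (\<i> * of_real (- s r)) ^ b * k)" for k
        using w[of "- s r" k] by simp
      have "partials (js @ replicate b a) (W \<alpha> r) 0
        = Re (p * (\<i> * of_real (s r)) ^ b * (c0 \<alpha> r + c1 \<alpha> r) + p * (\<i> * of_real (- s r)) ^ b * (c0 \<alpha> r - c1 \<alpha> r))"
        unfolding W_def partials_add[OF smooth_wave smooth_wave] w w' by simp
      also have "p * (\<i> * of_real (s r)) ^ b * (c0 \<alpha> r + c1 \<alpha> r) + p * (\<i> * of_real (- s r)) ^ b * (c0 \<alpha> r - c1 \<alpha> r)
         = of_real (X \<alpha>) * (c \<alpha> r * p)"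
      proof (cases "b = 0")
        case True
        then show ?thesis by (simp add: c0_def X_def algebra_simps)
      next
        case False
        then have "b = 1" using b by simp
        then have "p * (\<i> * of_real (s r)) ^ b * (c0 \<alpha> r + c1 \<alpha> r) + p * (\<i> * of_real (- s r)) ^ b * (c0 \<alpha> r - c1 \<alpha> r)
           = p * (2 * \<i> * of_real (s r)) * c1 \<alpha> r" by (simp add: algebra_simps)
        also have "\<dots> = of_real (B \<alpha>) * (c \<alpha> r * p)" using sr by (simp add: c1_def)
        finally show ?thesis using False by (simp add: X_def)
      qed
      also have "c \<alpha> r * p = (\<Prod>i\<in>UNIV. fd_coeff \<epsilon> (\<alpha> i) (r i) * (\<i> * of_real (\<epsilon> * real (r i))) ^ count_list js i)"
        by (simp add: c_def p_def prod.distrib)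
      finally show ?thesis by simp
    qed
    have "partials (js @ replicate b a) P 0 = (\<Sum>\<alpha>\<in>grid N. \<Sum>r\<in>rs \<alpha>. partials (js @ replicate b a) (W \<alpha> r) 0)"
      unfolding P_def by (subst partials_sum; (intro smooth_sum sW)?) (subst partials_sum; (intro smooth_sum sW refl)?)
    also have "\<dots> = (\<Sum>\<alpha>\<in>grid N. X \<alpha> * Re (\<Sum>r\<in>rs \<alpha>. \<Prod>i\<in>UNIV. fd_coeff \<epsilon> (\<alpha> i) (r i) * (\<i> * of_real (\<epsilon> * real (r i))) ^ count_list js i))"
      by (intro sum.cong refl) (simp add: pW sum_distrib_left)
    \<comment> \<open>The sum over the box \<open>rs \<alpha>\<close> of products is a product of
      one-dimensional sums, one moment for each coordinate.\<close>
    also have "\<dots> = (\<Sum>\<alpha>\<in>grid N. X \<alpha> * Re (\<Prod>i\<in>UNIV. fd_moment \<epsilon> (\<alpha> i) (count_list js i)))"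
      unfolding rs_def fd_moment_def by (subst prod_sum_PiE) auto
    finally show ?thesis by (auto simp: X_def if_distrib[of "\<lambda>f. f _"] cong: if_cong)
  qed
  with P1 show ?thesis by blast
qed

lemma exists_list_count:
  fixes \<alpha> :: "'n::finite \<Rightarrow> nat"
  shows "\<exists>js. count_list js = \<alpha>"
proof -
  have "finite {i. \<alpha> i > 0}" by simp
  then have "count (Abs_multiset \<alpha>) = \<alpha>" by simp
  moreover obtain js where "mset js = Abs_multiset \<alpha>" using ex_mset by blast
  ultimately show ?thesis by (metis count_mset ext)
qed

text \<open>The Cauchy data of the error consist of derivatives of \<open>h\<close> of order beyond
  \<open>N\<close>, small because \<open>h\<close> is entire, and of finite difference errors
  proportional to \<open>\<epsilon>\<close>. The order of choice matters: \<open>\<epsilon>0\<close>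
  depends on the radius, \<open>N\<close> on \<open>\<epsilon>0\<close>, and
  \<open>\<epsilon>\<close> comes last since \<open>S\<close> and \<open>Y\<close> depend on
  \<open>N\<close>.\<close>

lemma helmholtz_approx_trig_sum:
  fixes h :: "real ^ 'n \<Rightarrow> real"
  assumes h: "helmholtz_solution h" and \<eta>: "\<eta> > 0"
  obtains P where "trig_sum (sphere 0 1) P" "\<And>x. norm x \<le> R \<Longrightarrow> \<bar>h x - P x\<bar> \<le> \<eta>"
proof -
  define R' where "R' = max R 1"
  define d where "d = real CARD('n)"
  define a :: 'n where "a = undefined"
  have d: "d \<ge> 1" by (simp add: d_def Suc_leI)
  have R': "R' \<ge> 1" "R' \<ge> R" by (auto simp: R'_def)
  have dR: "d\<^sup>2 * R' > 0" using d R' by (intro mult_pos_pos) auto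
  \<comment> \<open>One factor \<open>d\<close> comes from the l1 norm in the Taylor bound, the
    other from eliminating the direction \<open>a\<close>; this value makes the tail geometric with
    ratio 1/2.\<close>
  define \<epsilon>0 where "\<epsilon>0 = 1 / (2 * (d\<^sup>2 * R'))"
  have \<epsilon>0: "\<epsilon>0 > 0" "d\<^sup>2 * R' * \<epsilon>0 = 1 / 2" using dR by (auto simp: \<epsilon>0_def)
  obtain C where C: "C \<ge> 0" "\<And>is. \<bar>partials is h 0\<bar> \<le> C * \<epsilon>0 ^ length is * fact (length is)"
    using helmholtz_entire[OF h \<epsilon>0(1), of 0] by (metis norm_zero order_refl)
  \<comment> \<open>From order \<open>1 / \<epsilon>0\<close> on,
    \<open>\<epsilon>0 ^ m * fact m\<close> is nondecreasing in \<open>m\<close>, as monotonicity of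
    \<open>T\<close> requires.\<close>
  obtain N1 :: nat where N1: "1 / \<epsilon>0 \<le> N1" using real_arch_simple by blast
  have "(\<lambda>n. C * (1/2) ^ n) \<longlonglongrightarrow> C * 0" by (intro tendsto_intros LIMSEQ_power_zero) simp
  then have "\<forall>\<^sub>F n in sequentially. C * (1/2) ^ n < \<eta> / 2"
    using \<eta> by (intro order_tendstoD(2)) auto
  then obtain N where N: "N \<ge> N1" "C * (1/2) ^ N \<le> \<eta> / 2"
    unfolding eventually_sequentially by (metis less_imp_le linorder_linear)
  define L :: "('n \<Rightarrow> nat) \<Rightarrow> 'n list" where "L = (\<lambda>\<alpha>. SOME js. count_list js = \<alpha>)"
  have L: "count_list (L \<alpha>) = \<alpha>" for \<alpha> unfolding L_def by (rule someI_ex[OF exists_list_count])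
  define A B where "A = (\<lambda>\<alpha>. partials (L \<alpha>) h 0)" and "B = (\<lambda>\<alpha>. partials (L \<alpha> @ [a]) h 0)"
  have sh: "smooth h" using h by (rule helmholtz_smooth)
  have mL: "mset (L (count_list js)) = mset js" for js
    by (rule multiset_eqI) (simp add: count_mset L)
  have AB: "partials (js @ replicate b a) h 0 = (if b = 0 then A (count_list js) else B (count_list js))" if "b \<le> 1" for js b
    using that by (cases b) (auto simp: A_def B_def intro!: partials_mset_cong[THEN fun_cong, OF sh] simp: mL)
  define grid where "grid = {\<alpha>::'n \<Rightarrow> nat. (\<forall>i. \<alpha> i \<le> N) \<and> \<alpha> a = 0}"
  have fgrid: "finite grid"
  proof (rule finite_subset)
    show "grid \<subseteq> PiE UNIV (\<lambda>i. {..N})" by (auto simp: grid_def)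
  qed (intro finite_PiE; simp)
  define S where "S = (\<Sum>\<alpha>\<in>grid. \<bar>A \<alpha>\<bar> + \<bar>B \<alpha>\<bar>)"
  have S: "S \<ge> 0" unfolding S_def by (intro sum_nonneg) auto
  define K where "K = real (Suc N)"
  define Y where "Y = exp (d\<^sup>2 * R' * K)"
  \<comment> \<open>The first bound keeps the horizontal frequencies inside the unit ball, the
    second keeps the accumulated finite difference error below \<open>\<eta> / 2\<close>.\<close>
  define \<epsilon> where "\<epsilon> = min (1 / (real N * d + 1)) (\<eta> / 2 / ((S + 1) * Y))"
  have Y: "Y > 0" by (simp add: Y_def)
  have Nd: "real N * d \<ge> 0" using d by simp
  have \<epsilon>: "\<epsilon> > 0" "\<epsilon> \<le> 1" "\<epsilon> * real N * d < 1" "\<epsilon> * S * Y \<le> \<eta> / 2"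
  proof -
    show e0: "\<epsilon> > 0" using \<eta> S Y Nd by (auto simp: \<epsilon>_def intro!: divide_pos_pos mult_pos_pos)
    have e1: "\<epsilon> \<le> 1 / (real N * d + 1)" "\<epsilon> \<le> \<eta> / 2 / ((S + 1) * Y)" by (simp_all add: \<epsilon>_def)
    have SY: "(S + 1) * Y > 0" using S Y by simp
    have "\<epsilon> * (real N * d + 1) \<le> 1" using e1(1) Nd by (simp add: pos_le_divide_eq)
    then have 1: "\<epsilon> * (real N * d) + \<epsilon> \<le> 1" by (simp add: algebra_simps)
    have "\<epsilon> * (real N * d) \<ge> 0" using e0 Nd by simp
    then show "\<epsilon> \<le> 1" "\<epsilon> * real N * d < 1" using 1 e0 by (simp_all add: mult.assoc)
    have "\<epsilon> * ((S + 1) * Y) \<le> \<eta> / 2" using e1(2) SY by (simp add: pos_le_divide_eq)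
    moreover have "\<epsilon> * ((S + 1) * Y) = \<epsilon> * S * Y + \<epsilon> * Y" by (simp add: algebra_simps)
    ultimately show "\<epsilon> * S * Y \<le> \<eta> / 2" using e0 Y by (smt (verit) mult_pos_pos)
  qed
  obtain P where P: "trig_sum (sphere 0 1) P" and Pd:
    "\<And>js b. a \<notin> set js \<Longrightarrow> b \<le> 1 \<Longrightarrow> partials (js @ replicate b a) P 0
      = (\<Sum>\<alpha>\<in>grid. (if b = 0 then A \<alpha> else B \<alpha>) * Re (\<Prod>i\<in>UNIV. fd_moment \<epsilon> (\<alpha> i) (count_list js i)))"
    using exists_trig_sum_cauchy_data[OF \<epsilon>(1) \<epsilon>(3)[unfolded d_def], of a A B, folded grid_def] by blast
  define E where "E = (\<lambda>x. h x - P x)"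
  have hP: "helmholtz_solution P" using P by (rule trig_sum_helmholtz)
  have E: "helmholtz_solution E" unfolding E_def by (rule helmholtz_diff[OF h hP])
  define T where "T = (\<lambda>m. (if N < m then C * \<epsilon>0 ^ m * fact m else 0) + \<epsilon> * S * K ^ m)"
  have T: "mono T"
  proof (rule incseq_SucI)
    fix m
    have "C * \<epsilon>0 ^ m * fact m \<le> C * \<epsilon>0 ^ Suc m * fact (Suc m)" if "N < m"
    proof -
      have "1 / \<epsilon>0 \<le> real (Suc m)" using N1 N that by linarith
      then have "1 \<le> \<epsilon>0 * real (Suc m)" using \<epsilon>0 by (simp add: pos_divide_le_eq mult.commute)
      from mult_left_mono[OF this, of "C * \<epsilon>0 ^ m * fact m"] show ?thesis
        using C \<epsilon>0 by (simp add: algebra_simps)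
    qed
    moreover have "0 \<le> C * \<epsilon>0 ^ Suc m * fact (Suc m)" using C \<epsilon>0 by simp
    moreover have "\<epsilon> * S * K ^ m \<le> \<epsilon> * S * K ^ Suc m"
      using \<epsilon> S by (intro mult_left_mono power_increasing) (auto simp: K_def)
    ultimately show "T m \<le> T (Suc m)" by (auto simp: T_def less_Suc_eq)
  qed
  have data: "\<bar>partials (js @ replicate b a) E 0\<bar> \<le> T (length js + b)" if js: "a \<notin> set js" and b: "b \<le> 1" for js b
  proof -
    define \<beta> where "\<beta> = count_list js"
    define X where "X = (if b = 0 then A else B)"
    define q where "q = (\<lambda>\<alpha>. \<Prod>i\<in>UNIV. fd_moment \<epsilon> (\<alpha> i) (\<beta> i))"
    have q: "\<bar>Re (q \<alpha>) - (if \<alpha> = \<beta> then 1 else 0)\<bar> \<le> \<epsilon> * K ^ length js" if "\<alpha> \<in> grid" for \<alpha>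
    proof -
      have "\<bar>Re (q \<alpha> - (if \<alpha> = \<beta> then 1 else 0))\<bar> \<le> norm (q \<alpha> - (if \<alpha> = \<beta> then 1 else 0))"
        by (rule abs_Re_le_cmod)
      also have "\<dots> \<le> \<epsilon> * real (Suc N) ^ (\<Sum>i\<in>UNIV. \<beta> i)"
        unfolding q_def by (rule fd_moment_prod_close) (use \<epsilon> that in \<open>auto simp: grid_def\<close>)
      also have "(\<Sum>i\<in>UNIV. \<beta> i) = length js"
      proof -
        have "(\<Sum>i\<in>UNIV. count_list js i) = (\<Sum>i\<in>set js. count_list js i)"
          by (rule sum.mono_neutral_right) (auto simp: count_list_0_iff)
        then show ?thesis by (simp add: \<beta>_def sum_count_set)
      qed
      finally show ?thesis by (simp add: K_def split: if_splits)
    qed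
    have "partials (js @ replicate b a) E 0 = X \<beta> - (\<Sum>\<alpha>\<in>grid. X \<alpha> * Re (q \<alpha>))"
      unfolding E_def partials_diff[OF sh helmholtz_smooth[OF hP]] AB[OF b] Pd[OF js b]
      by (simp add: X_def q_def \<beta>_def)
    \<comment> \<open>Inside the grid the coefficient \<open>X \<beta>\<close> cancels. Outside it
      some \<open>\<beta> i\<close> exceeds \<open>N\<close>, because \<open>\<beta> a = 0\<close>,
      so the order of the derivative exceeds \<open>N\<close> and the growth bound for
      \<open>h\<close> applies.\<close>
    also have "\<dots> = (if \<beta> \<in> grid then 0 else X \<beta>) - (\<Sum>\<alpha>\<in>grid. X \<alpha> * (Re (q \<alpha>) - (if \<alpha> = \<beta> then 1 else 0)))"
    proof -
      have "(\<Sum>\<alpha>\<in>grid. X \<alpha> * (if \<alpha> = \<beta> then 1 else 0)) = (if \<beta> \<in> grid then X \<beta> else 0)"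
        using fgrid by (simp add: if_distrib[of "\<lambda>x. X _ * x"] sum.delta cong: if_cong)
      then show ?thesis by (simp add: right_diff_distrib sum_subtractf)
    qed
    finally have "\<bar>partials (js @ replicate b a) E 0\<bar>
        \<le> \<bar>if \<beta> \<in> grid then 0 else X \<beta>\<bar> + \<bar>\<Sum>\<alpha>\<in>grid. X \<alpha> * (Re (q \<alpha>) - (if \<alpha> = \<beta> then 1 else 0))\<bar>" by linarith
    also have "\<bar>if \<beta> \<in> grid then 0 else X \<beta>\<bar> \<le> (if N < length js + b then C * \<epsilon>0 ^ (length js + b) * fact (length js + b) else 0)"
    proof (cases "\<beta> \<in> grid")
      case True
      then show ?thesis using C \<epsilon>0 by auto
    next
      case False
      have "\<beta> a = 0" using js by (simp add: \<beta>_def count_list_0_iff)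
      with False obtain i where "\<beta> i > N" by (auto simp: grid_def not_le)
      then have "N < length js + b" using count_le_length[of js i] by (simp add: \<beta>_def)
      moreover have "\<bar>X \<beta>\<bar> \<le> C * \<epsilon>0 ^ (length js + b) * fact (length js + b)"
        using C(2)[of "js @ replicate b a"] unfolding AB[OF b] by (auto simp: X_def \<beta>_def)
      ultimately show ?thesis using False by simp
    qed
    also have "\<bar>\<Sum>\<alpha>\<in>grid. X \<alpha> * (Re (q \<alpha>) - (if \<alpha> = \<beta> then 1 else 0))\<bar> \<le> (\<Sum>\<alpha>\<in>grid. (\<bar>A \<alpha>\<bar> + \<bar>B \<alpha>\<bar>) * (\<epsilon> * K ^ length js))"
      by (rule order_trans[OF sum_abs]) (auto simp: abs_mult X_def intro!: sum_mono mult_mono q)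
    also have "\<dots> = \<epsilon> * S * K ^ length js" by (simp add: S_def sum_distrib_right[symmetric])
    also have "\<dots> \<le> \<epsilon> * S * K ^ (length js + b)"
      using \<epsilon> S by (intro mult_left_mono power_increasing) (auto simp: K_def)
    finally show ?thesis by (simp add: T_def)
  qed
  have "\<bar>h x - P x\<bar> \<le> \<eta>" if x: "norm x \<le> R" for x
  proof -
    have "\<bar>E x\<bar> \<le> \<eta>"
    proof (rule helmholtz_taylor_bound[OF E, where T="\<lambda>k. d ^ k * T k" and R=R'])
      show "\<bar>partials is E 0\<bar> \<le> d ^ length is * T (length is)" for "is"
        unfolding d_def by (rule helmholtz_cauchy_data[OF E T data])
      show "norm x \<le> R'" using x R' by simp
      fix n
      \<comment> \<open>The second summand is the remainder of the geometric series; including it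
        makes the bound inductive.\<close>
      have tail: "(\<Sum>k<n. if N < k then (1/2::real) ^ k else 0) + (if N < n then (1/2) ^ (n - 1) else (1/2) ^ N) \<le> (1/2) ^ N"
      proof (induction n)
        case (Suc n)
        have "(1/2::real) ^ (n - 1) = 2 * (1/2) ^ n" if "N < n" using that by (cases n) auto
        then show ?case using Suc by (auto simp: less_Suc_eq split: if_splits)
      qed simp
      have "(\<Sum>k<n. (real CARD('n) * R') ^ k / fact k * (d ^ k * T k))
          = (\<Sum>k<n. C * (if N < k then (1/2) ^ k else 0) + \<epsilon> * S * ((d\<^sup>2 * R' * K) ^ k / fact k))"
      proof (rule sum.cong[OF refl])
        fix k
        define G where "G = (d\<^sup>2 * R') ^ k"
        have "(real CARD('n) * R') ^ k * d ^ k = G"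
          unfolding G_def by (simp add: d_def power_mult_distrib[symmetric] power2_eq_square mult_ac)
        then have "(real CARD('n) * R') ^ k / fact k * (d ^ k * T k) = G * T k / fact k" by (simp add: mult_ac)
        also have "\<dots> = C * (if N < k then G * \<epsilon>0 ^ k else 0) + \<epsilon> * S * (G * K ^ k / fact k)"
          by (simp add: T_def field_simps)
        also have "G * \<epsilon>0 ^ k = (1/2) ^ k" by (simp only: G_def power_mult_distrib[symmetric] \<epsilon>0(2))
        also have "G * K ^ k = (d\<^sup>2 * R' * K) ^ k" by (simp add: G_def power_mult_distrib)
        finally show "(real CARD('n) * R') ^ k / fact k * (d ^ k * T k)
          = C * (if N < k then (1/2) ^ k else 0) + \<epsilon> * S * ((d\<^sup>2 * R' * K) ^ k / fact k)" .
      qed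
      also have "\<dots> = C * (\<Sum>k<n. if N < k then (1/2) ^ k else 0) + \<epsilon> * S * (\<Sum>k<n. (d\<^sup>2 * R' * K) ^ k / fact k)"
        by (simp only: sum.distrib sum_distrib_left)
      also have "\<dots> \<le> C * (1/2) ^ N + \<epsilon> * S * Y"
      proof (intro add_mono mult_left_mono)
        show "(\<Sum>k<n. if N < k then (1/2::real) ^ k else 0) \<le> (1/2) ^ N"
          using tail by (smt (verit) zero_le_power zero_le_divide_1_iff)
        have "(\<Sum>k<n. (d\<^sup>2 * R' * K) ^ k /\<^sub>R fact k) \<le> (\<Sum>k. (d\<^sup>2 * R' * K) ^ k /\<^sub>R fact k)"
          using dR by (intro sum_le_suminf summable_exp_generic) (auto simp: K_def intro!: mult_nonneg_nonneg)
        then show "(\<Sum>k<n. (d\<^sup>2 * R' * K) ^ k / fact k) \<le> Y"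
          by (simp add: Y_def exp_def field_simps)
      qed (use C \<epsilon> S in auto)
      also have "\<dots> \<le> \<eta>" using N \<epsilon> by simp
      finally show "(\<Sum>k<n. (real CARD('n) * R') ^ k / fact k * (d ^ k * T k)) \<le> \<eta>" .
    qed
    then show ?thesis by (simp add: E_def)
  qed
  with P show thesis by (rule that)
qed

section \<open>Rational directions\<close>

lemma rational_approx_vec:
  fixes y :: "real ^ 'n"
  assumes "d > 0"
  obtains y' where "\<And>i. y' $ i \<in> \<rat>" "dist y' y < d"
proof -
  define e where "e = d / real CARD('n)"
  have e: "e > 0" using assms by (simp add: e_def)
  have "\<exists>q\<in>\<rat>. \<bar>q - y $ i\<bar> < e" for i
  proof -
    obtain q where "q \<in> \<rat>" "y $ i - e < q" "q < y $ i + e"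
      using Rats_dense_in_real[of "y $ i - e" "y $ i + e"] e by auto
    then show ?thesis by (intro bexI[of _ q]) auto
  qed
  then obtain q where q: "\<And>i. q i \<in> \<rat>" "\<And>i. \<bar>q i - y $ i\<bar> < e" by metis
  define y' where "y' = (\<chi> i. q i)"
  have "dist y' y \<le> (\<Sum>i\<in>UNIV. \<bar>(y' - y) $ i\<bar>)" unfolding dist_norm by (rule norm_le_l1_cart)
  also have "\<dots> < (\<Sum>i\<in>(UNIV::'n set). e)" using q by (intro sum_strict_mono) (auto simp: y'_def)
  also have "\<dots> = d" by (simp add: e_def)
  finally show thesis by (intro that[of y']) (auto simp: y'_def q)
qed

lemma trig_sum_mono:
  assumes "trig_sum S f" "S \<subseteq> T"
  shows "trig_sum T f"
  using assms(1)
proof (induction rule: trig_sum.induct)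
  case zero
  show ?case by (rule trig_sum.zero)
next
  case (insert \<xi> f c)
  then show ?case using assms(2) by (intro trig_sum.insert) auto
qed

definition rational_directions :: "(real ^ 'n) set" where
  "rational_directions = {\<xi>. norm \<xi> = 1 \<and> (\<forall>i. \<xi> $ i \<in> \<rat>)}"

lemma axis_in_rational_directions: "(axis i 1 :: real ^ 'n) \<in> rational_directions"
proof -
  have "(axis i 1 :: real ^ 'n) $ j \<in> \<rat>" for j by (simp add: axis_def)
  then show ?thesis by (simp add: rational_directions_def)
qed

text \<open>Every unit vector is the image of a fixed axis under a reflection, and reflections in
  rational hyperplanes preserve rational unit vectors.\<close>

lemma rational_directions_dense:
  fixes \<xi> :: "real ^ 'n"
  assumes \<xi>: "norm \<xi> = 1" and d: "d > 0"
  obtains \<xi>' where "\<xi>' \<in> rational_directions" "norm (\<xi>' - \<xi>) < d"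
proof -
  define e :: "real ^ 'n" where "e = axis undefined 1"
  have "e \<in> rational_directions" unfolding e_def by (rule axis_in_rational_directions)
  then have ee: "e \<bullet> e = 1" and eQ: "\<And>i. e $ i \<in> \<rat>" by (simp_all add: rational_directions_def norm_eq_1)
  show thesis
  proof (cases "\<xi> = e")
    case True
    then show thesis using \<xi> d eQ by (intro that[of e]) (auto simp: rational_directions_def)
  next
    case False
    define F where "F = (\<lambda>y. e - (2 * (e \<bullet> y) / (y \<bullet> y)) *\<^sub>R y)"
    \<comment> \<open>\<open>F y\<close> is the image of \<open>e\<close> under the reflection along
      \<open>y\<close>, and the reflection along \<open>e - \<xi>\<close> exchanges \<open>e\<close>
      and \<open>\<xi>\<close>.\<close>
    define y where "y = e - \<xi>"
    have y0: "y \<noteq> 0" using False by (simp add: y_def)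
    have \<xi>\<xi>: "\<xi> \<bullet> \<xi> = 1" using \<xi> by (simp add: norm_eq_1)
    have yy: "y \<bullet> y = 2 * (e \<bullet> y)" by (simp add: y_def inner_diff ee \<xi>\<xi> inner_commute)
    have "e \<bullet> y \<noteq> 0" using yy y0 by (metis inner_eq_zero_iff mult_zero_right)
    then have Fy: "F y = \<xi>" unfolding F_def yy by (simp add: y_def)
    have "continuous (at y) F"
      unfolding F_def by (intro continuous_intros) (use y0 in auto)
    then obtain \<delta> where \<delta>: "\<delta> > 0" "\<And>y'. dist y' y < \<delta> \<Longrightarrow> dist (F y') (F y) < d"
      using d unfolding continuous_at_eps_delta by metis
    obtain y' where y': "\<And>i. y' $ i \<in> \<rat>" "dist y' y < \<delta>" using rational_approx_vec[OF \<delta>(1)] by blast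
    \<comment> \<open>This covers \<open>y' = 0\<close> too: division by 0 yields 0, so that
      \<open>F y' = e\<close>.\<close>
    have "F y' \<bullet> F y' = 1"
      by (cases "y' \<bullet> y' = 0") (simp_all add: F_def inner_diff ee inner_commute field_simps)
    moreover have "F y' $ i \<in> \<rat>" for i
      by (simp add: F_def inner_vec_def) (intro Rats_diff Rats_mult Rats_divide Rats_sum eQ y' Rats_number_of)
    ultimately show thesis using \<delta>(2)[OF y'(2)]
      by (intro that[of "F y'"]) (auto simp: Fy dist_norm rational_directions_def norm_eq_1)
  qed
qed

lemma wave_lipschitz: "\<bar>wave \<xi> c x - wave \<xi>' c x\<bar> \<le> 2 * norm c * norm x * norm (\<xi>' - \<xi>)"
proof -
  let ?a = "\<xi> \<bullet> x" and ?b = "\<xi>' \<bullet> x"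
  have s: "\<bar>2 * (p * sin t)\<bar> \<le> 2 * \<bar>t\<bar>" if "\<bar>p\<bar> \<le> 1" for p t :: real
    using mult_mono[of "\<bar>p\<bar>" 1 "\<bar>sin t\<bar>" "\<bar>t\<bar>"] that abs_sin_x_le_abs_x[of t] by (simp add: abs_mult)
  have 1: "\<bar>cos ?a - cos ?b\<bar> \<le> \<bar>?b - ?a\<bar>"
    using s[of "sin ((?a + ?b) / 2)" "(?b - ?a) / 2"] by (simp add: cos_diff_cos)
  have 2: "\<bar>sin ?a - sin ?b\<bar> \<le> \<bar>?b - ?a\<bar>"
    using s[of "cos ((?a + ?b) / 2)" "(?a - ?b) / 2"] by (simp add: sin_diff_sin mult_ac abs_minus_commute)
  have "wave \<xi> c x - wave \<xi>' c x = Re c * (cos ?a - cos ?b) - Im c * (sin ?a - sin ?b)"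
    by (simp add: wave_def algebra_simps)
  also have "\<bar>\<dots>\<bar> \<le> \<bar>Re c\<bar> * \<bar>cos ?a - cos ?b\<bar> + \<bar>Im c\<bar> * \<bar>sin ?a - sin ?b\<bar>"
    by (metis abs_mult abs_triangle_ineq4)
  also have "\<dots> \<le> norm c * \<bar>?b - ?a\<bar> + norm c * \<bar>?b - ?a\<bar>"
    by (intro add_mono mult_mono 1 2 abs_Re_le_cmod abs_Im_le_cmod) auto
  also have "\<dots> = 2 * norm c * \<bar>(\<xi>' - \<xi>) \<bullet> x\<bar>" by (simp add: inner_diff_left)
  also have "\<dots> \<le> 2 * norm c * (norm (\<xi>' - \<xi>) * norm x)"
    by (intro mult_left_mono Cauchy_Schwarz_ineq2) auto
  finally show ?thesis by (simp add: mult_ac)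
qed

text \<open>Amplitudes are kept and only the frequencies move, within the unit sphere, so the
  approximant still solves the Helmholtz equation.\<close>

lemma trig_sum_rational_approx:
  assumes "trig_sum (sphere 0 1) P" "\<eta> > 0"
  shows "\<exists>Q. trig_sum rational_directions Q \<and> (\<forall>x. norm x \<le> R \<longrightarrow> \<bar>P x - Q x\<bar> \<le> \<eta>)"
  using assms
proof (induction P arbitrary: \<eta> rule: trig_sum.induct)
  case zero
  then show ?case by (intro exI[of _ "\<lambda>x. 0"]) (auto intro: trig_sum.zero)
next
  case (insert \<xi> f c)
  obtain Q where Q: "trig_sum rational_directions Q" "\<And>x. norm x \<le> R \<Longrightarrow> \<bar>f x - Q x\<bar> \<le> \<eta> / 2"
    using insert.IH[of "\<eta> / 2"] insert.prems by auto
  define M where "M = 2 * norm c * \<bar>R\<bar>"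
  have M: "M \<ge> 0" by (simp add: M_def)
  define d where "d = \<eta> / 2 / (M + 1)"
  have "d > 0" using insert.prems M by (simp add: d_def)
  then obtain \<xi>' where \<xi>': "\<xi>' \<in> rational_directions" "norm (\<xi>' - \<xi>) < d"
    using rational_directions_dense[of \<xi> d] insert.hyps by auto
  have "\<bar>wave \<xi> c x + f x - (wave \<xi>' c x + Q x)\<bar> \<le> \<eta>" if x: "norm x \<le> R" for x
  proof -
    have "\<bar>wave \<xi> c x - wave \<xi>' c x\<bar> \<le> 2 * norm c * norm x * norm (\<xi>' - \<xi>)" by (rule wave_lipschitz)
    also have "\<dots> \<le> (M + 1) * d"
      using x \<xi>' M unfolding M_def by (intro mult_mono add_increasing2 mult_left_mono) auto
    also have "\<dots> = \<eta> / 2" using M by (simp add: d_def nonzero_mult_div_cancel_left del: divide_divide_eq_left distrib_right)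
    finally show ?thesis using Q(2)[OF x] by linarith
  qed
  then show ?case using trig_sum.insert[OF \<xi>'(1) Q(1), of c] by blast
qed

section \<open>Periodicity of dilated rational trigonometric sums\<close>

lemma common_denominator:
  fixes \<xi> :: "real ^ 'n"
  assumes "\<And>i. \<xi> $ i \<in> \<rat>"
  obtains q :: nat where "q > 0" "\<And>i. real q * \<xi> $ i \<in> \<int>"
proof -
  have "\<exists>q::nat. q > 0 \<and> real q * \<xi> $ i \<in> \<int>" for i
  proof -
    obtain m n where "n > 0" "\<xi> $ i = of_int m / of_int n"
      using Rats_cases'[OF assms[of i]] by metis
    then show ?thesis by (intro exI[of _ "nat n"]) (auto simp: of_nat_nat)
  qed
  then obtain p :: "'n \<Rightarrow> nat" where p: "\<And>i. p i > 0" "\<And>i. real (p i) * \<xi> $ i \<in> \<int>" by metis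
  show thesis
  proof (rule that[of "\<Prod>i\<in>UNIV. p i"])
    show "(\<Prod>i\<in>UNIV. p i) > 0" using p by (intro prod_pos) auto
    fix i
    have "real (\<Prod>i\<in>UNIV. p i) * \<xi> $ i = real (\<Prod>j\<in>UNIV - {i}. p j) * (real (p i) * \<xi> $ i)"
      by (simp add: prod.remove[of UNIV i])
    also have "\<dots> \<in> \<int>" by (intro Ints_mult p Ints_of_nat)
    finally show "real (\<Prod>i\<in>UNIV. p i) * \<xi> $ i \<in> \<int>" .
  qed
qed

lemma wave_periodic:
  assumes "\<xi> \<bullet> z = 2 * pi * k" "k \<in> \<int>"
  shows "wave \<xi> c (x + z) = wave \<xi> c x"
proof -
  have "cis (\<xi> \<bullet> z) = 1" using assms by (auto simp: cis_multiple_2pi)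
  then show ?thesis by (simp add: wave_def inner_add_right cis_mult[symmetric])
qed

text \<open>Invariance is asked for the whole lattice
  \<open>{z. r *\<^sub>R z \<in> int_lattice}\<close>, which contains every admissible
  \<open>\<Gamma>\<close>, so that only \<open>r\<close> enters. The integer \<open>n\<close> is
  there to clear the denominators of the frequencies.\<close>

definition periodic_dilate :: "real \<Rightarrow> (real ^ 'n \<Rightarrow> real) \<Rightarrow> nat \<Rightarrow> bool" where
  "periodic_dilate r f n \<longleftrightarrow> (\<forall>x z. r *\<^sub>R z \<in> int_lattice \<longrightarrow>
     f ((2 * pi * r * n) *\<^sub>R (x + z)) = f ((2 * pi * r * n) *\<^sub>R x))"

lemma trig_sum_rational_periodic:
  assumes "trig_sum rational_directions P"
  shows "\<exists>Q>0. \<forall>n. Q dvd n \<longrightarrow> periodic_dilate r P n"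
  using assms
proof (induction rule: trig_sum.induct)
  case zero
  show ?case by (intro exI[of _ 1]) (auto simp: periodic_dilate_def)
next
  case (insert \<xi> f c)
  from insert.IH obtain Q :: nat where Q: "Q > 0" and per: "\<And>n. Q dvd n \<Longrightarrow> periodic_dilate r f n" by blast
  obtain q where q: "q > 0" "\<And>i. real q * \<xi> $ i \<in> \<int>"
    using common_denominator[of \<xi>] insert.hyps unfolding rational_directions_def by blast
  have "wave \<xi> c ((2 * pi * r * n) *\<^sub>R (x + z)) + f ((2 * pi * r * n) *\<^sub>R (x + z))
      = wave \<xi> c ((2 * pi * r * n) *\<^sub>R x) + f ((2 * pi * r * n) *\<^sub>R x)"
    if n: "q * Q dvd n" and z: "r *\<^sub>R z \<in> int_lattice" for n :: nat and x z
  proof -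
    obtain j where j: "n = q * j" using n by (metis dvdE mult.assoc)
    define k where "k = (\<Sum>i\<in>UNIV. real j * (real q * \<xi> $ i) * (r *\<^sub>R z) $ i)"
    have "k \<in> \<int>"
      unfolding k_def using z by (intro Ints_sum Ints_mult[OF Ints_mult[OF Ints_of_nat q(2)]]) (simp add: int_lattice_def)
    moreover have "\<xi> \<bullet> ((2 * pi * r * n) *\<^sub>R z) = 2 * pi * k"
      by (simp add: k_def inner_vec_def j sum_distrib_left mult_ac)
    ultimately have "wave \<xi> c ((2 * pi * r * n) *\<^sub>R x + (2 * pi * r * n) *\<^sub>R z) = wave \<xi> c ((2 * pi * r * n) *\<^sub>R x)"
      by (intro wave_periodic)
    moreover have "Q dvd n" using n by (rule dvd_mult_right)
    ultimately show ?thesis using per[of n] z by (simp add: scaleR_add_right periodic_dilate_def)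
  qed
  then show ?case using q Q by (intro exI[of _ "q * Q"]) (auto simp: periodic_dilate_def)
qed

text \<open>Nonnegativity too rests on the uniform bound, since the supremum dominates its members
  only over a set that is bounded above.\<close>

lemma Cl_norm_le:
  assumes "B \<noteq> {}" "\<And>is x. length is \<le> l \<Longrightarrow> x \<in> B \<Longrightarrow> \<bar>partials is f x\<bar> \<le> \<delta>"
  shows "0 \<le> Cl_norm l B f" "Cl_norm l B f \<le> \<delta>"
proof -
  let ?S = "{is. length is \<le> l} \<times> B"
  obtain x where x: "x \<in> B" using assms(1) by auto
  have ne: "([], x) \<in> ?S" using x by simp
  show "Cl_norm l B f \<le> \<delta>"
    unfolding Cl_norm_def by (rule cSUP_least) (use ne assms(2) in \<open>blast, auto\<close>)
  have "bdd_above ((\<lambda>(is, x). \<bar>partials is f x\<bar>) ` ?S)"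
    using assms(2) by (intro bdd_aboveI[of _ \<delta>]) auto
  from cSUP_upper[OF ne this] show "0 \<le> Cl_norm l B f"
    unfolding Cl_norm_def by (auto intro: order_trans[OF abs_ge_zero])
qed

lemma laplacian_dilate:
  assumes "smooth f"
  shows "laplacian (\<lambda>x. f (c *\<^sub>R x)) x = c\<^sup>2 * laplacian f (c *\<^sub>R x)"
  by (simp add: laplacian_def partials_dilate[OF assms] sum_distrib_left power2_eq_square del: partials.simps)

text \<open>Dilating \<open>P n\<close> by \<open>k n\<close> gives a periodic eigenfunction with
  eigenvalue \<open>(k n)\<^sup>2\<close>, and the rescaling in the localization property undoes the
  dilation exactly. It remains to compare \<open>P n\<close> with \<open>h\<close>, two solutions of
  one equation, for which uniform closeness on a larger ball is enough.\<close>

lemma inverse_localization_rational: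
  fixes \<Gamma> :: "(real ^ 'n) set"
  assumes r: "r > 0" and \<Gamma>: "(\<lambda>x. r *\<^sub>R x) ` \<Gamma> \<subseteq> int_lattice"
  shows "inverse_localization \<Gamma>"
  unfolding inverse_localization_def
proof (intro allI impI)
  fix h :: "real ^ 'n \<Rightarrow> real" and c :: "real ^ 'n" and R :: real and l :: nat
  assume "helmholtz_solution h \<and> R > 0 \<and> l \<ge> 1"
  then have h: "helmholtz_solution h" and R: "R > 0" by auto
  define K where "K = 39 + 6 * real CARD('n)"
  have K: "K \<ge> 1" by (simp add: K_def)
  \<comment> \<open>The margin \<open>l\<close> provides one unit shell for each derivative.\<close>
  define R' where "R' = norm c + R + real l"
  have approx: "\<exists>P. trig_sum rational_directions P \<and> (\<exists>x. P x \<noteq> 0) \<and> (\<forall>x. norm x \<le> R' \<longrightarrow> \<bar>h x - P x\<bar> \<le> \<eta>)"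
    if \<eta>: "\<eta> > 0" for \<eta>
  proof -
    obtain P0 where P0: "trig_sum (sphere 0 1) P0" "\<And>x. norm x \<le> R' \<Longrightarrow> \<bar>h x - P0 x\<bar> \<le> \<eta> / 3"
      using helmholtz_approx_trig_sum[OF h, of "\<eta> / 3" R'] \<eta> by (metis divide_pos_pos zero_less_numeral)
    obtain P where P: "trig_sum rational_directions P" "\<And>x. norm x \<le> R' \<Longrightarrow> \<bar>P0 x - P x\<bar> \<le> \<eta> / 3"
      using trig_sum_rational_approx[OF P0(1), of "\<eta> / 3" R'] \<eta> by auto
    show ?thesis
    proof (cases "\<exists>x. P x \<noteq> 0")
      case True
      have "\<bar>h x - P x\<bar> \<le> \<eta>" if "norm x \<le> R'" for x using P0(2)[OF that] P(2)[OF that] \<eta> by linarith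
      then show ?thesis using P True by blast
    next
      \<comment> \<open>If the approximant vanishes, \<open>h\<close> itself is small there, and a
        wave of amplitude \<open>\<eta> / 3\<close> serves instead, because eigenfunctions must be
        nonzero.\<close>
      case False
      define e :: "real ^ 'n" where "e = axis undefined 1"
      define W where "W = wave e (of_real (\<eta> / 3))"
      have "e \<in> rational_directions" unfolding e_def by (rule axis_in_rational_directions)
      then have "trig_sum rational_directions W" unfolding W_def by (rule trig_sum_wave)
      moreover have "W 0 \<noteq> 0" using \<eta> by (simp add: W_def wave_def)
      moreover have "\<bar>h x - W x\<bar> \<le> \<eta>" if "norm x \<le> R'" for x
      proof -
        have "\<bar>W x\<bar> \<le> \<eta> / 3"
          using \<eta> mult_left_mono[of "\<bar>cos (e \<bullet> x)\<bar>" 1 "\<eta>"] by (simp add: W_def wave_def abs_mult)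
        moreover have "P x = 0" using False by blast
        ultimately show ?thesis using P0(2)[OF that] P(2)[OF that] \<eta> by linarith
      qed
      ultimately show ?thesis by blast
    qed
  qed
  \<comment> \<open>Division by \<open>K ^ l\<close> compensates the loss in the derivative bound
    and leaves \<open>1 / (n + 1)\<close>.\<close>
  define \<eta> where "\<eta> = (\<lambda>n. inverse (real (Suc n)) / K ^ l)"
  have \<eta>: "\<eta> n > 0" for n using K by (simp add: \<eta>_def)
  obtain P where P: "\<And>n. trig_sum rational_directions (P n)" "\<And>n. \<exists>x. P n x \<noteq> 0"
      "\<And>n x. norm x \<le> R' \<Longrightarrow> \<bar>h x - P n x\<bar> \<le> \<eta> n"
    using approx[OF \<eta>] by metis
  obtain Q :: "nat \<Rightarrow> nat" where Q: "\<And>n. Q n > 0" "\<And>n m. Q n dvd m \<Longrightarrow> periodic_dilate r (P n) m"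
    using trig_sum_rational_periodic[OF P(1), where r=r] by metis
  \<comment> \<open>\<open>Q n\<close> clears the denominators, \<open>Suc n\<close> drives the
    eigenvalues to infinity.\<close>
  define k where "k = (\<lambda>n. 2 * pi * r * real (Q n * Suc n))"
  have k: "k n > 0" for n unfolding k_def using r Q(1)[of n] by (intro mult_pos_pos) (auto intro: add_pos_nonneg)
  define u where "u = (\<lambda>n x. P n (k n *\<^sub>R x))"
  have P': "trig_sum (sphere 0 1) (P n)" for n
    by (rule trig_sum_mono[OF P(1)]) (auto simp: rational_directions_def)
  have hP: "helmholtz_solution (P n)" for n using P' by (rule trig_sum_helmholtz)
  show "\<exists>u \<mu>. (\<forall>n. torus_eigenfunction \<Gamma> (\<mu> n) (u n)) \<and> filterlim \<mu> at_top sequentially \<and>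
      (\<lambda>n. Cl_norm l (ball c R) (\<lambda>x. u n (x /\<^sub>R sqrt (\<mu> n)) - h x)) \<longlonglongrightarrow> 0"
  proof (intro exI[of _ u] exI[of _ "\<lambda>n. (k n)\<^sup>2"] conjI allI)
    fix n
    have sP: "smooth (P n)" using hP by (rule helmholtz_smooth)
    have "\<exists>x. u n x \<noteq> 0"
    proof -
      obtain x where "P n x \<noteq> 0" using P(2) by blast
      then show ?thesis using k[of n] by (intro exI[of _ "inverse (k n) *\<^sub>R x"]) (simp add: u_def)
    qed
    moreover have "smooth (u n)" unfolding u_def by (rule smooth_dilate[OF sP])
    moreover have "u n (x + \<gamma>) = u n x" if "\<gamma> \<in> \<Gamma>" for x \<gamma>
    proof -
      have "r *\<^sub>R \<gamma> \<in> int_lattice" using \<Gamma> that by auto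
      with Q(2)[OF dvd_triv_left, of n "Suc n"] show ?thesis unfolding periodic_dilate_def u_def k_def by blast
    qed
    moreover have "laplacian (u n) x + (k n)\<^sup>2 * u n x = 0" for x
      using hP[of n] unfolding u_def laplacian_dilate[OF sP] helmholtz_solution_def
      by (simp add: distrib_left[symmetric])
    ultimately show "torus_eigenfunction \<Gamma> ((k n)\<^sup>2) (u n)" by (simp add: torus_eigenfunction_def)
  next
    have "filterlim (\<lambda>n. (2 * pi * r)\<^sup>2 * real n) at_top sequentially"
      using r by (intro filterlim_tendsto_pos_mult_at_top[OF tendsto_const _ filterlim_real_sequentially]) simp
    then show "filterlim (\<lambda>n. (k n)\<^sup>2) at_top sequentially"
    proof (rule filterlim_at_top_mono)
      have "(2 * pi * r)\<^sup>2 * real n \<le> (k n)\<^sup>2" for n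
      proof -
        have "n \<le> Q n * Suc n" using Q(1)[of n] by (cases "Q n") auto
        also have "\<dots> \<le> (Q n * Suc n)\<^sup>2" using Q(1)[of n] by (intro self_le_power) auto
        finally have "real n \<le> (real (Q n * Suc n))\<^sup>2" by (metis of_nat_le_iff of_nat_power)
        then show ?thesis unfolding k_def power_mult_distrib[of "2 * pi * r"] by (rule mult_left_mono) simp
      qed
      then show "\<forall>\<^sub>F n in sequentially. (2 * pi * r)\<^sup>2 * real n \<le> (k n)\<^sup>2" by simp
    qed
  next
    have b: "\<bar>partials is (\<lambda>x. u n (x /\<^sub>R sqrt ((k n)\<^sup>2)) - h x) x\<bar> \<le> inverse (real (Suc n))"
      if len: "length is \<le> l" and x: "x \<in> ball c R" for n "is" x
    proof -
      have "(\<lambda>x. u n (x /\<^sub>R sqrt ((k n)\<^sup>2)) - h x) = (\<lambda>x. P n x - h x)"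
        using k[of n] by (simp add: u_def)
      moreover have "\<bar>partials is (\<lambda>x. P n x - h x) x\<bar> \<le> (K / 1) ^ length is * \<eta> n"
        unfolding K_def
      proof (rule helmholtz_partials_bound[OF helmholtz_diff[OF hP h]])
        fix y assume y: "y \<in> cball x (real (length is) * 1)"
        have "norm y \<le> norm c + dist c x + dist x y"
          using dist_triangle[of 0 y x] dist_triangle[of 0 x c] by (simp add: dist_norm norm_minus_commute)
        also have "\<dots> \<le> R'" using x y len by (simp add: R'_def)
        finally show "\<bar>P n y - h y\<bar> \<le> \<eta> n" using P(3) by (simp add: abs_minus_commute)
      qed auto
      moreover have "K ^ length is * \<eta> n \<le> K ^ l * \<eta> n"
        using K len \<eta>[of n] by (intro mult_right_mono power_increasing) auto
      moreover have "K ^ l * \<eta> n = inverse (real (Suc n))" using K by (simp add: \<eta>_def)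
      ultimately show ?thesis by simp
    qed
    have ne: "ball c R \<noteq> {}" using R by simp
    show "(\<lambda>n. Cl_norm l (ball c R) (\<lambda>x. u n (x /\<^sub>R sqrt ((k n)\<^sup>2)) - h x)) \<longlonglongrightarrow> 0"
      by (rule tendsto_sandwich[OF _ _ tendsto_const LIMSEQ_inverse_real_of_nat]) (use Cl_norm_le[OF ne b] in auto)
  qed
qed

section \<open>Means over the torus\<close>

text \<open>Cut the shifted cube at the face \<open>x \<bullet> b = 1\<close> and move the
  overhanging slab back by the period \<open>b\<close>; the two pieces reassemble the original
  cube.\<close>

lemma integral_unit_cube_shift:
  fixes G :: "'a::euclidean_space \<Rightarrow> real"
  assumes G: "continuous_on UNIV G" and b: "b \<in> Basis" and per: "\<And>y. G (y + b) = G y"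
    and t: "0 \<le> t" "t \<le> 1"
  shows "integral (cbox 0 One) (\<lambda>y. G (y + t *\<^sub>R b)) = integral (cbox 0 One) G"
proof -
  have int: "G integrable_on cbox u v" for u v
    by (rule integrable_continuous) (rule continuous_on_subset[OF G]; simp)
  have mem: "x \<in> cbox (p *\<^sub>R b) (One + q *\<^sub>R b) \<longleftrightarrow>
      (\<forall>c\<in>Basis - {b}. 0 \<le> x \<bullet> c \<and> x \<bullet> c \<le> 1) \<and> p \<le> x \<bullet> b \<and> x \<bullet> b \<le> 1 + q" for x p q
  proof -
    have "(\<forall>c\<in>Basis. P c) \<longleftrightarrow> (\<forall>c\<in>Basis - {b}. P c) \<and> P b" for P using b by blast
    note split = this
    show ?thesis
      unfolding mem_box split using b by (auto simp: inner_add_left inner_Basis)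
  qed
  have "integral (cbox 0 One) (\<lambda>y. G (y + t *\<^sub>R b)) = integral (cbox (t *\<^sub>R b) (One + t *\<^sub>R b)) G"
    using integral_shift_cbox[of "t *\<^sub>R b" "t *\<^sub>R b" "One + t *\<^sub>R b" G] by simp
  also have "\<dots> = integral (cbox (t *\<^sub>R b) (One + t *\<^sub>R b) \<inter> {x. x \<bullet> b \<le> 1}) G
      + integral (cbox (t *\<^sub>R b) (One + t *\<^sub>R b) \<inter> {x. x \<bullet> b \<ge> 1}) G"
    by (rule integral_split[OF int b])
  also have "cbox (t *\<^sub>R b) (One + t *\<^sub>R b) \<inter> {x. x \<bullet> b \<le> 1} = cbox (t *\<^sub>R b) (One + 0 *\<^sub>R b)"
    unfolding set_eq_iff Int_iff mem_Collect_eq mem using t by auto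
  also have "cbox (t *\<^sub>R b) (One + t *\<^sub>R b) \<inter> {x. x \<bullet> b \<ge> 1} = cbox (1 *\<^sub>R b) (One + t *\<^sub>R b)"
    unfolding set_eq_iff Int_iff mem_Collect_eq mem using t by auto
  also have "integral (cbox (1 *\<^sub>R b) (One + t *\<^sub>R b)) G = integral (cbox (0 *\<^sub>R b) (One + (t - 1) *\<^sub>R b)) G"
    using integral_shift_cbox[of "1 *\<^sub>R b" b "One + t *\<^sub>R b" G] by (simp add: per algebra_simps)
  also have "cbox (t *\<^sub>R b) (One + 0 *\<^sub>R b) = cbox (0 *\<^sub>R b) (One + 0 *\<^sub>R b) \<inter> {x. x \<bullet> b \<ge> t}"
    unfolding set_eq_iff Int_iff mem_Collect_eq mem using t by auto
  also have "cbox (0 *\<^sub>R b) (One + (t - 1) *\<^sub>R b) = cbox (0 *\<^sub>R b) (One + 0 *\<^sub>R b) \<inter> {x. x \<bullet> b \<le> t}"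
    unfolding set_eq_iff Int_iff mem_Collect_eq mem using t by auto
  also have "integral (cbox (0 *\<^sub>R b) (One + 0 *\<^sub>R b) \<inter> {x. x \<bullet> b \<ge> t}) G + integral (cbox (0 *\<^sub>R b) (One + 0 *\<^sub>R b) \<inter> {x. x \<bullet> b \<le> t}) G
      = integral (cbox 0 One) G"
    using integral_split[OF int b, of 0 One t] by simp
  finally show ?thesis .
qed

section \<open>Means and integration by parts on the torus\<close>

definition lattice_periodic :: "real ^ 'n ^ 'n \<Rightarrow> (real ^ 'n \<Rightarrow> real) \<Rightarrow> bool" where
  "lattice_periodic A f \<longleftrightarrow> (\<forall>x. \<forall>\<gamma>\<in>lattice_of A. f (x + \<gamma>) = f x)"

text \<open>Pulled back to the unit cube, so that the fundamental cell has volume 1 and no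
  determinant occurs.\<close>

definition torus_mean :: "real ^ 'n ^ 'n \<Rightarrow> (real ^ 'n \<Rightarrow> real) \<Rightarrow> real" where
  "torus_mean A f = integral (cbox 0 One) (\<lambda>y. f (A *v y))"

lemma axis_in_int_lattice: "(axis j 1 :: real ^ 'n) \<in> int_lattice"
  by (simp add: int_lattice_def axis_def)

lemma lattice_periodic_axis:
  assumes "lattice_periodic A f"
  shows "f (x + A *v axis j 1) = f x"
proof -
  have "A *v axis j 1 \<in> lattice_of A"
    unfolding lattice_of_def by (rule imageI) (rule axis_in_int_lattice)
  then show ?thesis using assms by (auto simp: lattice_periodic_def)
qed

lemma continuous_on_lattice_coords:
  fixes A :: "real ^ 'n ^ 'n"
  assumes "continuous_on UNIV f"
  shows "continuous_on S (\<lambda>y. f (A *v y))"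
  by (rule continuous_on_compose2[OF assms]) (auto intro: continuous_intros)

lemma torus_mean_integrable:
  fixes A :: "real ^ 'n ^ 'n" and f :: "real ^ 'n \<Rightarrow> real"
  assumes "continuous_on UNIV f"
  shows "(\<lambda>y. f (A *v y)) integrable_on cbox 0 One"
  by (rule integrable_continuous) (rule continuous_on_lattice_coords[OF assms])

lemma torus_mean_lincomb:
  fixes A :: "real ^ 'n ^ 'n"
  assumes "continuous_on UNIV f" "continuous_on UNIV g"
  shows "torus_mean A (\<lambda>x. a * f x + b * g x) = a * torus_mean A f + b * torus_mean A g"
  unfolding torus_mean_def
  using torus_mean_integrable[OF assms(1), of A] torus_mean_integrable[OF assms(2), of A]
  by (subst integral_add) (auto intro: integrable_on_mult_right)

lemma torus_mean_sum:
  fixes A :: "real ^ 'n ^ 'n"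
  assumes "\<And>j. j \<in> J \<Longrightarrow> continuous_on UNIV (f j)" "finite J"
  shows "torus_mean A (\<lambda>x. \<Sum>j\<in>J. f j x) = (\<Sum>j\<in>J. torus_mean A (f j))"
  unfolding torus_mean_def
  by (rule integral_sum[OF assms(2)]) (rule torus_mean_integrable[OF assms(1)])

text \<open>The mean of the translate by \<open>t\<close> times a lattice vector does not depend on
  \<open>t\<close>; differentiate it under the integral at 0. The derivative is taken within
  \<open>{0..1}\<close>, where the cube shift is available.\<close>

lemma torus_mean_dird_axis:
  fixes A :: "real ^ 'n ^ 'n"
  assumes per: "lattice_periodic A f" and d: "\<And>x. f differentiable (at x)"
    and c: "\<And>i. continuous_on UNIV (partial i f)"
  shows "torus_mean A (dird (A *v axis j 1) f) = 0"
proof -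
  define v where "v = A *v axis j 1"
  have cf: "continuous_on UNIV f"
    by (meson continuous_at_imp_continuous_on differentiable_imp_continuous_within d)
  have cd: "continuous_on UNIV (dird v f)"
    unfolding dird_def[abs_def] by (intro continuous_intros c)
  have A: "A *v (y + t *\<^sub>R axis j 1) = A *v y + t *\<^sub>R v" for y t
    by (simp add: v_def matrix_vector_right_distrib matrix_vector_mult_scaleR)
  have L: "((\<lambda>t. integral (cbox 0 One) (\<lambda>y. f (A *v y + t *\<^sub>R v))) has_field_derivative
      integral (cbox 0 One) (\<lambda>y. dird v f (A *v y + 0 *\<^sub>R v))) (at 0 within {0..1})"
  proof (rule leibniz_rule_field_derivative)
    show "((\<lambda>t. f (A *v y + t *\<^sub>R v)) has_field_derivative dird v f (A *v y + t *\<^sub>R v)) (at t within {0..1})" for t y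
      by (rule has_field_derivative_at_within) (rule has_real_derivative_along_line[OF d])
    show "(\<lambda>y. f (A *v y + t *\<^sub>R v)) integrable_on cbox 0 One" for t
      by (rule integrable_continuous, rule continuous_on_compose2[OF cf]) (auto intro!: continuous_intros)
    show "continuous_on ({0..1} \<times> cbox 0 One) (\<lambda>(t, y). dird v f (A *v y + t *\<^sub>R v))"
      unfolding split_beta
      by (rule continuous_on_compose2[OF cd])
         (auto intro!: continuous_intros continuous_on_compose2[OF matrix_vector_mult_linear_continuous_on[of UNIV A]])
  qed auto
  have I: "integral (cbox 0 One) (\<lambda>y. f (A *v y + t *\<^sub>R v)) = torus_mean A f" if "t \<in> {0..1}" for t
  proof -
    have "integral (cbox 0 One) (\<lambda>y. (\<lambda>y. f (A *v y)) (y + t *\<^sub>R axis j 1)) = integral (cbox 0 One) (\<lambda>y. f (A *v y))"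
    proof (rule integral_unit_cube_shift)
      show "continuous_on UNIV (\<lambda>y. f (A *v y))" by (rule continuous_on_lattice_coords[OF cf])
      show "(axis j 1 :: real ^ 'n) \<in> Basis" by (simp add: axis_in_Basis_iff)
      show "f (A *v (y + axis j 1)) = f (A *v y)" for y
        using lattice_periodic_axis[OF per, of "A *v y" j] by (simp add: matrix_vector_right_distrib)
    qed (use that in auto)
    then show ?thesis by (simp add: A torus_mean_def)
  qed
  have "((\<lambda>t. torus_mean A f) has_field_derivative torus_mean A (dird v f)) (at 0 within {0..1})"
    unfolding torus_mean_def[of A "dird v f"]
    by (rule has_field_derivative_transform_within[OF L[unfolded scaleR_zero_left add_0_right], of 1]) (auto simp: I)
  moreover have "((\<lambda>t::real. torus_mean A f) has_field_derivative 0) (at 0 within {0..1})" by simp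
  ultimately have "torus_mean A (dird v f) = 0"
    unfolding has_real_derivative_iff_has_vector_derivative
    by (intro vector_derivative_unique_within[where x=0 and S="{0..1::real}"]) (auto simp: at_within_Icc_at_right)
  then show ?thesis by (simp add: v_def)
qed

text \<open>Invertibility makes the lattice vectors \<open>A *v axis j 1\<close> a basis, in which
  the coordinate direction is expanded.\<close>

lemma torus_mean_partial:
  fixes A :: "real ^ 'n ^ 'n"
  assumes A: "invertible A" and per: "lattice_periodic A f" and d: "\<And>x. f differentiable (at x)"
    and c: "\<And>i. continuous_on UNIV (partial i f)"
  shows "torus_mean A (partial i f) = 0"
proof -
  obtain A' where A': "A ** A' = mat 1" using A unfolding invertible_def by blast
  define w where "w = A' *v axis i 1"
  have "A *v w = axis i 1"
    by (simp add: w_def matrix_vector_mul_assoc A')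
  also have "A *v w = (\<Sum>j\<in>UNIV. w $ j *\<^sub>R (A *v axis j 1))"
    using arg_cong[OF basis_expansion[of w], of "\<lambda>t. A *v t"]
    by (simp add: scalar_mult_eq_scaleR linear_sum[OF matrix_vector_mul_linear] matrix_vector_mult_scaleR)
  finally have e: "axis i 1 = (\<Sum>j\<in>UNIV. w $ j *\<^sub>R (A *v axis j 1))" ..
  have "partial i f = dird (axis i 1) f" by simp
  also have "\<dots> = (\<lambda>x. \<Sum>j\<in>UNIV. w $ j * dird (A *v axis j 1) f x)"
  proof
    fix x
    have "dird (axis i 1) f x = (\<Sum>k\<in>UNIV. \<Sum>j\<in>UNIV. w $ j * ((A *v axis j 1) $ k * partial k f x))"
      unfolding e dird_def by (simp add: sum_component sum_distrib_right mult.assoc)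
    also have "\<dots> = (\<Sum>j\<in>UNIV. \<Sum>k\<in>UNIV. w $ j * ((A *v axis j 1) $ k * partial k f x))"
      by (rule sum.swap)
    finally show "dird (axis i 1) f x = (\<Sum>j\<in>UNIV. w $ j * dird (A *v axis j 1) f x)"
      by (simp add: dird_def sum_distrib_left)
  qed
  finally have eq: "partial i f = (\<lambda>x. \<Sum>j\<in>UNIV. w $ j * dird (A *v axis j 1) f x)" .
  have "torus_mean A (partial i f) = (\<Sum>j\<in>UNIV. torus_mean A (\<lambda>x. w $ j * dird (A *v axis j 1) f x))"
    unfolding eq dird_def by (rule torus_mean_sum) (auto intro!: continuous_intros c)
  also have "\<dots> = (\<Sum>j\<in>UNIV. w $ j * torus_mean A (dird (A *v axis j 1) f))"
    by (simp add: torus_mean_def)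
  finally show ?thesis by (simp add: torus_mean_dird_axis[OF per d c])
qed

lemma partial_mult:
  assumes "f differentiable (at x)" "g differentiable (at x)"
  shows "partial i (\<lambda>x. f x * g x) x = f x * partial i g x + partial i f x * g x"
proof -
  have "((\<lambda>x. f x * g x) has_derivative
     (\<lambda>v. f x * frechet_derivative g (at x) v + frechet_derivative f (at x) v * g x)) (at x)"
    using assms by (intro has_derivative_mult) (simp_all add: frechet_derivative_works)
  from has_derivative_partial[OF this] show ?thesis by (simp add: partial_def)
qed

lemma lattice_periodic_partial:
  assumes "lattice_periodic A f" "smooth f"
  shows "lattice_periodic A (partial i f)"
  unfolding lattice_periodic_def
proof (intro allI ballI)
  fix x \<gamma> assume "\<gamma> \<in> lattice_of A"
  then have f: "f = (\<lambda>x. f (x + \<gamma>))" using assms by (auto simp: lattice_periodic_def)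
  have "((\<lambda>x. f (x + \<gamma>)) has_derivative (\<lambda>v. frechet_derivative f (at (x + \<gamma>)) (v + 0))) (at x)"
    by (rule has_derivative_compose[where f="\<lambda>x. x + \<gamma>"])
       (auto intro!: derivative_eq_intros simp: frechet_derivative_works[symmetric] smooth_differentiable0 assms)
  from has_derivative_partial[OF this, of i] show "partial i f (x + \<gamma>) = partial i f x"
    by (simp add: partial_def f[symmetric])
qed

text \<open>Green's identity: \<open>W\<close> is the field \<open>f * grad g - g * grad f\<close>,
  its divergence is \<open>(\<nu> - \<mu>) * f * g\<close>, and divergences of periodic fields have
  mean 0.\<close>

lemma torus_mean_eigenfunctions:
  fixes A :: "real ^ 'n ^ 'n"
  assumes A: "invertible A"
    and f: "lattice_periodic A f" "smooth f" "\<And>x. laplacian f x + \<nu> * f x = 0"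
    and g: "lattice_periodic A g" "smooth g" "\<And>x. laplacian g x + \<mu> * g x = 0"
    and ne: "\<nu> \<noteq> \<mu>"
  shows "torus_mean A (\<lambda>x. f x * g x) = 0"
proof -
  define W where "W = (\<lambda>i x. f x * partial i g x - g x * partial i f x)"
  note sm = smooth_differentiable0[OF f(2)] smooth_differentiable0[OF g(2)]
    smooth_differentiable0[OF smooth_partial[OF f(2)]] smooth_differentiable0[OF smooth_partial[OF g(2)]]
  have pW: "partial k (W i) = (\<lambda>x. (f x * partial k (partial i g) x + partial k f x * partial i g x)
      - (g x * partial k (partial i f) x + partial k g x * partial i f x))" for i k
  proof
    fix x
    show "partial k (W i) x = (f x * partial k (partial i g) x + partial k f x * partial i g x)
      - (g x * partial k (partial i f) x + partial k g x * partial i f x)"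
      using partial_lincomb[of "\<lambda>x. f x * partial i g x" x "\<lambda>x. g x * partial i f x" k 1 "-1"] sm
      by (simp add: W_def partial_mult)
  qed
  have cW: "continuous_on UNIV (partial k (W i))" for i k
    unfolding pW by (intro continuous_intros smooth_continuous_on smooth_partial f g)
  have "torus_mean A (partial i (W i)) = 0" for i
  proof (rule torus_mean_partial[OF A])
    show "lattice_periodic A (W i)"
      using f(1) g(1) lattice_periodic_partial[OF f(1,2), of i] lattice_periodic_partial[OF g(1,2), of i]
      unfolding lattice_periodic_def W_def by simp
    show "W i differentiable (at x)" for x unfolding W_def by (intro derivative_intros sm)
  qed (rule cW)
  then have "(\<Sum>i\<in>UNIV. torus_mean A (partial i (W i))) = 0" by simp
  also have "(\<Sum>i\<in>UNIV. torus_mean A (partial i (W i))) = torus_mean A (\<lambda>x. \<Sum>i\<in>UNIV. partial i (W i) x)"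
    by (rule torus_mean_sum[symmetric]) (simp_all add: cW)
  also have "(\<lambda>x. \<Sum>i\<in>UNIV. partial i (W i) x) = (\<lambda>x. (\<nu> - \<mu>) * (f x * g x) + 0 * f x)"
  proof
    fix x
    have "(\<Sum>i\<in>UNIV. partial i (W i) x) = f x * laplacian g x - g x * laplacian f x"
      by (simp add: pW laplacian_def sum_distrib_left sum_subtractf[symmetric])
    moreover have "laplacian g x = - \<mu> * g x" "laplacian f x = - \<nu> * f x"
      using f(3)[of x] g(3)[of x] by (simp_all add: eq_neg_iff_add_eq_0)
    ultimately show "(\<Sum>i\<in>UNIV. partial i (W i) x) = (\<nu> - \<mu>) * (f x * g x) + 0 * f x"
      by (simp add: algebra_simps)
  qed
  also have "torus_mean A \<dots> = (\<nu> - \<mu>) * torus_mean A (\<lambda>x. f x * g x) + 0 * torus_mean A f"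
    by (rule torus_mean_lincomb) (intro continuous_intros smooth_continuous_on f g)+
  finally show ?thesis using ne by simp
qed

text \<open>The frequencies whose inner product with every lattice vector is an integer multiple of
  \<open>2 * pi\<close>; the entries of \<open>transpose A *v \<xi>\<close> are the inner products
  with the generators.\<close>

definition dual_lattice :: "real ^ 'n ^ 'n \<Rightarrow> (real ^ 'n) set" where
  "dual_lattice A = {\<xi>. \<exists>k\<in>int_lattice. transpose A *v \<xi> = (2 * pi) *\<^sub>R k}"

lemma int_lattice_add: "x \<in> int_lattice \<Longrightarrow> y \<in> int_lattice \<Longrightarrow> x + y \<in> int_lattice"
  and int_lattice_diff: "x \<in> int_lattice \<Longrightarrow> y \<in> int_lattice \<Longrightarrow> x - y \<in> int_lattice"
  and int_lattice_0: "0 \<in> int_lattice"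
  by (auto simp: int_lattice_def)

lemma dual_lattice_add: "x \<in> dual_lattice A \<Longrightarrow> y \<in> dual_lattice A \<Longrightarrow> x + y \<in> dual_lattice A"
  and dual_lattice_diff: "x \<in> dual_lattice A \<Longrightarrow> y \<in> dual_lattice A \<Longrightarrow> x - y \<in> dual_lattice A"
  and dual_lattice_0: "0 \<in> dual_lattice A"
proof -
  assume x: "x \<in> dual_lattice A" and y: "y \<in> dual_lattice A"
  obtain k where k: "k \<in> int_lattice" "transpose A *v x = (2 * pi) *\<^sub>R k"
    using x unfolding dual_lattice_def by blast
  obtain l where l: "l \<in> int_lattice" "transpose A *v y = (2 * pi) *\<^sub>R l"
    using y unfolding dual_lattice_def by blast
  have "transpose A *v (x + y) = (2 * pi) *\<^sub>R (k + l)"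
    unfolding matrix_vector_right_distrib k l scaleR_right_distrib ..
  then show "x + y \<in> dual_lattice A" unfolding dual_lattice_def using int_lattice_add[OF k(1) l(1)] by blast
  have "transpose A *v (x - y) = (2 * pi) *\<^sub>R (k - l)"
    unfolding matrix_vector_mult_diff_distrib k l scaleR_right_diff_distrib ..
  then show "x - y \<in> dual_lattice A" unfolding dual_lattice_def using int_lattice_diff[OF k(1) l(1)] by blast
next
  have "transpose A *v 0 = (2 * pi) *\<^sub>R 0" by simp
  then show "0 \<in> dual_lattice A" unfolding dual_lattice_def using int_lattice_0 by blast
qed

lemma wave_lattice_periodic:
  assumes "\<xi> \<in> dual_lattice A"
  shows "lattice_periodic A (wave \<xi> c)"
  unfolding lattice_periodic_def
proof (intro allI ballI)
  fix x \<gamma> assume "\<gamma> \<in> lattice_of A"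
  then obtain z where z: "z \<in> int_lattice" "\<gamma> = A *v z" by (auto simp: lattice_of_def)
  obtain k where k: "k \<in> int_lattice" "transpose A *v \<xi> = (2 * pi) *\<^sub>R k"
    using assms by (auto simp: dual_lattice_def)
  have "\<xi> \<bullet> \<gamma> = (transpose A *v \<xi>) \<bullet> z"
    by (simp add: z dot_lmul_matrix)
  also have "\<dots> = 2 * pi * (k \<bullet> z)" unfolding k by simp
  finally show "wave \<xi> c (x + \<gamma>) = wave \<xi> c x"
    using z k by (intro wave_periodic) (auto simp: inner_vec_def int_lattice_def intro!: Ints_sum)
qed

lemma wave_mult:
  "wave \<xi> c x * wave \<xi>' c' x = wave (\<xi> + \<xi>') (c * c' / 2) x + wave (\<xi> - \<xi>') (c * cnj c' / 2) x"
proof -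
  have 1: "cis ((\<xi> + \<xi>') \<bullet> x) = cis (\<xi> \<bullet> x) * cis (\<xi>' \<bullet> x)"
    by (simp add: inner_add_left cis_mult)
  have 2: "cis ((\<xi> - \<xi>') \<bullet> x) = cis (\<xi> \<bullet> x) * cnj (cis (\<xi>' \<bullet> x))"
    by (simp add: inner_diff_left cis_cnj cis_mult)
  show ?thesis unfolding wave_def 1 2 by (simp add: field_simps)
qed

text \<open>The product formula for cosines needs both sums and differences of frequencies. Under
  this closure trigonometric sums form an algebra, as polynomial approximation requires.\<close>

lemma trig_sum_mult:
  assumes S: "\<And>\<xi> \<xi>'. \<xi> \<in> S \<Longrightarrow> \<xi>' \<in> S \<Longrightarrow> \<xi> + \<xi>' \<in> S" "\<And>\<xi> \<xi>'. \<xi> \<in> S \<Longrightarrow> \<xi>' \<in> S \<Longrightarrow> \<xi> - \<xi>' \<in> S"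
    and f: "trig_sum S f" and g: "trig_sum S g"
  shows "trig_sum S (\<lambda>x. f x * g x)"
proof -
  have w: "trig_sum S (\<lambda>x. wave \<xi> c x * g x)" if "\<xi> \<in> S" for \<xi> c
    using g
  proof (induction rule: trig_sum.induct)
    case zero
    show ?case by (simp add: trig_sum.zero)
  next
    case (insert \<xi>' g c')
    then show ?case unfolding distrib_left wave_mult
      by (intro trig_sum_add trig_sum_wave S that)
  qed
  show ?thesis using f
  proof (induction rule: trig_sum.induct)
    case zero
    show ?case by (simp add: trig_sum.zero)
  next
    case (insert \<xi> f c)
    then show ?case unfolding distrib_right by (intro trig_sum_add w)
  qed
qed

section \<open>Completeness of plane waves on the torus\<close>

lemma int_coord_decomposition:
  fixes x :: "real ^ 'n"
  obtains y z where "x = y + z" "z \<in> int_lattice" "y \<in> cbox 0 One"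
proof -
  define z :: "real ^ 'n" where "z = (\<chi> i. of_int \<lfloor>x $ i\<rfloor>)"
  have "(One :: real ^ 'n) $ i = 1" for i
  proof -
    have "(One :: real ^ 'n) $ i = (One :: real ^ 'n) \<bullet> axis i 1" by (simp add: inner_axis)
    also have "\<dots> = 1"
    proof -
      have "One \<bullet> b = 1" if "b \<in> Basis" for b :: "real ^ 'n"
        using that by (simp add: inner_sum_left inner_Basis)
      then show ?thesis by (simp add: axis_in_Basis_iff)
    qed
    finally show ?thesis .
  qed
  then have "x - z \<in> cbox 0 One"
    by (auto simp: mem_box_cart z_def) linarith
  then show thesis by (intro that[of "x - z" z]) (auto simp: z_def int_lattice_def)
qed

text \<open>A continuous periodic function factors through the compact image of \<open>x \<mapsto> (cis (\<xi>\<^sub>j \<bullet> x))\<^sub>j\<close>,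
  where \<open>\<xi>\<^sub>j\<close> is a basis of the dual lattice, and polynomials on the image are trigonometric sums.\<close>

lemma trig_sum_dense_periodic:
  fixes A :: "real ^ 'n ^ 'n" and f :: "real ^ 'n \<Rightarrow> real"
  assumes A: "invertible A" and f: "lattice_periodic A f" "continuous_on UNIV f" and e: "e > 0"
  obtains P where "trig_sum (dual_lattice A) P" "\<And>x. \<bar>f x - P x\<bar> < e"
proof -
  obtain A' where A': "A ** A' = mat 1" "A' ** A = mat 1" using A unfolding invertible_def by blast
  define \<xi> where "\<xi> = (\<lambda>j. (2 * pi) *\<^sub>R (transpose A' *v axis j 1))"
  have \<xi>D: "\<xi> j \<in> dual_lattice A" for j
  proof -
    have "transpose A *v \<xi> j = (2 * pi) *\<^sub>R (transpose A *v (transpose A' *v axis j 1))"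
      unfolding \<xi>_def by (rule matrix_vector_mult_scaleR)
    also have "transpose A *v (transpose A' *v axis j 1) = axis j 1"
      unfolding matrix_vector_mul_assoc matrix_transpose_mul[symmetric] A' by simp
    finally show ?thesis unfolding dual_lattice_def using axis_in_int_lattice by blast
  qed
  have \<xi>A: "\<xi> j \<bullet> (A *v y) = 2 * pi * y $ j" for j y
  proof -
    have "(transpose A' *v axis j 1) \<bullet> (A *v y) = axis j 1 \<bullet> (A' *v (A *v y))"
      by (simp add: dot_lmul_matrix)
    then show ?thesis by (simp add: \<xi>_def matrix_vector_mul_assoc A' inner_axis')
  qed
  define E :: "real ^ 'n \<Rightarrow> complex ^ 'n" where "E = (\<lambda>x. \<chi> j. cis (\<xi> j \<bullet> x))"
  define Q where "Q = (\<lambda>y. A *v y) ` cbox 0 One"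
  have cQ: "compact Q" unfolding Q_def
    by (intro compact_continuous_image matrix_vector_mult_linear_continuous_on compact_cbox)
  have cE: "continuous_on S E" for S
    unfolding E_def cis_conv_exp by (intro continuous_intros)
  \<comment> \<open>Equality of all phases means that the coordinates with respect to
    \<open>A\<close> differ by integers, so the points agree modulo the lattice.\<close>
  have per: "f x = f x'" if "E x = E x'" for x x'
  proof -
    have z: "(A' *v x - A' *v x') $ j \<in> \<int>" for j
    proof -
      have "cis (\<xi> j \<bullet> x) = cis (\<xi> j \<bullet> x')" using that by (simp add: E_def vec_eq_iff)
      then have "cis (\<xi> j \<bullet> (x - x')) = 1" by (simp add: inner_diff_right cis_divide[symmetric])
      moreover have "\<xi> j \<bullet> (x - x') = 2 * pi * (A' *v x - A' *v x') $ j"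
        using \<xi>A[of j "A' *v x - A' *v x'"]
        by (simp add: matrix_vector_mult_diff_distrib matrix_vector_mul_assoc A')
      ultimately have "cos (2 * pi * (A' *v x - A' *v x') $ j) = 1" by (metis cis.sel(1) one_complex.sel(1))
      then obtain n :: int where "2 * pi * (A' *v x - A' *v x') $ j = of_int n * 2 * pi"
        unfolding cos_one_2pi_int by blast
      then have "(A' *v x - A' *v x') $ j = of_int n" by simp
      then show ?thesis by simp
    qed
    have "x = x' + A *v (A' *v x - A' *v x')"
      by (simp add: matrix_vector_mult_diff_distrib matrix_vector_mul_assoc A')
    moreover have "A *v (A' *v x - A' *v x') \<in> lattice_of A"
      unfolding lattice_of_def using z by (intro imageI) (simp add: int_lattice_def)
    ultimately show ?thesis using f(1) unfolding lattice_periodic_def by metis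
  qed
  have rep: "\<exists>q\<in>Q. E q = E x" for x
  proof -
    obtain y z where yz: "A' *v x = y + z" "z \<in> int_lattice" "y \<in> cbox 0 One"
      by (rule int_coord_decomposition)
    have x: "x = A *v y + A *v z"
      using arg_cong[OF yz(1), of "\<lambda>t. A *v t"] by (simp add: matrix_vector_mul_assoc A' matrix_vector_right_distrib)
    have "cis (\<xi> j \<bullet> x) = cis (\<xi> j \<bullet> (A *v y))" for j
    proof -
      have "cis (\<xi> j \<bullet> (A *v z)) = 1" unfolding \<xi>A using yz(2) by (intro cis_multiple_2pi) (simp add: int_lattice_def)
      then show ?thesis unfolding x inner_add_right cis_mult[symmetric] by simp
    qed
    then show ?thesis using yz(3) by (intro bexI[of _ "A *v y"]) (auto simp: E_def Q_def)
  qed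
  define g where "g = (\<lambda>s. f (SOME q. q \<in> Q \<and> E q = s))"
  have gE: "g (E x) = f x" for x
  proof -
    have "\<exists>q. q \<in> Q \<and> E q = E x" using rep[of x] by blast
    from someI_ex[OF this] show ?thesis unfolding g_def using per by blast
  qed
  \<comment> \<open>On the compact set \<open>Q\<close> the map \<open>E\<close> is a quotient map
    onto its image, so \<open>g\<close> inherits continuity from \<open>f\<close>, its composition
    with \<open>E\<close>.\<close>
  have cg: "continuous_on (E ` Q) g"
  proof -
    have "openin (top_of_set (E ` Q)) (E ` Q \<inter> g -` U)" if U: "open U" for U
    proof (rule Abstract_Topology_2.continuous_imp_quotient_map[OF cE refl cQ, THEN iffD1])
      have "Q \<inter> E -` (E ` Q \<inter> g -` U) = Q \<inter> f -` U" by (auto simp: gE) (metis per)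
      moreover have "openin (top_of_set Q) (Q \<inter> f -` U)"
        by (rule continuous_openin_preimage_gen[OF continuous_on_subset[OF f(2)] U]) simp
      ultimately show "openin (top_of_set Q) (Q \<inter> E -` (E ` Q \<inter> g -` U))" by simp
    qed simp
    then show ?thesis by (subst continuous_on_open_gen[of g _ UNIV]) auto
  qed
  have cEQ: "compact (E ` Q)" by (rule compact_continuous_image[OF cE cQ])
  obtain p where p: "polynomial_function p" "\<forall>s\<in>E ` Q. norm (g s - p s) < e"
    using Stone_Weierstrass_polynomial_function[OF cEQ cg e] by (elim exE conjE)
  have "real_polynomial_function p" using p(1) by (simp add: real_polynomial_function_eq)
  then have P: "trig_sum (dual_lattice A) (\<lambda>x. p (E x))"
  proof (induction p rule: real_polynomial_function.induct)
    case (linear l)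
    interpret l: bounded_linear l by fact
    \<comment> \<open>The values of \<open>l\<close> on the real and imaginary axes are the cosine
      and sine coefficients; the minus sign arises because \<open>wave\<close> takes a real
      part.\<close>
    have "l (E x) = (\<Sum>j\<in>UNIV. wave (\<xi> j) (Complex (l (axis j 1)) (- l (axis j \<i>))) x)" for x
    proof -
      have "E x = (\<Sum>j\<in>UNIV. axis j (cis (\<xi> j \<bullet> x)))"
        by (simp add: E_def vec_eq_iff axis_def)
      also have "\<dots> = (\<Sum>j\<in>UNIV. cos (\<xi> j \<bullet> x) *\<^sub>R axis j 1 + sin (\<xi> j \<bullet> x) *\<^sub>R axis j \<i>)"
        by (intro sum.cong refl) (auto simp: vec_eq_iff axis_def complex_eq_iff)
      finally show ?thesis
        by (simp add: l.sum l.add l.scaleR wave_def mult.commute)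
    qed
    then show ?case by (simp add: trig_sum_sum trig_sum_wave \<xi>D)
  next
    case (const c)
    have "(\<lambda>x::real ^ 'n. c) = wave 0 (of_real c)" by (simp add: wave_def fun_eq_iff)
    then show ?case using trig_sum_wave[OF dual_lattice_0, of A "of_real c"] by simp
  next
    case (add p q)
    then show ?case by (intro trig_sum_add)
  next
    case (mult p q)
    then show ?case by (intro trig_sum_mult dual_lattice_add dual_lattice_diff)
  qed
  have "\<bar>f x - p (E x)\<bar> < e" for x
  proof -
    obtain q where "q \<in> Q" "E q = E x" using rep by blast
    then have "E x \<in> E ` Q" by (metis imageI)
    from bspec[OF p(2) this] show ?thesis by (simp add: gE)
  qed
  with P show thesis by (rule that)
qed

text \<open>For a trigonometric sum \<open>P\<close> within \<open>e\<close> of \<open>f\<close>,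
  the mean of \<open>f * f\<close> equals that of \<open>f * (f - P)\<close> and is at most
  \<open>e\<close> times the mean of the absolute value of \<open>f\<close>. Hence it is 0, and
  continuity and periodicity give the rest.\<close>

lemma lattice_periodic_eq_0:
  fixes A :: "real ^ 'n ^ 'n"
  assumes A: "invertible A" and f: "lattice_periodic A f" "continuous_on UNIV f"
    and orth: "\<And>\<xi> c. \<xi> \<in> dual_lattice A \<Longrightarrow> torus_mean A (\<lambda>x. f x * wave \<xi> c x) = 0"
  shows "f x = 0"
proof -
  have orthP: "torus_mean A (\<lambda>x. f x * P x) = 0" if "trig_sum (dual_lattice A) P" for P
    using that
  proof (induction rule: trig_sum.induct)
    case zero
    show ?case by (simp add: torus_mean_def)
  next
    case (insert \<xi> P c)
    have "torus_mean A (\<lambda>x. 1 * (f x * wave \<xi> c x) + 1 * (f x * P x)) = 1 * 0 + 1 * 0"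
      using torus_mean_lincomb[of "\<lambda>x. f x * wave \<xi> c x" "\<lambda>x. f x * P x" A 1 1]
        continuous_on_mult[OF f(2) smooth_continuous_on[OF smooth_wave[of \<xi> c]]]
        continuous_on_mult[OF f(2) smooth_continuous_on[OF trig_sum_smooth[OF insert.hyps(2)]]]
      by (simp add: orth insert)
    then show ?case by (simp add: distrib_left)
  qed
  define M where "M = torus_mean A (\<lambda>x. \<bar>f x\<bar>)"
  have ff: "torus_mean A (\<lambda>x. f x * f x) \<le> e * M" if e: "e > 0" for e
  proof -
    obtain P where P: "trig_sum (dual_lattice A) P" "\<And>x. \<bar>f x - P x\<bar> < e"
      using trig_sum_dense_periodic[OF A f e] by blast
    have cP: "continuous_on UNIV P" by (rule smooth_continuous_on[OF trig_sum_smooth[OF P(1)]])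
    have "torus_mean A (\<lambda>x. f x * f x) = torus_mean A (\<lambda>x. 1 * (f x * (f x - P x)) + 1 * (f x * P x))"
      by (simp add: algebra_simps)
    also have "\<dots> = torus_mean A (\<lambda>x. f x * (f x - P x))"
      by (subst torus_mean_lincomb) (auto intro!: continuous_intros f cP simp: orthP[OF P(1)])
    also have "\<dots> \<le> torus_mean A (\<lambda>x. e * \<bar>f x\<bar>)"
      unfolding torus_mean_def
    proof (rule integral_le)
      show "f (A *v y) * (f (A *v y) - P (A *v y)) \<le> e * \<bar>f (A *v y)\<bar>" for y
      proof -
        have "f (A *v y) * (f (A *v y) - P (A *v y)) \<le> \<bar>f (A *v y)\<bar> * \<bar>f (A *v y) - P (A *v y)\<bar>"
          by (metis abs_ge_self abs_mult)
        also have "\<dots> \<le> \<bar>f (A *v y)\<bar> * e" using P(2)[of "A *v y"] by (intro mult_left_mono) auto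
        finally show ?thesis by (simp add: mult.commute)
      qed
    qed (auto intro!: torus_mean_integrable continuous_intros f cP)
    also have "\<dots> = e * M" by (simp add: torus_mean_def M_def)
    finally show ?thesis .
  qed
  have "M \<ge> 0" unfolding M_def torus_mean_def
    by (intro integral_nonneg torus_mean_integrable continuous_intros f) auto
  have "torus_mean A (\<lambda>x. f x * f x) \<le> 0 + e" if e: "e > 0" for e
  proof -
    have "torus_mean A (\<lambda>x. f x * f x) \<le> e / (M + 1) * M"
      using e \<open>M \<ge> 0\<close> by (intro ff) simp
    also have "\<dots> \<le> e / (M + 1) * (M + 1)" using e \<open>M \<ge> 0\<close> by (intro mult_left_mono) auto
    finally show ?thesis using \<open>M \<ge> 0\<close> by simp
  qed
  then have "torus_mean A (\<lambda>x. f x * f x) \<le> 0" by (rule field_le_epsilon)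
  moreover have "torus_mean A (\<lambda>x. f x * f x) \<ge> 0"
    unfolding torus_mean_def by (intro integral_nonneg torus_mean_integrable continuous_intros f) auto
  ultimately have 0: "((\<lambda>y. f (A *v y) * f (A *v y)) has_integral 0) (cbox 0 One)"
    using integrable_integral[OF torus_mean_integrable[of "\<lambda>x. f x * f x" A]] f(2)
    by (simp add: torus_mean_def continuous_intros)
  have z: "f (A *v y) = 0" if "y \<in> cbox 0 One" for y
  proof -
    have "f (A *v y) * f (A *v y) = 0"
      by (rule has_integral_0_cbox_imp_0[OF _ _ 0 _ that])
         (auto intro!: continuous_intros continuous_on_lattice_coords f simp: box_ne_empty)
    then show ?thesis by simp
  qed
  obtain A' where A': "A ** A' = mat 1" using A unfolding invertible_def by blast
  obtain y z where yz: "A' *v x = y + z" "z \<in> int_lattice" "y \<in> cbox 0 One"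
    by (rule int_coord_decomposition)
  have "x = A *v y + A *v z"
    using arg_cong[OF yz(1), of "\<lambda>t. A *v t"] by (simp add: matrix_vector_mul_assoc A' matrix_vector_right_distrib)
  moreover have "A *v z \<in> lattice_of A" using yz(2) by (auto simp: lattice_of_def)
  ultimately have "f x = f (A *v y)" using f(1) by (auto simp: lattice_periodic_def)
  then show ?thesis using z[OF yz(3)] by simp
qed

text \<open>In the product formula the wave of frequency \<open>\<xi> + \<xi>\<close> is orthogonal
  to constants, which are eigenfunctions for the eigenvalue 0; the wave of frequency 0 is constant
  and supplies the value.\<close>

lemma torus_mean_wave_mult:
  fixes A :: "real ^ 'n ^ 'n"
  assumes A: "invertible A" and \<xi>: "\<xi> \<in> dual_lattice A" "\<xi> \<noteq> 0"
  shows "torus_mean A (\<lambda>x. wave \<xi> c x * wave \<xi> d x) = Re (c * cnj d) / 2"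
proof -
  have const: "wave 0 a = (\<lambda>x::real ^ 'n. Re a)" for a by (simp add: wave_def fun_eq_iff)
  have "torus_mean A (\<lambda>x. wave (\<xi> + \<xi>) (c * d / 2) x * 1) = 0"
  proof (rule torus_mean_eigenfunctions[OF A])
    show "lattice_periodic A (wave (\<xi> + \<xi>) (c * d / 2))"
      by (intro wave_lattice_periodic dual_lattice_add \<xi>)
    show "laplacian (wave (\<xi> + \<xi>) (c * d / 2)) x + ((\<xi> + \<xi>) \<bullet> (\<xi> + \<xi>)) * wave (\<xi> + \<xi>) (c * d / 2) x = 0" for x
      by (simp add: laplacian_wave)
    show "laplacian (\<lambda>x. 1) x + 0 * 1 = 0" for x :: "real ^ 'n"
      by (simp add: laplacian_def partials_const del: partials.simps)
    show "(\<xi> + \<xi>) \<bullet> (\<xi> + \<xi>) \<noteq> 0" using \<xi>(2) unfolding inner_add_left inner_add_right by simp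
  qed (auto simp: smooth_wave lattice_periodic_def)
  then have "torus_mean A (wave (\<xi> + \<xi>) (c * d / 2)) = 0" by simp
  moreover have "torus_mean A (\<lambda>x. wave \<xi> c x * wave \<xi> d x)
      = torus_mean A (\<lambda>x. 1 * wave (\<xi> + \<xi>) (c * d / 2) x + 1 * wave (\<xi> - \<xi>) (c * cnj d / 2) x)"
    by (simp only: wave_mult mult_1)
  moreover have "\<dots> = 1 * torus_mean A (wave (\<xi> + \<xi>) (c * d / 2)) + 1 * torus_mean A (wave (\<xi> - \<xi>) (c * cnj d / 2))"
    by (intro torus_mean_lincomb smooth_continuous_on smooth_wave)
  moreover have "torus_mean A (wave (\<xi> - \<xi>) (c * cnj d / 2)) = Re (c * cnj d) / 2"
    by (simp add: const torus_mean_def)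
  ultimately show ?thesis by simp
qed

lemma wave_uminus: "wave (- \<xi>) c = wave \<xi> (cnj c)"
  by (simp add: wave_def fun_eq_iff)

text \<open>Orthogonality and completeness provide a dual vector of squared length
  \<open>\<mu>\<close>. Its only companion of equal length is its negative, which gives the same
  real waves; subtracting the projection of \<open>u\<close> onto these leaves a function orthogonal
  to every wave.\<close>

lemma eigenfunction_simple_spectrum:
  fixes A :: "real ^ 'n ^ 'n"
  assumes A: "invertible A"
    and simple: "\<And>\<xi> \<xi>'. \<xi> \<in> dual_lattice A \<Longrightarrow> \<xi>' \<in> dual_lattice A \<Longrightarrow> norm \<xi> = norm \<xi>' \<Longrightarrow> \<xi>' = \<xi> \<or> \<xi>' = - \<xi>"
    and u: "torus_eigenfunction (lattice_of A) \<mu> u" and \<mu>: "\<mu> > 0"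
  shows "\<exists>\<xi> c. u = wave \<xi> c"
proof -
  have su: "smooth u" and pu: "lattice_periodic A u" and eu: "\<And>x. laplacian u x + \<mu> * u x = 0"
    and nz: "\<exists>x. u x \<noteq> 0"
    using u by (auto simp: torus_eigenfunction_def lattice_periodic_def)
  have orth: "torus_mean A (\<lambda>x. u x * wave \<xi> c x) = 0" if "\<xi> \<in> dual_lattice A" "\<xi> \<bullet> \<xi> \<noteq> \<mu>" for \<xi> c
  proof (rule torus_mean_eigenfunctions[OF A pu su eu wave_lattice_periodic[OF that(1)] smooth_wave])
    show "laplacian (wave \<xi> c) x + (\<xi> \<bullet> \<xi>) * wave \<xi> c x = 0" for x by (simp add: laplacian_wave)
  qed (use that in auto)
  obtain \<xi> where \<xi>: "\<xi> \<in> dual_lattice A" "\<xi> \<bullet> \<xi> = \<mu>"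
    using lattice_periodic_eq_0[OF A pu smooth_continuous_on[OF su]] orth nz by blast
  have \<xi>0: "\<xi> \<noteq> 0" using \<xi> \<mu> by auto
  define m where "m = (\<lambda>c. torus_mean A (\<lambda>x. u x * wave \<xi> c x))"
  \<comment> \<open>\<open>m 1\<close> and \<open>m (- \<i>)\<close> are the means of
    \<open>u\<close> against cosine and sine; \<open>c0\<close> solves
    \<open>Re (c0 * cnj c) / 2 = m c\<close> for all \<open>c\<close>.\<close>
  define c0 where "c0 = Complex (2 * m 1) (- 2 * m (- \<i>))"
  have m: "m c = Re c * m 1 - Im c * m (- \<i>)" for c
  proof -
    have "m c = torus_mean A (\<lambda>x. Re c * (u x * wave \<xi> 1 x) + (- Im c) * (u x * wave \<xi> (- \<i>) x))"
      by (simp add: m_def wave_def algebra_simps)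
    also have "\<dots> = Re c * m 1 + (- Im c) * m (- \<i>)"
      unfolding m_def by (rule torus_mean_lincomb) (intro continuous_intros smooth_continuous_on su smooth_wave)+
    finally show ?thesis by simp
  qed
  define w where "w = (\<lambda>x. 1 * u x + (- 1) * wave \<xi> c0 x)"
  have "w x = 0" for x
  proof (rule lattice_periodic_eq_0[OF A])
    show "lattice_periodic A w"
      using pu wave_lattice_periodic[OF \<xi>(1), of c0] unfolding lattice_periodic_def w_def by simp
    show "continuous_on UNIV w"
      unfolding w_def by (intro continuous_intros smooth_continuous_on su smooth_wave)
    fix \<eta> c assume \<eta>: "\<eta> \<in> dual_lattice A"
    have split: "torus_mean A (\<lambda>x. w x * wave \<eta> c x)
        = torus_mean A (\<lambda>x. u x * wave \<eta> c x) - torus_mean A (\<lambda>x. wave \<xi> c0 x * wave \<eta> c x)" for \<eta> c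
    proof -
      have "torus_mean A (\<lambda>x. w x * wave \<eta> c x)
         = torus_mean A (\<lambda>x. 1 * (u x * wave \<eta> c x) + (- 1) * (wave \<xi> c0 x * wave \<eta> c x))"
        by (simp add: w_def algebra_simps)
      also have "\<dots> = 1 * torus_mean A (\<lambda>x. u x * wave \<eta> c x) + (- 1) * torus_mean A (\<lambda>x. wave \<xi> c0 x * wave \<eta> c x)"
        by (rule torus_mean_lincomb) (intro continuous_intros smooth_continuous_on su smooth_wave)+
      finally show ?thesis by simp
    qed
    have same: "torus_mean A (\<lambda>x. w x * wave \<xi> c x) = 0" for c
      using m[of c] unfolding split torus_mean_wave_mult[OF A \<xi>(1) \<xi>0]
      by (simp add: m_def c0_def algebra_simps)
    show "torus_mean A (\<lambda>x. w x * wave \<eta> c x) = 0"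
    proof (cases "\<eta> \<bullet> \<eta> = \<mu>")
      case True
      then have "norm \<xi> = norm \<eta>" using \<xi>(2) by (simp add: norm_eq_sqrt_inner)
      then have "\<eta> = \<xi> \<or> \<eta> = - \<xi>" using simple \<xi>(1) \<eta> by blast
      then show ?thesis using same by (auto simp: wave_uminus)
    next
      case False
      have "torus_mean A (\<lambda>x. wave \<xi> c0 x * wave \<eta> c x) = 0"
      proof (rule torus_mean_eigenfunctions[OF A])
        show "laplacian (wave \<xi> c0) x + (\<xi> \<bullet> \<xi>) * wave \<xi> c0 x = 0" for x by (simp add: laplacian_wave)
        show "laplacian (wave \<eta> c) x + (\<eta> \<bullet> \<eta>) * wave \<eta> c x = 0" for x by (simp add: laplacian_wave)
      qed (use False \<xi> \<eta> in \<open>auto intro: wave_lattice_periodic smooth_wave\<close>)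
      then show ?thesis unfolding split using orth[OF \<eta> False] by simp
    qed
  qed
  then have "u = wave \<xi> c0" by (auto simp: w_def fun_eq_iff)
  then show ?thesis by blast
qed

section \<open>Generic lattices\<close>

text \<open>The supremum is over a bounded set: lists of bounded length are finite in number, and
  each derivative is bounded on the closed ball.\<close>

lemma Cl_norm_upper:
  fixes f :: "real ^ 'n \<Rightarrow> real"
  assumes f: "smooth f" and "length is \<le> l" "x \<in> ball c R"
  shows "\<bar>partials is f x\<bar> \<le> Cl_norm l (ball c R) f"
proof -
  let ?L = "{is :: 'n list. length is \<le> l}"
  have fin: "finite ?L" using finite_lists_length_le[of "UNIV :: 'n set" l] by simp
  have "bounded (partials js f ` cball c R)" for js
    by (intro compact_imp_bounded compact_continuous_image smooth_continuous_on smooth_partials f compact_cball)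
  then have "\<exists>B. \<forall>y\<in>cball c R. \<bar>partials js f y\<bar> \<le> B" for js
    unfolding bounded_iff by auto
  then obtain B where B: "\<And>js y. y \<in> cball c R \<Longrightarrow> \<bar>partials js f y\<bar> \<le> B js" by metis
  have "bdd_above ((\<lambda>(is, x). \<bar>partials is f x\<bar>) ` (?L \<times> ball c R))"
  proof (rule bdd_aboveI)
    fix t assume "t \<in> (\<lambda>(is, x). \<bar>partials is f x\<bar>) ` (?L \<times> ball c R)"
    then obtain js y where js: "js \<in> ?L" "y \<in> ball c R" "t = \<bar>partials js f y\<bar>" by auto
    have "\<bar>partials js f y\<bar> \<le> \<bar>B js\<bar>" using B[of y js] js by auto
    also have "\<dots> \<le> (\<Sum>js\<in>?L. \<bar>B js\<bar>)" using fin js by (intro member_le_sum) auto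
    finally show "t \<le> (\<Sum>js\<in>?L. \<bar>B js\<bar>)" using js by simp
  qed
  from cSUP_upper[OF _ this, of "(is, x)"] show ?thesis
    using assms by (simp add: Cl_norm_def)
qed

text \<open>Plane waves have parallel gradients at any two points, a property that passes to
  \<open>C\<^sup>1\<close> limits but fails for \<open>cos x\<^sub>i + cos x\<^sub>j\<close>.\<close>

lemma not_inverse_localization_simple_spectrum:
  fixes A :: "real ^ 'n ^ 'n"
  assumes d: "CARD('n) \<ge> 2" and A: "invertible A"
    and simple: "\<And>\<xi> \<xi>'. \<xi> \<in> dual_lattice A \<Longrightarrow> \<xi>' \<in> dual_lattice A \<Longrightarrow> norm \<xi> = norm \<xi>' \<Longrightarrow> \<xi>' = \<xi> \<or> \<xi>' = - \<xi>"
  shows "\<not> inverse_localization (lattice_of A)"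
proof
  assume IL: "inverse_localization (lattice_of A)"
  obtain i j :: 'n where ij: "i \<noteq> j"
    using d card_le_Suc0_iff_eq[of "UNIV :: 'n set"] by fastforce
  define h where "h = (\<lambda>x. wave (axis i 1 :: real ^ 'n) 1 x + wave (axis j 1) 1 x)"
  have h: "helmholtz_solution h"
    unfolding h_def by (intro trig_sum_helmholtz trig_sum_add trig_sum_wave) auto
  have sh: "smooth h" using h by (rule helmholtz_smooth)
  obtain u \<mu> where u: "\<And>n. torus_eigenfunction (lattice_of A) (\<mu> n) (u n)"
    and \<mu>: "filterlim \<mu> at_top sequentially"
    and lim: "(\<lambda>n. Cl_norm 1 (ball 0 2) (\<lambda>x. u n (x /\<^sub>R sqrt (\<mu> n)) - h x)) \<longlonglongrightarrow> 0"
    using IL[unfolded inverse_localization_def, rule_format, of h 2 1 0] h by auto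
  define f where "f = (\<lambda>n x. u n (x /\<^sub>R sqrt (\<mu> n)))"
  have sf: "smooth (f n)" for n
    using u[of n] unfolding f_def torus_eigenfunction_def by (intro smooth_dilate) blast
  have conv: "(\<lambda>n. partial k (f n) x) \<longlonglongrightarrow> partial k h x" if x: "x \<in> ball 0 2" for k x
  proof -
    have "norm (partial k (f n) x - partial k h x) \<le> Cl_norm 1 (ball 0 2) (\<lambda>x. u n (x /\<^sub>R sqrt (\<mu> n)) - h x)" for n
      using Cl_norm_upper[OF smooth_diff[OF sf[of n] sh], of "[k]" 1 x 0 2] x partials_diff[OF sf[of n] sh, of "[k]"]
      by (simp add: f_def)
    then have "(\<lambda>n. partial k (f n) x - partial k h x) \<longlonglongrightarrow> 0"
      by (intro Lim_null_comparison[OF _ lim]) auto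
    then show ?thesis by (simp add: LIM_zero_iff)
  qed
  have ev: "\<forall>\<^sub>F n in sequentially. partial i (f n) x * partial j (f n) y = partial j (f n) x * partial i (f n) y" for x y
  proof -
    have "\<forall>\<^sub>F n in sequentially. \<mu> n > 0" using \<mu> by (simp add: filterlim_at_top_dense)
    then show ?thesis
    proof eventually_elim
      case (elim n)
      obtain \<xi> c where w: "u n = wave \<xi> c"
        using eigenfunction_simple_spectrum[OF A simple u elim] by blast
      have "f n = wave (\<xi> /\<^sub>R sqrt (\<mu> n)) c"
        by (simp add: f_def w wave_def fun_eq_iff)
      then obtain \<zeta> where "f n = wave \<zeta> c" by blast
      \<comment> \<open>The gradient of a wave is the fixed vector \<open>\<zeta>\<close> times a
        scalar, so the 2x2 minors formed from gradients at two points vanish.\<close>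
      moreover have "partial k (wave \<zeta> c) x = \<zeta> $ k * Re (\<i> * c * cis (\<zeta> \<bullet> x))" for k x
        unfolding partial_wave wave_def by (simp add: algebra_simps)
      ultimately show ?case by (simp only: mult_ac)
    qed
  qed
  have xy: "axis i 1 \<in> ball (0 :: real ^ 'n) 2" "axis j 1 \<in> ball (0 :: real ^ 'n) 2" by simp_all
  \<comment> \<open>At \<open>axis i 1\<close> the \<open>i\<close>-th derivative of
    \<open>h\<close> is \<open>- sin 1\<close> and the \<open>j\<close>-th is 0; at
    \<open>axis j 1\<close> the roles are exchanged.\<close>
  let ?x = "axis i 1 :: real ^ 'n" and ?y = "axis j 1 :: real ^ 'n"
  have "(\<lambda>n. partial i (f n) ?x * partial j (f n) ?y) \<longlonglongrightarrow> partial i h ?x * partial j h ?y"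
    by (intro tendsto_mult conv xy)
  moreover have "(\<lambda>n. partial i (f n) ?x * partial j (f n) ?y) \<longlonglongrightarrow> partial j h ?x * partial i h ?y"
    by (rule Lim_transform_eventually[OF tendsto_mult[OF conv conv, OF xy]])
       (use ev[of ?x ?y] in \<open>auto elim: eventually_mono\<close>)
  ultimately have "partial i h ?x * partial j h ?y = partial j h ?x * partial i h ?y"
    by (rule LIMSEQ_unique)
  moreover have "partial k h x = - (axis i 1 $ k * sin (x $ i)) - axis j 1 $ k * sin (x $ j)" for k x
    using partials_add[OF smooth_wave smooth_wave, of "[k]" "axis i 1" 1 "axis j 1" 1]
    by (simp add: h_def partial_wave wave_def inner_axis')
  ultimately have "sin 1 * sin 1 = (0 :: real)" using ij by (simp add: axis_def)
  moreover have "sin (1 :: real) > 0" using pi_gt3 by (intro sin_gt_zero) auto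
  ultimately show False by simp
qed

text \<open>Averaging the translates of \<open>S\<close> by \<open>t *\<^sub>R v\<close> over
  \<open>t\<close> in \<open>{0..1}\<close> preserves its measure, and after exchanging the
  integrals the inner ones run over finite sets. This handles any direction \<open>v\<close> without
  a change of coordinates.\<close>

lemma negligible_if_line_sections_finite:
  fixes S :: "'a :: euclidean_space set"
  assumes S: "S \<in> sets borel" and fin: "\<And>x. finite {t :: real. x + t *\<^sub>R v \<in> S}"
  shows "negligible S"
proof -
  have m1: "(\<lambda>(x, t). indicator S (x + t *\<^sub>R v) * indicator {0..1} t :: ennreal)
      \<in> borel_measurable (lborel \<Otimes>\<^sub>M lborel)"
  proof -
    have "(\<lambda>p :: 'a \<times> real. fst p + snd p *\<^sub>R v) \<in> borel_measurable (lborel \<Otimes>\<^sub>M lborel)" by measurable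
    then have "(\<lambda>p :: 'a \<times> real. indicator S (fst p + snd p *\<^sub>R v) * indicator {0..1} (snd p) :: ennreal)
      \<in> borel_measurable (lborel \<Otimes>\<^sub>M lborel)"
      using S by measurable
    then show ?thesis by (simp add: split_beta)
  qed
  have "(\<integral>\<^sup>+t. (\<integral>\<^sup>+x. indicator S (x + t *\<^sub>R v) * indicator {0..1} t \<partial>lborel) \<partial>lborel)
      = (\<integral>\<^sup>+t. emeasure lborel S * indicator {0..1} (t::real) \<partial>lborel)"
  proof (intro nn_integral_cong)
    fix t :: real
    have "(\<integral>\<^sup>+x. indicator S (x + t *\<^sub>R v) \<partial>lborel) = (\<integral>\<^sup>+x. indicator S x \<partial>distr lborel borel ((+) (t *\<^sub>R v)))"
      using S by (subst nn_integral_distr) (auto simp: add.commute)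
    also have "\<dots> = emeasure lborel S"
      unfolding lborel_distr_plus using S by simp
    finally show "(\<integral>\<^sup>+x. indicator S (x + t *\<^sub>R v) * indicator {0..1} t \<partial>lborel) = emeasure lborel S * indicator {0..1} t"
      using S by (subst nn_integral_multc) auto
  qed
  also have "\<dots> = emeasure lborel S"
    by (subst nn_integral_cmult) auto
  finally have "emeasure lborel S = (\<integral>\<^sup>+t. (\<integral>\<^sup>+x. indicator S (x + t *\<^sub>R v) * indicator {0..1} t \<partial>lborel) \<partial>lborel)" ..
  also have "\<dots> = (\<integral>\<^sup>+x. (\<integral>\<^sup>+t. indicator S (x + t *\<^sub>R v) * indicator {0..1} t \<partial>lborel) \<partial>lborel)"
    using lborel_pair.Fubini'[OF m1] by simp
  also have "\<dots> = (\<integral>\<^sup>+x. 0 \<partial>(lborel :: 'a measure))"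
  proof (intro nn_integral_cong)
    fix x
    have "(\<integral>\<^sup>+t. indicator S (x + t *\<^sub>R v) * indicator {0..1} t \<partial>lborel)
        \<le> (\<integral>\<^sup>+t. indicator {t. x + t *\<^sub>R v \<in> S} t \<partial>lborel)"
      by (intro nn_integral_mono) (auto simp: indicator_def)
    also have "\<dots> = emeasure lborel {t. x + t *\<^sub>R v \<in> S}"
      using fin by (intro nn_integral_indicator) (simp add: borel_closed finite_imp_closed)
    also have "\<dots> = 0" by (rule emeasure_lborel_countable) (use fin in \<open>simp add: countable_finite\<close>)
    finally show "(\<integral>\<^sup>+t. indicator S (x + t *\<^sub>R v) * indicator {0..1} t \<partial>lborel) = 0" by simp
  qed
  finally have "S \<in> null_sets lborel" using S by (simp add: null_sets_def)
  then show ?thesis by (simp add: negligible_iff_null_sets null_sets_completionI)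
qed

text \<open>Along a rank one direction built from \<open>e\<close> and \<open>a\<close>, the
  difference of the squared norms is a polynomial in \<open>t\<close> with quadratic coefficient
  \<open>(a \<bullet> p) * (a \<bullet> q)\<close>. For suitable \<open>a\<close> this is nonzero,
  so lines in that direction meet the set finitely often.\<close>

lemma negligible_norm_coincidence:
  fixes k l :: "real ^ 'n"
  assumes "k \<noteq> l" "k \<noteq> - l"
  shows "negligible {B :: real ^ 'n ^ 'n. norm (B *v k) = norm (B *v l)}"
proof -
  define p q where "p = k - l" and "q = k + l"
  have pq: "p \<noteq> 0" "q \<noteq> 0" using assms by (auto simp: p_def q_def eq_neg_iff_add_eq_0)
  \<comment> \<open>For orthogonal \<open>p\<close> and \<open>q\<close> the inner products of
    \<open>p + q\<close> with them are their squared norms; otherwise \<open>p\<close> itself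
    works.\<close>
  obtain a where a: "a \<bullet> p \<noteq> 0" "a \<bullet> q \<noteq> 0"
  proof (cases "p \<bullet> q = 0")
    case True
    then show thesis using pq True by (intro that[of "p + q"]) (simp_all only: inner_add_left inner_commute[of q p] add_0_right add_0_left inner_eq_zero_iff not_False_eq_True)
  next
    case False
    then show thesis using pq by (intro that[of p]) auto
  qed
  define e :: "real ^ 'n" where "e = axis undefined 1"
  define V :: "real ^ 'n ^ 'n" where "V = (\<chi> i j. e $ i * a $ j)"
  have V: "V *v x = (a \<bullet> x) *\<^sub>R e" for x
    by (simp add: V_def matrix_vector_mult_def vec_eq_iff inner_vec_def sum_distrib_left mult_ac)
  define S where "S = {B :: real ^ 'n ^ 'n. norm (B *v k) = norm (B *v l)}"
  have cont: "continuous_on UNIV (\<lambda>B :: real ^ 'n ^ 'n. B *v x)" for x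
    unfolding matrix_vector_mult_def by (intro continuous_intros)
  have cl: "closed S"
    unfolding S_def by (intro closed_Collect_eq continuous_on_norm cont)
  have fin: "finite {t. B + t *\<^sub>R V \<in> S}" for B
  proof -
    define P where "P = [: (B *v k) \<bullet> (B *v k) - (B *v l) \<bullet> (B *v l),
        2 * ((B *v k) \<bullet> e * (a \<bullet> k) - (B *v l) \<bullet> e * (a \<bullet> l)), (a \<bullet> k)\<^sup>2 - (a \<bullet> l)\<^sup>2 :]"
    have "(a \<bullet> k)\<^sup>2 - (a \<bullet> l)\<^sup>2 = (a \<bullet> p) * (a \<bullet> q)"
      by (simp add: p_def q_def inner_diff_right inner_add_right power2_eq_square algebra_simps)
    then have "P \<noteq> 0" using a by (simp add: P_def)
    then have roots: "finite {t. poly P t = 0}" by (rule poly_roots_finite)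
    have "{t. B + t *\<^sub>R V \<in> S} \<subseteq> {t. poly P t = 0}"
    proof clarify
      fix t assume "B + t *\<^sub>R V \<in> S"
      then have "norm (B *v k + (t * (a \<bullet> k)) *\<^sub>R e) = norm (B *v l + (t * (a \<bullet> l)) *\<^sub>R e)"
        by (simp add: S_def matrix_vector_mult_add_rdistrib scaleR_matrix_vector_assoc[symmetric] V)
      then have "(B *v k + (t * (a \<bullet> k)) *\<^sub>R e) \<bullet> (B *v k + (t * (a \<bullet> k)) *\<^sub>R e)
         = (B *v l + (t * (a \<bullet> l)) *\<^sub>R e) \<bullet> (B *v l + (t * (a \<bullet> l)) *\<^sub>R e)"
        by (simp add: norm_eq)
      moreover have "(x + s *\<^sub>R e) \<bullet> (x + s *\<^sub>R e) = x \<bullet> x + 2 * s * (x \<bullet> e) + s * s" for x s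
      proof -
        have "e \<bullet> e = 1" "e \<bullet> x = x \<bullet> e" by (simp_all add: e_def inner_axis_axis inner_commute)
        then show ?thesis by (simp add: inner_add_left inner_add_right distrib_left)
      qed
      ultimately have "(B *v k) \<bullet> (B *v k) + 2 * (t * (a \<bullet> k)) * ((B *v k) \<bullet> e) + (t * (a \<bullet> k)) * (t * (a \<bullet> k))
         = (B *v l) \<bullet> (B *v l) + 2 * (t * (a \<bullet> l)) * ((B *v l) \<bullet> e) + (t * (a \<bullet> l)) * (t * (a \<bullet> l))"
        by (simp only:)
      then show "poly P t = 0"
        unfolding P_def by (simp add: power2_eq_square algebra_simps)
    qed
    then show ?thesis using roots by (rule finite_subset)
  qed
  have "negligible S"
    by (rule negligible_if_line_sections_finite[OF borel_closed[OF cl] fin])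
  then show ?thesis by (simp add: S_def)
qed

section \<open>Transfer of null sets under matrix inversion\<close>

lemma differentiable_det:
  fixes F :: "'a :: euclidean_space \<Rightarrow> real ^ 'n ^ 'n"
  assumes "\<And>i j. (\<lambda>x. F x $ i $ j) differentiable (at x)"
  shows "(\<lambda>x. det (F x)) differentiable (at x)"
proof -
  have P: "(\<lambda>x. \<Prod>i\<in>UNIV. F x $ i $ p i) differentiable (at x)" for p
    by (rule differentiableI, rule has_derivative_prod, rule frechet_derivative_works[THEN iffD1, OF assms])
  show ?thesis
    unfolding det_def
    by (intro differentiable_sum ballI differentiable_mult differentiable_const P finite_permutations finite)
qed

lemma matrix_inv_unique:
  fixes B C :: "real ^ 'n ^ 'n"
  assumes "B ** C = mat 1" "C ** B = mat 1"
  shows "matrix_inv B = C"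
proof -
  have "B ** matrix_inv B = mat 1 \<and> matrix_inv B ** B = mat 1"
    unfolding matrix_inv_def by (rule someI[of _ C]) (use assms in simp)
  then show ?thesis
    by (metis assms(2) matrix_mul_assoc matrix_mul_lid matrix_mul_rid)
qed

text \<open>By Cramer's rule the entries of the inverse are quotients of determinants.
  Differentiability is what lets inversion carry null sets to null sets.\<close>

lemma matrix_inv_differentiable_on:
  "(matrix_inv :: real ^ 'n ^ 'n \<Rightarrow> real ^ 'n ^ 'n) differentiable_on {B. invertible B}"
proof -
  define F :: "real ^ 'n ^ 'n \<Rightarrow> real ^ 'n ^ 'n" where
    "F = (\<lambda>B. \<chi> k c. det (\<chi> i j. if j = k then axis c 1 $ i else B $ i $ j) / det B)"
  have eq: "matrix_inv B = F B" if B: "invertible B" for B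
  proof -
    obtain C where C: "B ** C = mat 1" "C ** B = mat 1" using B unfolding invertible_def by blast
    have "C $ k $ c = F B $ k $ c" for k c
    proof -
      have "B *v (C *v axis c 1) = axis c 1" by (simp add: matrix_vector_mul_assoc C)
      then have "C *v axis c 1 = (\<chi> k. det (\<chi> i j. if j = k then axis c 1 $ i else B $ i $ j) / det B)"
        using cramer[of B "C *v axis c 1" "axis c 1"] B by (simp add: invertible_det_nz)
      moreover have "(C *v axis c 1) $ k = C $ k $ c"
        by (simp add: matrix_vector_mult_basis column_def)
      ultimately show ?thesis by (simp add: F_def)
    qed
    then show ?thesis unfolding matrix_inv_unique[OF C] by (simp add: vec_eq_iff)
  qed
  have "F differentiable (at B)" if B: "invertible B" for B
  proof -
    have entry: "(\<lambda>B :: real ^ 'n ^ 'n. B $ i $ j) differentiable (at x)" for i j x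
      by (intro bounded_linear_imp_differentiable bounded_linear_compose[OF bounded_linear_vec_nth bounded_linear_vec_nth])
    have "(\<lambda>B :: real ^ 'n ^ 'n. det (\<chi> i j. if j = k then axis c 1 $ i else B $ i $ j)) differentiable (at B)" for k c
    proof (rule differentiable_det)
      fix i j
      have "(\<lambda>B :: real ^ 'n ^ 'n. if j = k then axis c 1 $ i else B $ i $ j) differentiable (at B)"
        by (cases "j = k") (simp_all add: entry)
      then show "(\<lambda>B :: real ^ 'n ^ 'n. (\<chi> i j. if j = k then axis c 1 $ i else B $ i $ j) $ i $ j) differentiable (at B)"
        by simp
    qed
    moreover have "(\<lambda>B :: real ^ 'n ^ 'n. det B) differentiable (at B)"
      by (rule differentiable_det) (rule entry)
    ultimately have "(\<lambda>B. F B $ k $ c) differentiable (at B)" for k c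
      unfolding F_def using B by (simp add: invertible_det_nz)
    then have "(\<lambda>B. F B \<bullet> b) differentiable (at B)" if "b \<in> Basis" for b
      using that by (auto simp: Basis_vec_def inner_axis)
    then show ?thesis
      using differentiable_componentwise_within[of F B UNIV] by simp
  qed
  then have F: "F differentiable (at B within {B. invertible B})" if "invertible B" for B
    using that differentiable_at_withinI by blast
  show ?thesis
    unfolding differentiable_on_def
  proof
    fix B :: "real ^ 'n ^ 'n" assume B: "B \<in> {B. invertible B}"
    show "matrix_inv differentiable (at B within {B. invertible B})"
      by (rule differentiable_transform_within[OF F zero_less_one B]) (use B eq in auto)
  qed
qed

text \<open>The inverse transpose is an involution of the invertible matrices, so the set is
  contained in the image of a null set under a differentiable map.\<close>

lemma negligible_dual_norm_coincidence:
  fixes k l :: "real ^ 'n"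
  assumes "k \<noteq> l" "k \<noteq> - l"
  shows "negligible {A :: real ^ 'n ^ 'n. invertible A \<and>
    norm (transpose (matrix_inv A) *v k) = norm (transpose (matrix_inv A) *v l)}"
proof -
  define N where "N = {B :: real ^ 'n ^ 'n. invertible B \<and> norm (B *v k) = norm (B *v l)}"
  define g :: "real ^ 'n ^ 'n \<Rightarrow> real ^ 'n ^ 'n" where "g = (\<lambda>B. transpose (matrix_inv B))"
  have "negligible N"
    by (rule negligible_subset[OF negligible_norm_coincidence[OF assms]]) (auto simp: N_def)
  moreover have "g differentiable_on N"
  proof -
    have "linear (transpose :: real ^ 'n ^ 'n \<Rightarrow> real ^ 'n ^ 'n)"
      by (auto intro!: linearI simp: transpose_def vec_eq_iff)
    moreover have "(matrix_inv :: real ^ 'n ^ 'n \<Rightarrow> real ^ 'n ^ 'n) differentiable_on N"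
      by (rule differentiable_on_subset[OF matrix_inv_differentiable_on]) (auto simp: N_def)
    ultimately show ?thesis
      unfolding g_def by (rule differentiable_on_compose[OF _ linear_imp_differentiable_on, rotated])
  qed
  ultimately have "negligible (g ` N)" by (intro negligible_differentiable_image_negligible) auto
  moreover have "{A :: real ^ 'n ^ 'n. invertible A \<and>
    norm (transpose (matrix_inv A) *v k) = norm (transpose (matrix_inv A) *v l)} \<subseteq> g ` N"
  proof clarify
    fix A :: "real ^ 'n ^ 'n"
    assume A: "invertible A" and eq: "norm (transpose (matrix_inv A) *v k) = norm (transpose (matrix_inv A) *v l)"
    obtain C where C: "A ** C = mat 1" "C ** A = mat 1" using A unfolding invertible_def by blast
    have gA: "g A = transpose C" by (simp add: g_def matrix_inv_unique[OF C])
    have T: "transpose C ** transpose A = mat 1" "transpose A ** transpose C = mat 1"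
      by (simp_all add: matrix_transpose_mul[symmetric] C)
    have "A = g (g A)"
      unfolding gA by (simp add: g_def matrix_inv_unique[OF T])
    moreover have "g A \<in> N" using eq T unfolding N_def gA mem_Collect_eq invertible_def
      by (auto simp: gA[symmetric] g_def)
    ultimately show "A \<in> g ` N" by blast
  qed
  ultimately show ?thesis by (rule negligible_subset)
qed

lemma countable_int_lattice: "countable (int_lattice :: (real ^ 'n) set)"
proof (rule countable_subset)
  have "z \<in> range (\<lambda>f :: 'n \<Rightarrow> int. \<chi> i. of_int (f i))" if "z \<in> int_lattice" for z :: "real ^ 'n"
  proof -
    have "\<forall>i. \<exists>m :: int. z $ i = of_int m" using that by (auto simp: int_lattice_def Ints_def)
    then obtain f :: "'n \<Rightarrow> int" where "\<And>i. z $ i = of_int (f i)" by metis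
    then show ?thesis by (intro image_eqI[of _ _ f]) (auto simp: vec_eq_iff)
  qed
  then show "int_lattice \<subseteq> range (\<lambda>f :: 'n \<Rightarrow> int. (\<chi> i. of_int (f i)) :: real ^ 'n)" by blast
  have "countable (PiE (UNIV :: 'n set) (\<lambda>_. UNIV :: int set))" by (rule countable_PiE) auto
  then show "countable (range (\<lambda>f :: 'n \<Rightarrow> int. (\<chi> i. of_int (f i)) :: real ^ 'n))"
    by (simp add: PiE_UNIV_domain)
qed

theorem theorem1p3:
  assumes "CARD('n::finite) \<ge> 2"
  shows "{A :: real ^ 'n ^ 'n. invertible A \<and> inverse_localization (lattice_of A)}
           \<in> null_sets lebesgue
         \<and> (\<forall>\<Gamma> :: (real ^ 'n) set.
              full_rank_lattice \<Gamma> \<and> (\<exists>r>0. (\<lambda>x. r *\<^sub>R x) ` \<Gamma> \<subseteq> int_lattice)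
              \<longrightarrow> inverse_localization \<Gamma>)"
proof
  define I where "I = {p \<in> int_lattice \<times> (int_lattice :: (real ^ 'n) set). fst p \<noteq> snd p \<and> fst p \<noteq> - snd p}"
  define N where "N = (\<lambda>p :: (real ^ 'n) \<times> (real ^ 'n). {A :: real ^ 'n ^ 'n. invertible A \<and>
    norm (transpose (matrix_inv A) *v fst p) = norm (transpose (matrix_inv A) *v snd p)})"
  have "countable I"
    unfolding I_def by (intro countable_Collect countable_SIGMA countable_int_lattice)
  moreover have "negligible (N p)" if "p \<in> I" for p
    unfolding N_def using that by (intro negligible_dual_norm_coincidence) (auto simp: I_def)
  ultimately have "negligible (\<Union>p\<in>I. N p)"
    by (intro negligible_countable_Union) auto
  moreover have "{A :: real ^ 'n ^ 'n. invertible A \<and> inverse_localization (lattice_of A)} \<subseteq> (\<Union>p\<in>I. N p)"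
  proof clarify
    fix A :: "real ^ 'n ^ 'n" assume A: "invertible A" and IL: "inverse_localization (lattice_of A)"
    obtain C where C: "A ** C = mat 1" "C ** A = mat 1" using A unfolding invertible_def by blast
    obtain \<xi> \<xi>' where \<xi>: "\<xi> \<in> dual_lattice A" "\<xi>' \<in> dual_lattice A" "norm \<xi> = norm \<xi>'" "\<xi>' \<noteq> \<xi>" "\<xi>' \<noteq> - \<xi>"
      using not_inverse_localization_simple_spectrum[OF assms A] IL by blast
    \<comment> \<open>Dual vectors are \<open>2 * pi\<close> times images of integer vectors under
      the inverse transpose, which turns a coincidence of their lengths into membership in some
      \<open>N (k, l)\<close>.\<close>
    have rep: "\<exists>k\<in>int_lattice. \<eta> = (2 * pi) *\<^sub>R (transpose C *v k)" if \<eta>: "\<eta> \<in> dual_lattice A" for \<eta>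
    proof -
      obtain k where k: "k \<in> int_lattice" "transpose A *v \<eta> = (2 * pi) *\<^sub>R k"
        using \<eta> unfolding dual_lattice_def by blast
      have "transpose C *v (transpose A *v \<eta>) = \<eta>"
        unfolding matrix_vector_mul_assoc matrix_transpose_mul[symmetric] C by simp
      then have "\<eta> = (2 * pi) *\<^sub>R (transpose C *v k)"
        unfolding k matrix_vector_mult_scaleR ..
      with k show ?thesis by blast
    qed
    obtain k l where k: "k \<in> int_lattice" "\<xi> = (2 * pi) *\<^sub>R (transpose C *v k)"
      and l: "l \<in> int_lattice" "\<xi>' = (2 * pi) *\<^sub>R (transpose C *v l)"
      using rep \<xi> by meson
    have "k \<noteq> l" using \<xi>(4) k l by auto
    moreover have "k \<noteq> - l"
    proof
      assume kl: "k = - l"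
      have "\<xi> = - \<xi>'"
        unfolding k(2) l(2) kl linear_neg[OF matrix_vector_mul_linear] by simp
      then show False using \<xi>(5) by simp
    qed
    moreover have "norm (transpose C *v k) = norm (transpose C *v l)" using \<xi>(3) unfolding k l by simp
    ultimately show "A \<in> (\<Union>p\<in>I. N p)"
      using k l A by (intro UN_I[of "(k, l)"]) (auto simp: I_def N_def matrix_inv_unique[OF C])
  qed
  \<comment> \<open>Subsets of null sets are null by completeness of Lebesgue measure, which settles
    measurability as well.\<close>
  ultimately show "{A :: real ^ 'n ^ 'n. invertible A \<and> inverse_localization (lattice_of A)} \<in> null_sets lebesgue"
    using negligible_subset negligible_iff_null_sets by blast
next
  show "\<forall>\<Gamma> :: (real ^ 'n) set.
              full_rank_lattice \<Gamma> \<and> (\<exists>r>0. (\<lambda>x. r *\<^sub>R x) ` \<Gamma> \<subseteq> int_lattice)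
              \<longrightarrow> inverse_localization \<Gamma>"
    using inverse_localization_rational by blast
qed

end
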